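(* Let $E/F$ be the unramified quadratic extension of a non-Archimedean local field $F$ of odd residue characteristic, and let $\bar G=U(1,1)(F)$ and $G=SL_2(F)\subset\bar G$. Let $\bar\pi$ be an irreducible admissible supercuspidal representation of $\bar G$. The relation between its conductor $c(\bar\pi)$ and its minimal depth $\rho_0(\bar\pi)$ is given by $$\rho_0(\bar\pi)=\frac{c(\bar\pi)-2}{2}.$$ If $\pi$ is an irreducible subrepresentation of the restriction of $\bar\pi$ to $G$, then $$c(\bar\pi)=c(\pi).$$
   Context: Fields. $F$ is a non-Archimedean local field of odd residue characteristic with ring of integers $\mathcal{O}_F$, maximal ideal $\mathcal{P}_F$, uniformizer $\varpi_F$. $E/F$ is the unramified quadratic extension (with $\mathcal{O}_E,\mathcal{P}_E$ similarly), $s$ is the nontrivial element of $\mathrm{Gal}(E/F)$, $E^1=\ker(N_{E/F})\subset E^*$. Let $\alpha=\mathrm{diag}(\varpi_F,1)$. Conductor for $\bar G$. $\bar G=U(1,1)(F)$ is the group of $g\in GL_2(E)$ with ${}^s g\,J\,{}^t g=J$, where $J=\begin{pmatrix}0&1\\-1&0\end{pmatrix}$; its center is identified with $E^1$. $\bar K_0=\bar G\cap GL_2(\mathcal{O}_E)$; for $m\ge1$, $\bar K_m=\{\begin{pmatrix}a&b\\c&d\end{pmatrix}\in\bar K_0: c\in\mathcal{P}_E^m\}$; and $\bar K_m'=\alpha^{-1}\bar K_m\alpha$ for $m\ge0$. Let $(\bar\pi,V)$ be an irreducible admissible infinite-dimensional representation of $\bar G$ with central character $\omega_{\bar\pi}$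 (a character of $E^1$), and let $\bar\eta$ be a character of $\mathcal{O}_E^\times$ with $\bar\eta|_{E^1}=\omega_{\bar\pi}$. For $\bar H=\bar K_m$ or $\bar K'_m$, $$\bar\pi_{\bar\eta}^{\bar H}=\{v\in V:\bar\pi(g)v=\bar\eta(d)v\ \text{ for all } g=\begin{pmatrix}a&b\\c&d\end{pmatrix}\in\bar H\}.$$ For $m=0$, where $d$ need not be a unit, this is understood as follows: if $\bar\eta|_{\mathcal{O}_F^\times}\ne 1$ the space is $0$; if $\bar\eta|_{\mathcal{O}_F^\times}=1$, then $\bar\eta(d)$ is replaced by the character of $\bar K_0=SL_2(\mathcal{O}_F)\bar T_0$, $\bar T_0=\{\mathrm{diag}(t,s(t)^{-1}):t\in\mathcal{O}_E^\times\}$, sending $k\cdot\mathrm{diag}(t,s(t)^{-1})$ to $\bar\eta(s(t)^{-1})$ (and by its conjugate by $\alpha$ for $\bar K_0'$). Put $$c_{\bar\eta}(\bar\pi)=\min\{m\ge0:\bar\pi_{\bar\eta}^{\bar K_m}\neq0\text{ or }\bar\pi_{\bar\eta}^{\bar K_m'}\ne0\},\qquad c(\bar\pi)=\min\{c_{\bar\eta}(\bar\pi):\bar\eta|_{E^1}=\omega_{\bar\pi}\}.$$ Conductor for $G=SL_2(F)$. $K_0=SL_2(\mathcal{O}_F)$; for $m\ge1$, $K_m=\{\begin{pmatrix}a&b\\c&d\end{pmatrix}\in K_0:c\in\mathcal{P}_F^m\}$; $K_m'=\alpha^{-1}K_m\alpha$. For an irreducible admissible infinite-dimensional representation $(\pi,V)$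 of $G$, let $\omega_\pi(-1)$ be the scalar by which $-1\in G$ acts. Let $\eta$ be a character of $\mathcal{O}_F^\times$ with $\eta(-1)=\omega_\pi(-1)$, of conductor $c(\eta)$ (the least $n\ge0$ such that $\eta$ is trivial on $U_F^n$, where $U_F^0=\mathcal{O}_F^\times$, $U_F^n=1+\mathcal{P}_F^n$). For $m\ge c(\eta)$, $\pi_\eta^{K_m}$ (resp. $\pi_\eta^{K_m'}$) is the space of $v\in V$ with $\pi(g)v=\eta(d)v$ for all $g=\begin{pmatrix}a&b\\c&d\end{pmatrix}$ in $K_m$ (resp. $K_m'$), where for $m=0$ (so $\eta=1$) $\eta(d)$ means $1$; for $m<c(\eta)$ both spaces are $0$. Put $c_\eta(\pi)=\min\{m\ge0:\pi_\eta^{K_m}\ne0\text{ or }\pi_\eta^{K'_m}\neq0\}$ and $c(\pi)=\min\{c_\eta(\pi):\eta(-1)=\omega_\pi(-1)\}$. Depth. $\rho(\cdot)$ denotes the Moy–Prasad depth, and the minimal depth is $\rho_0(\bar\pi)=\min_\chi\rho(\bar\pi\otimes\chi)$, with $\chi$ ranging over all (one-dimensional) characters of $\bar G$. *)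

theory Defs
  imports "HOL-Analysis.Analysis" "HOL-Algebra.Generated_Groups"
begin

section \<open>Non-Archimedean local fields\<close>

text \<open>A discrete valuation is a function \<open>v :: 'a \<Rightarrow> int\<close> whose value at \<open>0\<close> is
  irrelevant; \<open>0\<close> is put into every power of the maximal ideal by hand.\<close>

definition ideal_power :: "('a::field \<Rightarrow> int) \<Rightarrow> int \<Rightarrow> 'a set" where
  "ideal_power v n = {x. x = 0 \<or> n \<le> v x}"

abbreviation integers :: "('a::field \<Rightarrow> int) \<Rightarrow> 'a set" where
  "integers v \<equiv> ideal_power v 0"

definition int_units :: "('a::field \<Rightarrow> int) \<Rightarrow> 'a set" where
  "int_units v = {x. x \<noteq> 0 \<and> v x = 0}"

locale nonarch_local_field =
  fixes v :: "'a::field \<Rightarrow> int"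
  assumes val_mult: "\<And>x y. x \<noteq> 0 \<Longrightarrow> y \<noteq> 0 \<Longrightarrow> v (x * y) = v x + v y"
    and val_add: "\<And>x y. x \<noteq> 0 \<Longrightarrow> y \<noteq> 0 \<Longrightarrow> x + y \<noteq> 0 \<Longrightarrow> min (v x) (v y) \<le> v (x + y)"
    and uniformizer_exists: "\<exists>x. x \<noteq> 0 \<and> v x = 1"
    and complete: "\<And>X :: nat \<Rightarrow> 'a.
      (\<forall>n. \<exists>N. \<forall>i\<ge>N. \<forall>j\<ge>N. X i - X j \<in> ideal_power v n) \<Longrightarrow>
      \<exists>L. \<forall>n. \<exists>N. \<forall>i\<ge>N. X i - L \<in> ideal_power v n"
    and finite_residue_field:
      "finite (integers v // {(x, y). x \<in> integers v \<and> y \<in> integers v \<and> x - y \<in> ideal_power v 1})"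

text \<open>The characteristic of the residue field, i.e. the additive order of \<open>1\<close> in it.\<close>

definition residue_char :: "('a::field \<Rightarrow> int) \<Rightarrow> nat" where
  "residue_char v = (LEAST p. 0 < p \<and> of_nat p \<in> ideal_power v 1)"

text \<open>The field \<open>E\<close> is the type \<open>'e\<close> and \<open>F\<close> the type \<open>'f\<close>, embedded by \<open>\<iota>\<close>. Both valuations are
  normalized (onto \<open>\<int>\<close>), so \<open>val_emb\<close> says that the valuation of \<open>E\<close> extends that of \<open>F\<close> with
  ramification index \<open>1\<close>. As residue fields are finite, residual separability is automatic.\<close>

locale unramified_quadratic_extension =
  F: nonarch_local_field vF + E: nonarch_local_field vE
  for vF :: "'f::field \<Rightarrow> int" and vE :: "'e::field \<Rightarrow> int" +
  fixes \<iota> :: "'f \<Rightarrow> 'e" and s :: "'e \<Rightarrow> 'e"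
  assumes emb_one: "\<iota> 1 = 1"
    and emb_add: "\<And>x y. \<iota> (x + y) = \<iota> x + \<iota> y"
    and emb_mult: "\<And>x y. \<iota> (x * y) = \<iota> x * \<iota> y"
    and degree_two: "vector_space.dim (\<lambda>a x. \<iota> a * x) (UNIV :: 'e set) = 2"
    and val_emb: "\<And>x. x \<noteq> 0 \<Longrightarrow> vE (\<iota> x) = vF x"
    and aut_bij: "bij s"
    and aut_add: "\<And>x y. s (x + y) = s x + s y"
    and aut_mult: "\<And>x y. s (x * y) = s x * s y"
    and aut_emb: "\<And>x. s (\<iota> x) = \<iota> x"
    and aut_nontrivial: "s \<noteq> id"

definition unit_filtration :: "('a::field \<Rightarrow> int) \<Rightarrow> nat \<Rightarrow> 'a set" where
  "unit_filtration v n = (if n = 0 then int_units v else {x. x - 1 \<in> ideal_power v (int n)})"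

text \<open>Characters of the unit group are smooth; the values of \<open>\<eta>\<close> off the units are irrelevant.\<close>

definition unit_character :: "('a::field \<Rightarrow> int) \<Rightarrow> ('a \<Rightarrow> complex) \<Rightarrow> bool" where
  "unit_character v \<eta> \<longleftrightarrow>
     (\<forall>x\<in>int_units v. \<eta> x \<noteq> 0) \<and>
     (\<forall>x\<in>int_units v. \<forall>y\<in>int_units v. \<eta> (x * y) = \<eta> x * \<eta> y) \<and>
     (\<exists>n. \<forall>x\<in>unit_filtration v n. \<eta> x = 1)"

definition character_conductor :: "('a::field \<Rightarrow> int) \<Rightarrow> ('a \<Rightarrow> complex) \<Rightarrow> nat" where
  "character_conductor v \<eta> = (LEAST n. \<forall>x\<in>unit_filtration v n. \<eta> x = 1)"

section \<open>The groups\<close>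

definition mat2 :: "'a::field \<Rightarrow> 'a \<Rightarrow> 'a \<Rightarrow> 'a \<Rightarrow> 'a^2^2" where
  "mat2 a b c d = vector [vector [a, b], vector [c, d]]"

definition matrix_group :: "('a::field^2^2) set \<Rightarrow> ('a^2^2) monoid" where
  "matrix_group S = \<lparr>carrier = S, mult = (**), one = mat 1\<rparr>"

definition U11 :: "('e::field \<Rightarrow> 'e) \<Rightarrow> ('e^2^2) monoid" where
  "U11 s = matrix_group {g. invertible g \<and>
     map_matrix s g ** mat2 0 1 (-1) 0 ** transpose g = mat2 0 1 (-1) 0}"

definition SL2 :: "('f::field^2^2) monoid" where
  "SL2 = matrix_group {g. det g = 1}"

definition SL2_integers :: "('f::field \<Rightarrow> int) \<Rightarrow> ('f^2^2) set" where
  "SL2_integers v = {g. det g = 1 \<and> (\<forall>i j. g $ i $ j \<in> integers v)}"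

definition GL2_integers :: "('e::field \<Rightarrow> int) \<Rightarrow> ('e^2^2) set" where
  "GL2_integers v = {g. det g \<in> int_units v \<and> (\<forall>i j. g $ i $ j \<in> integers v)}"

text \<open>Conjugation \<open>g \<mapsto> \<alpha>\<inverse> g \<alpha>\<close> with \<open>\<alpha> = diag(p, 1)\<close>, where \<open>p\<close> is meant to be a uniformizer.\<close>

definition alpha_conj :: "'a::field \<Rightarrow> 'a^2^2 \<Rightarrow> 'a^2^2" where
  "alpha_conj p g = matrix_inv (mat2 p 0 0 1) ** g ** mat2 p 0 0 1"

text \<open>Open subsets of a matrix group in its valuation topology.\<close>

definition open_in_group :: "('a::field \<Rightarrow> int) \<Rightarrow> ('a^2^2) monoid \<Rightarrow> ('a^2^2) set \<Rightarrow> bool" where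
  "open_in_group v G U \<longleftrightarrow> U \<subseteq> carrier G \<and>
     (\<forall>g\<in>U. \<exists>n. \<forall>h\<in>carrier G. (\<forall>i j. h $ i $ j - g $ i $ j \<in> ideal_power v n) \<longrightarrow> h \<in> U)"

section \<open>Representations\<close>

text \<open>A representation is carried by a subspace \<open>V\<close> of a complex vector space given by the scalar
  multiplication \<open>scl\<close>; only the values \<open>\<pi> g x\<close> with \<open>g\<close> in the group and \<open>x \<in> V\<close> matter.\<close>

definition representation ::
  "(complex \<Rightarrow> 'v \<Rightarrow> 'v::ab_group_add) \<Rightarrow> 'v set \<Rightarrow> ('g, 'm) monoid_scheme \<Rightarrow> ('g \<Rightarrow> 'v \<Rightarrow> 'v) \<Rightarrow> bool"
  where
  "representation scl V G \<pi> \<longleftrightarrow>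
     vector_space scl \<and> module.subspace scl V \<and>
     (\<forall>g\<in>carrier G. \<forall>x\<in>V. \<pi> g x \<in> V) \<and>
     (\<forall>g\<in>carrier G. \<forall>x\<in>V. \<forall>y\<in>V. \<pi> g (x + y) = \<pi> g x + \<pi> g y) \<and>
     (\<forall>g\<in>carrier G. \<forall>a. \<forall>x\<in>V. \<pi> g (scl a x) = scl a (\<pi> g x)) \<and>
     (\<forall>x\<in>V. \<pi> \<one>\<^bsub>G\<^esub> x = x) \<and>
     (\<forall>g\<in>carrier G. \<forall>h\<in>carrier G. \<forall>x\<in>V. \<pi> (g \<otimes>\<^bsub>G\<^esub> h) x = \<pi> g (\<pi> h x))"

definition irreducible_representation ::
  "(complex \<Rightarrow> 'v \<Rightarrow> 'v::ab_group_add) \<Rightarrow> 'v set \<Rightarrow> ('g, 'm) monoid_scheme \<Rightarrow> ('g \<Rightarrow> 'v \<Rightarrow> 'v) \<Rightarrow> bool"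
  where
  "irreducible_representation scl V G \<pi> \<longleftrightarrow>
     representation scl V G \<pi> \<and> V \<noteq> {0} \<and>
     (\<forall>W. module.subspace scl W \<and> W \<subseteq> V \<and> (\<forall>g\<in>carrier G. \<forall>x\<in>W. \<pi> g x \<in> W) \<longrightarrow>
        W = {0} \<or> W = V)"

text \<open>Letting \<open>K\<close> range over the compact open subgroups only would make no difference, as every
  open subgroup contains a compact open one.\<close>

definition admissible ::
  "('a::field \<Rightarrow> int) \<Rightarrow> (complex \<Rightarrow> 'v \<Rightarrow> 'v::ab_group_add) \<Rightarrow> 'v set \<Rightarrow> ('a^2^2) monoid \<Rightarrow>
   ('a^2^2 \<Rightarrow> 'v \<Rightarrow> 'v) \<Rightarrow> bool" where
  "admissible v scl V G \<pi> \<longleftrightarrow>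
     (\<forall>x\<in>V. open_in_group v G {g \<in> carrier G. \<pi> g x = x}) \<and>
     (\<forall>K. subgroup K G \<and> open_in_group v G K \<longrightarrow>
        (\<exists>B. finite B \<and> {x \<in> V. \<forall>g\<in>K. \<pi> g x = x} \<subseteq> module.span scl B))"

text \<open>Vanishing Jacquet module \<open>V / V(N)\<close>, where \<open>V(N)\<close> is the span of all \<open>\<pi>(n)x - x\<close>.
  Every proper parabolic subgroup of \<open>U(1,1)\<close> is conjugate to the Borel subgroup with unipotent
  radical \<open>N\<close>, the upper unitriangular matrices with entry in \<open>F\<close>.\<close>

definition supercuspidal ::
  "('f::field \<Rightarrow> 'e::field) \<Rightarrow> (complex \<Rightarrow> 'v \<Rightarrow> 'v::ab_group_add) \<Rightarrow> 'v set \<Rightarrow>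
   ('e^2^2 \<Rightarrow> 'v \<Rightarrow> 'v) \<Rightarrow> bool" where
  "supercuspidal \<iota> scl V \<pi> \<longleftrightarrow>
     module.span scl {\<pi> (mat2 1 (\<iota> b) 0 1) x - x | b x. x \<in> V} = V"

definition group_character ::
  "('a::field \<Rightarrow> int) \<Rightarrow> ('a^2^2) monoid \<Rightarrow> ('a^2^2 \<Rightarrow> complex) \<Rightarrow> bool" where
  "group_character v G \<theta> \<longleftrightarrow>
     (\<forall>g\<in>carrier G. \<theta> g \<noteq> 0) \<and>
     (\<forall>g\<in>carrier G. \<forall>h\<in>carrier G. \<theta> (g \<otimes>\<^bsub>G\<^esub> h) = \<theta> g * \<theta> h) \<and>
     open_in_group v G {g \<in> carrier G. \<theta> g = 1}"

definition twist ::
  "(complex \<Rightarrow> 'v \<Rightarrow> 'v) \<Rightarrow> ('g \<Rightarrow> 'v \<Rightarrow> 'v) \<Rightarrow> ('g \<Rightarrow> complex) \<Rightarrow> 'g \<Rightarrow> 'v \<Rightarrow> 'v" where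
  "twist scl \<pi> \<theta> g x = scl (\<theta> g) (\<pi> g x)"

section \<open>The conductor for \<open>U(1,1)\<close>\<close>

definition Kbar ::
  "('e::field \<Rightarrow> int) \<Rightarrow> ('e \<Rightarrow> 'e) \<Rightarrow> nat \<Rightarrow> ('e^2^2) set" where
  "Kbar vE s m = {g \<in> carrier (U11 s) \<inter> GL2_integers vE.
     m = 0 \<or> g $ 2 $ 1 \<in> ideal_power vE (int m)}"

text \<open>The space of vectors on which \<open>\<phi>(K\<^sub>m)\<close> acts through \<open>\<phi>(g) \<mapsto> \<eta>(d)\<close>, for \<open>\<phi>\<close> either the
  identity or conjugation by \<open>\<alpha>\<close>; neither changes the diagonal entries. For \<open>m = 0\<close> elements of the
  group are written as \<open>k diag(t, s(t)\<inverse>)\<close> with \<open>k \<in> SL\<^sub>2(O\<^sub>F)\<close>.\<close>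

definition Kbar_space ::
  "('f::field \<Rightarrow> int) \<Rightarrow> ('e::field \<Rightarrow> int) \<Rightarrow> ('f \<Rightarrow> 'e) \<Rightarrow> ('e \<Rightarrow> 'e) \<Rightarrow>
   (complex \<Rightarrow> 'v \<Rightarrow> 'v::ab_group_add) \<Rightarrow> 'v set \<Rightarrow> ('e^2^2 \<Rightarrow> 'v \<Rightarrow> 'v) \<Rightarrow>
   ('e^2^2 \<Rightarrow> 'e^2^2) \<Rightarrow> ('e \<Rightarrow> complex) \<Rightarrow> nat \<Rightarrow> 'v set" where
  "Kbar_space vF vE \<iota> s scl V \<pi> \<phi> \<eta> m =
     (if m = 0 then
        (if \<forall>u\<in>int_units vF. \<eta> (\<iota> u) = 1 then
           {x \<in> V. \<forall>k\<in>SL2_integers vF. \<forall>t\<in>int_units vE.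
              \<pi> (\<phi> (map_matrix \<iota> k ** mat2 t 0 0 (inverse (s t)))) x = scl (\<eta> (inverse (s t))) x}
         else {0})
      else {x \<in> V. \<forall>g\<in>Kbar vE s m. \<pi> (\<phi> g) x = scl (\<eta> (g $ 2 $ 2)) x})"

definition conductor_U11_at ::
  "('f::field \<Rightarrow> int) \<Rightarrow> ('e::field \<Rightarrow> int) \<Rightarrow> ('f \<Rightarrow> 'e) \<Rightarrow> ('e \<Rightarrow> 'e) \<Rightarrow> 'f \<Rightarrow>
   (complex \<Rightarrow> 'v \<Rightarrow> 'v::ab_group_add) \<Rightarrow> 'v set \<Rightarrow> ('e^2^2 \<Rightarrow> 'v \<Rightarrow> 'v) \<Rightarrow>
   ('e \<Rightarrow> complex) \<Rightarrow> nat" where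
  "conductor_U11_at vF vE \<iota> s p scl V \<pi> \<eta> =
     (LEAST m. Kbar_space vF vE \<iota> s scl V \<pi> id \<eta> m \<noteq> {0} \<or>
               Kbar_space vF vE \<iota> s scl V \<pi> (alpha_conj (\<iota> p)) \<eta> m \<noteq> {0})"

text \<open>\<open>\<eta>\<close> restricts to the central character of \<open>\<pi>\<close> on \<open>E\<^sup>1\<close>, the kernel of the norm.\<close>

definition extends_central_character ::
  "('e::field \<Rightarrow> 'e) \<Rightarrow> (complex \<Rightarrow> 'v \<Rightarrow> 'v) \<Rightarrow> 'v set \<Rightarrow> ('e^2^2 \<Rightarrow> 'v \<Rightarrow> 'v) \<Rightarrow>
   ('e \<Rightarrow> complex) \<Rightarrow> bool" where
  "extends_central_character s scl V \<pi> \<eta> \<longleftrightarrow>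
     (\<forall>z. z * s z = 1 \<longrightarrow> (\<forall>x\<in>V. \<pi> (mat z) x = scl (\<eta> z) x))"

definition conductor_U11 ::
  "('f::field \<Rightarrow> int) \<Rightarrow> ('e::field \<Rightarrow> int) \<Rightarrow> ('f \<Rightarrow> 'e) \<Rightarrow> ('e \<Rightarrow> 'e) \<Rightarrow> 'f \<Rightarrow>
   (complex \<Rightarrow> 'v \<Rightarrow> 'v::ab_group_add) \<Rightarrow> 'v set \<Rightarrow> ('e^2^2 \<Rightarrow> 'v \<Rightarrow> 'v) \<Rightarrow> nat" where
  "conductor_U11 vF vE \<iota> s p scl V \<pi> =
     (LEAST c. \<exists>\<eta>. unit_character vE \<eta> \<and> extends_central_character s scl V \<pi> \<eta> \<and>
                   c = conductor_U11_at vF vE \<iota> s p scl V \<pi> \<eta>)"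

section \<open>The conductor for \<open>SL\<^sub>2(F)\<close>\<close>

definition K_SL2 :: "('f::field \<Rightarrow> int) \<Rightarrow> nat \<Rightarrow> ('f^2^2) set" where
  "K_SL2 v m = {g \<in> SL2_integers v. m = 0 \<or> g $ 2 $ 1 \<in> ideal_power v (int m)}"

definition K_SL2_space ::
  "('f::field \<Rightarrow> int) \<Rightarrow> (complex \<Rightarrow> 'v \<Rightarrow> 'v::ab_group_add) \<Rightarrow> 'v set \<Rightarrow>
   ('f^2^2 \<Rightarrow> 'v \<Rightarrow> 'v) \<Rightarrow> ('f^2^2 \<Rightarrow> 'f^2^2) \<Rightarrow> ('f \<Rightarrow> complex) \<Rightarrow> nat \<Rightarrow> 'v set" where
  "K_SL2_space v scl V \<pi> \<phi> \<eta> m =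
     (if m < character_conductor v \<eta> then {0}
      else {x \<in> V. \<forall>g\<in>K_SL2 v m. \<pi> (\<phi> g) x = scl (if m = 0 then 1 else \<eta> (g $ 2 $ 2)) x})"

definition conductor_SL2_at ::
  "('f::field \<Rightarrow> int) \<Rightarrow> 'f \<Rightarrow> (complex \<Rightarrow> 'v \<Rightarrow> 'v::ab_group_add) \<Rightarrow> 'v set \<Rightarrow>
   ('f^2^2 \<Rightarrow> 'v \<Rightarrow> 'v) \<Rightarrow> ('f \<Rightarrow> complex) \<Rightarrow> nat" where
  "conductor_SL2_at v p scl V \<pi> \<eta> =
     (LEAST m. K_SL2_space v scl V \<pi> id \<eta> m \<noteq> {0} \<or>
               K_SL2_space v scl V \<pi> (alpha_conj p) \<eta> m \<noteq> {0})"

definition conductor_SL2 ::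
  "('f::field \<Rightarrow> int) \<Rightarrow> 'f \<Rightarrow> (complex \<Rightarrow> 'v \<Rightarrow> 'v::ab_group_add) \<Rightarrow> 'v set \<Rightarrow>
   ('f^2^2 \<Rightarrow> 'v \<Rightarrow> 'v) \<Rightarrow> nat" where
  "conductor_SL2 v p scl V \<pi> =
     (LEAST c. \<exists>\<eta>. unit_character v \<eta> \<and> (\<forall>x\<in>V. \<pi> (mat (-1)) x = scl (\<eta> (-1)) x) \<and>
                   c = conductor_SL2_at v p scl V \<pi> \<eta>)"

section \<open>Moy--Prasad depth for \<open>U(1,1)\<close>\<close>

text \<open>The apartment of the diagonal torus \<open>{diag(t, s(t)\<inverse>)}\<close> is identified with \<open>\<real>\<close> by the value
  \<open>y\<close> of the positive root, with origin at the vertex fixed by \<open>U(1,1) \<inter> GL\<^sub>2(O\<^sub>E)\<close>. For \<open>r > 0\<close> the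
  group \<open>G\<^sub>y\<^sub>,\<^sub>r\<close> is generated by the \<open>r\<close>-th filtration subgroup of the torus and the affine root
  subgroups whose affine root is at least \<open>r\<close> at \<open>y\<close>; the root groups are isomorphic to \<open>F\<close>.\<close>

definition moy_prasad ::
  "('f::field \<Rightarrow> int) \<Rightarrow> ('e::field \<Rightarrow> int) \<Rightarrow> ('f \<Rightarrow> 'e) \<Rightarrow> ('e \<Rightarrow> 'e) \<Rightarrow> real \<Rightarrow> real \<Rightarrow>
   ('e^2^2) set" where
  "moy_prasad vF vE \<iota> s y r = generate (U11 s)
     ({mat2 t 0 0 (inverse (s t)) | t. t = 1 \<or> (t \<noteq> 0 \<and> r \<le> real_of_int (vE (t - 1)))} \<union>
      {mat2 1 (\<iota> b) 0 1 | b. b = 0 \<or> r \<le> real_of_int (vF b) + y} \<union>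
      {mat2 1 0 (\<iota> c) 1 | c. c = 0 \<or> r \<le> real_of_int (vF c) - y})"

definition moy_prasad_plus ::
  "('f::field \<Rightarrow> int) \<Rightarrow> ('e::field \<Rightarrow> int) \<Rightarrow> ('f \<Rightarrow> 'e) \<Rightarrow> ('e \<Rightarrow> 'e) \<Rightarrow> real \<Rightarrow> real \<Rightarrow>
   ('e^2^2) set" where
  "moy_prasad_plus vF vE \<iota> s y r = (\<Union>r'\<in>{r<..}. moy_prasad vF vE \<iota> s y r')"

text \<open>Every point of the building is a translate \<open>g y\<close> of a point of the apartment, and the
  filtration subgroups at \<open>g y\<close> are the conjugates by \<open>g\<close> of those at \<open>y\<close>.\<close>

definition depth ::
  "('f::field \<Rightarrow> int) \<Rightarrow> ('e::field \<Rightarrow> int) \<Rightarrow> ('f \<Rightarrow> 'e) \<Rightarrow> ('e \<Rightarrow> 'e) \<Rightarrow> 'v::ab_group_add set \<Rightarrow>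
   ('e^2^2 \<Rightarrow> 'v \<Rightarrow> 'v) \<Rightarrow> real" where
  "depth vF vE \<iota> s V \<pi> =
     (LEAST r. 0 \<le> r \<and> (\<exists>g\<in>carrier (U11 s). \<exists>y. \<exists>x\<in>V. x \<noteq> 0 \<and>
        (\<forall>h\<in>moy_prasad_plus vF vE \<iota> s y r. \<pi> (g ** h ** matrix_inv g) x = x)))"

definition minimal_depth ::
  "('f::field \<Rightarrow> int) \<Rightarrow> ('e::field \<Rightarrow> int) \<Rightarrow> ('f \<Rightarrow> 'e) \<Rightarrow> ('e \<Rightarrow> 'e) \<Rightarrow>
   (complex \<Rightarrow> 'v \<Rightarrow> 'v::ab_group_add) \<Rightarrow> 'v set \<Rightarrow> ('e^2^2 \<Rightarrow> 'v \<Rightarrow> 'v) \<Rightarrow> real" where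
  "minimal_depth vF vE \<iota> s scl V \<pi> =
     (LEAST r. \<exists>\<theta>. group_character vE (U11 s) \<theta> \<and> r = depth vF vE \<iota> s V (twist scl \<pi> \<theta>))"

end

theory Submission
  imports Defs
begin

text \<open>Write \<open>N(b)\<close>, \<open>N\<^sup>-(c)\<close> for the unipotents and \<open>T(d) = diag(s(d)\<inverse>, d)\<close>. Both invariants are
  read off from the least \<open>m\<close> for which some nonzero vector is fixed by \<open>N(P\<^sup>i)\<close> and \<open>N\<^sup>-(P\<^sup>j)\<close> with
  \<open>i + j = m\<close>. The compact torus acts on such vectors through finite abelian quotients, so there are
  eigenvectors, and by the Iwahori factorization these are the vectors in the definition of \<open>c\<close>.
  For \<open>SL\<^sub>2\<close> one projects a vector to one of finitely many conjugates of the constituent.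

  Supercuspidality enters as follows. If \<open>T(d)\<close> acts on a vector of level \<open>m\<close> through a
  character \<open>\<eta>\<close> and \<open>m \<le> 1\<close> or \<open>\<eta>\<close> has conductor larger than \<open>m/2\<close>, then, after lowering \<open>m\<close> to the
  conductor by conjugation with unipotents, averaging over \<open>N(P\<^sup>i\<^sup>-\<^sup>1)\<close> gives a nonzero vector of the
  same kind; iterating contradicts \<open>V = V(N)\<close>. Hence \<open>m \<ge> 2\<close> and \<open>\<eta>\<close> is trivial on \<open>1 + P\<^sup>n\<close> with
  \<open>n = \<lfloor>m/2\<rfloor>\<close>, and, after twisting away the central character on one-units, the vector is fixed
  by a Moy--Prasad subgroup of depth \<open>(m - 2)/2\<close>.

  That every compatible \<open>\<eta>\<close> has a finite conductor follows as in the Kirillov model: the characters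
  of \<open>N\<close> occurring in \<open>V\<close> are permuted by \<open>T\<close> through the norm.\<close>

section \<open>Transversals\<close>

text \<open>Integrals are replaced by finite sums over representatives of \<open>P a\<close> modulo
  \<open>P (a + 1)\<close>. Both conductors are minima over \<open>\<eta>\<close> of minima over
  \<open>m\<close>, and \<open>LEAST\<close> of an empty set is unspecified. One vector of small
  level is therefore not enough: every compatible \<open>\<eta>\<close> has to occur at some level.
  This works because norm-one torus elements are central, so centrality is the only constraint on
  \<open>\<eta>\<close>. A torus element over \<open>F\<close> changes \<open>(i, j)\<close> by even
  amounts with the same sum; the two parities of \<open>i\<close> are the two families
  \<open>K\<^sub>m\<close> and \<open>K\<^sub>m'\<close>. Unipotent invariance just above depth
  \<open>r\<close> at a point of the apartment has \<open>i + j\<close> at most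
  \<open>2 * r + 2\<close>. This gives one inequality at once. For the other, the torus must also
  act trivially beyond depth \<open>r\<close>. A torus element close to 1 is a product of an element
  of \<open>F\<close> close to 1 and a central one, by a square root of its norm. Cuspidality
  controls \<open>\<eta>\<close> on the first factor, a twist on the second.\<close>

definition transversal :: "('a \<Rightarrow> 'a \<Rightarrow> bool) \<Rightarrow> 'a set \<Rightarrow> 'a set \<Rightarrow> bool" where
  "transversal R A S \<longleftrightarrow> equivp R \<and> finite S \<and> S \<subseteq> A \<and> (\<forall>x\<in>A. \<exists>!s. s \<in> S \<and> R x s)"

text \<open>The choice \<open>c x\<close> depends only on the class of \<open>x\<close>, because
  \<open>R x y\<close> makes the predicates \<open>R x\<close> and \<open>R y\<close> equal. The set
  \<open>T\<close> need not lie in \<open>A\<close>; it only bounds the number of classes that meet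
  \<open>A\<close>.\<close>

lemma transversal_exists:
  assumes R: "equivp R" and T: "finite T" "\<And>x. x \<in> A \<Longrightarrow> \<exists>t\<in>T. R x t"
  obtains S where "transversal R A S"
proof -
  define c where "c x = (SOME y. y \<in> A \<and> R x y)" for x
  have c: "c x \<in> A \<and> R x (c x)" if "x \<in> A" for x
    unfolding c_def by (rule someI[of _ x]) (use that R in \<open>auto simp: equivp_reflp\<close>)
  have same: "c x = c y" if "R x y" for x y
    using that R unfolding c_def by (simp add: equivp_def)
  have "c ` A \<subseteq> c ` T"
    using T(2) same by fast
  then have "finite (c ` A)"
    using T(1) finite_surj by blast
  moreover have "\<exists>!s. s \<in> c ` A \<and> R x s" if "x \<in> A" for x
  proof (rule ex1I[of _ "c x"])
    show "c x \<in> c ` A \<and> R x (c x)"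
      using that c by blast
    fix s assume "s \<in> c ` A \<and> R x s"
    then obtain y where y: "y \<in> A" "s = c y" "R x (c y)" by blast
    then have "R x y"
      using c[of y] R by (metis equivp_def)
    then show "s = c x"
      using same y(2) by metis
  qed
  ultimately have "transversal R A (c ` A)"
    using R c unfolding transversal_def by blast
  then show ?thesis using that by blast
qed

text \<open>Change of variables in a sum over the finite quotient of \<open>A\<close> by
  \<open>R\<close>. The map \<open>\<phi>\<close> need not send representatives to representatives,
  so \<open>\<phi> x\<close> is replaced by the representative \<open>g x\<close> of its class,
  where \<open>f\<close> has the same value.\<close>

lemma sum_transversal_reindex:
  fixes f :: "'b \<Rightarrow> 'c::comm_monoid_add"
  assumes S: "transversal R A S" and S': "transversal R' B S'"
    and phi: "bij_betw \<phi> A B" "\<And>x y. x \<in> A \<Longrightarrow> y \<in> A \<Longrightarrow> R' (\<phi> x) (\<phi> y) \<Longrightarrow> R x y"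
    and f: "\<And>x y. x \<in> B \<Longrightarrow> y \<in> B \<Longrightarrow> R' x y \<Longrightarrow> f x = f y"
    and R: "\<And>x y. x \<in> A \<Longrightarrow> y \<in> A \<Longrightarrow> R x y \<Longrightarrow> R' (\<phi> x) (\<phi> y)"
  shows "(\<Sum>x\<in>S. f (\<phi> x)) = sum f S'"
proof -
  define g where "g x = (THE s. s \<in> S' \<and> R' (\<phi> x) s)" for x
  have g: "g x \<in> S' \<and> R' (\<phi> x) (g x)" if "x \<in> A" for x
  proof -
    have "\<phi> x \<in> B" using that phi(1) by (auto simp: bij_betw_def)
    then have "\<exists>!s. s \<in> S' \<and> R' (\<phi> x) s"
      using S' unfolding transversal_def by blast
    from theI'[OF this] show ?thesis
      unfolding g_def .
  qed
  have SA: "S \<subseteq> A" and SB: "S' \<subseteq> B" and eR: "equivp R" and eR': "equivp R'"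
    using S S' by (auto simp: transversal_def)
  have uS: "s = t" if "s \<in> S" "t \<in> S" "R s t" for s t
    using S that eR unfolding transversal_def by (metis equivp_reflp subsetD)
  have uS': "s = t" if "s \<in> S'" "t \<in> S'" "R' s t" for s t
    using S' that eR' unfolding transversal_def by (metis equivp_reflp subsetD)
  have "inj_on g S"
  proof (rule inj_onI)
    fix x y assume xy: "x \<in> S" "y \<in> S" "g x = g y"
    then have "R' (\<phi> x) (\<phi> y)"
      using g[of x] g[of y] SA eR' by (metis equivp_def subsetD)
    then show "x = y"
      using phi(2) xy SA uS by blast
  qed
  moreover have "g ` S = S'"
  proof
    show "g ` S \<subseteq> S'" using g SA by blast
    show "S' \<subseteq> g ` S"
    proof
      fix t assume t: "t \<in> S'"
      then obtain x where x: "x \<in> A" "\<phi> x = t"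
        using SB phi(1) by (auto simp: bij_betw_def)
      obtain s where s: "s \<in> S" "R x s"
        using S x(1) unfolding transversal_def by blast
      have "R' t (\<phi> s)" using R[OF x(1) _ s(2)] s(1) SA x(2) by blast
      then have "R' t (g s)"
        using g[of s] s(1) SA eR' by (metis equivp_def subsetD)
      then have "t = g s"
        using uS' t g s(1) SA by blast
      then show "t \<in> g ` S" using s(1) by blast
    qed
  qed
  ultimately have "sum f S' = (\<Sum>x\<in>S. f (g x))"
    by (metis (mono_tags, lifting) sum.reindex_cong)
  also have "\<dots> = (\<Sum>x\<in>S. f (\<phi> x))"
  proof (rule sum.cong)
    fix x assume "x \<in> S"
    then have "x \<in> A" using SA by blast
    moreover have "\<phi> x \<in> B" using calculation phi(1) by (auto simp: bij_betw_def)
    ultimately show "f (g x) = f (\<phi> x)"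
      using f g SB by (metis subsetD)
  qed simp
  finally show ?thesis by simp
qed

lemma equivp_pullback: "equivp R \<Longrightarrow> equivp (\<lambda>x y. R (f x) (f y))"
  unfolding equivp_reflp_symp_transp reflp_def symp_def transp_def by blast

section \<open>Local fields\<close>

context nonarch_local_field
begin

section \<open>Powers of the maximal ideal, units and one-units\<close>

abbreviation P :: "int \<Rightarrow> 'a set" where "P \<equiv> ideal_power v"

lemma in_P: "x \<in> P n \<longleftrightarrow> x = 0 \<or> n \<le> v x"
  by (simp add: ideal_power_def)

lemma val_one [simp]: "v 1 = 0"
  using val_mult[of 1 1] by simp

lemma val_minus_one [simp]: "v (-1) = 0"
  using val_mult[of "-1" "-1"] by simp

lemma val_minus [simp]: "v (- x) = v x"
proof (cases "x = 0")
  case False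
  then show ?thesis using val_mult[of "-1" x] by simp
qed simp

lemma val_inverse: "x \<noteq> 0 \<Longrightarrow> v (inverse x) = - v x"
  using val_mult[of x "inverse x"] by simp

lemma val_divide: "x \<noteq> 0 \<Longrightarrow> y \<noteq> 0 \<Longrightarrow> v (x / y) = v x - v y"
  using val_mult[of x "inverse y"] by (simp add: val_inverse divide_inverse)

lemma val_power: "x \<noteq> 0 \<Longrightarrow> v (x ^ n) = int n * v x"
  by (induction n) (simp_all add: val_mult algebra_simps)

lemma val_power_int: "x \<noteq> 0 \<Longrightarrow> v (x powi n) = n * v x"
  by (cases "n \<ge> 0") (auto simp: power_int_def val_power val_inverse power_inverse)

lemma P_zero [simp]: "0 \<in> P n"
  by (simp add: in_P)

lemma P_uminus [simp]: "- x \<in> P n \<longleftrightarrow> x \<in> P n"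
  by (simp add: in_P)

lemma P_add: "x \<in> P n \<Longrightarrow> y \<in> P n \<Longrightarrow> x + y \<in> P n"
  using val_add[of x y] by (fastforce simp: in_P)

lemma P_diff: "x \<in> P n \<Longrightarrow> y \<in> P n \<Longrightarrow> x - y \<in> P n"
  using P_add[of x n "-y"] by simp

lemma P_mono: "x \<in> P n \<Longrightarrow> m \<le> n \<Longrightarrow> x \<in> P m"
  by (auto simp: in_P)

lemma P_mult: "x \<in> P m \<Longrightarrow> y \<in> P n \<Longrightarrow> x * y \<in> P (m + n)"
  by (cases "x = 0"; cases "y = 0") (auto simp: in_P val_mult)

lemma P_mult_mono: "x \<in> P m \<Longrightarrow> y \<in> P n \<Longrightarrow> k \<le> m + n \<Longrightarrow> x * y \<in> P k"
  using P_mult P_mono by blast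

lemma P_sum: "(\<And>i. i \<in> A \<Longrightarrow> f i \<in> P n) \<Longrightarrow> sum f A \<in> P n"
  by (induction A rule: infinite_finite_induct) (auto intro: P_add)

lemma P_scale: "c \<noteq> 0 \<Longrightarrow> c * x \<in> P n \<longleftrightarrow> x \<in> P (n - v c)"
  by (cases "x = 0") (auto simp: in_P val_mult)

lemma P_all: "(\<And>n. x \<in> P (int n)) \<Longrightarrow> x = 0"
proof (rule ccontr)
  assume h: "\<And>n. x \<in> P (int n)" "x \<noteq> 0"
  then have "int (Suc (nat (v x))) \<le> v x"
    by (metis in_P)
  then show False by linarith
qed

lemma one_in_P: "1 \<in> P n \<longleftrightarrow> n \<le> 0"
  by (simp add: in_P)

lemma one_notin_P [simp]: "0 < n \<Longrightarrow> 1 \<notin> P n"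
  by (simp add: in_P)

lemma P_of_nat: "of_nat n \<in> P 0"
  by (induction n) (auto intro: P_add simp: one_in_P)

lemma int_units_iff: "u \<in> int_units v \<longleftrightarrow> u \<in> P 0 \<and> u \<notin> P 1"
  by (auto simp: int_units_def in_P)

lemma unit_nonzero: "u \<in> int_units v \<Longrightarrow> u \<noteq> 0"
  by (simp add: int_units_def)

lemma unit_P: "u \<in> int_units v \<Longrightarrow> u \<in> P 0"
  by (simp add: int_units_def in_P)

lemma unit_one [simp]: "1 \<in> int_units v"
  by (simp add: int_units_def)

lemma unit_mult: "x \<in> int_units v \<Longrightarrow> y \<in> int_units v \<Longrightarrow> x * y \<in> int_units v"
  by (simp add: int_units_def val_mult)

lemma unit_inverse: "x \<in> int_units v \<Longrightarrow> inverse x \<in> int_units v"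
  by (simp add: int_units_def val_inverse)

lemma unit_divide: "x \<in> int_units v \<Longrightarrow> y \<in> int_units v \<Longrightarrow> x / y \<in> int_units v"
  by (simp add: divide_inverse unit_mult unit_inverse)

lemma unit_power: "x \<in> int_units v \<Longrightarrow> x ^ n \<in> int_units v"
  by (simp add: int_units_def val_power)

lemma P_unit_mult: "u \<in> int_units v \<Longrightarrow> u * x \<in> P n \<longleftrightarrow> x \<in> P n"
  by (cases "x = 0") (auto simp: int_units_def in_P val_mult)

lemma P_unit_divide: "u \<in> int_units v \<Longrightarrow> x / u \<in> P n \<longleftrightarrow> x \<in> P n"
  by (cases "x = 0") (auto simp: int_units_def in_P val_divide)

lemma one_unit: "x - 1 \<in> P n \<Longrightarrow> 0 < n \<Longrightarrow> x \<in> int_units v"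
proof -
  assume h: "x - 1 \<in> P n" "0 < n"
  then have "x - 1 \<in> P 1" using P_mono by force
  then have "x \<in> P 0"
    using P_add[of "x - 1" 0 1] P_mono[of "x - 1" 1 0] by (simp add: one_in_P)
  moreover have "x \<notin> P 1"
    using P_diff[of x 1 "x - 1"] \<open>x - 1 \<in> P 1\<close> by auto
  ultimately show ?thesis by (simp add: int_units_iff)
qed

lemma one_plus_unit: "z \<in> P n \<Longrightarrow> 0 < n \<Longrightarrow> 1 + z \<in> int_units v"
  by (rule one_unit[of _ n]) simp_all

lemma one_mult: "x - 1 \<in> P n \<Longrightarrow> y - 1 \<in> P n \<Longrightarrow> 0 \<le> n \<Longrightarrow> x * y - 1 \<in> P n"
proof -
  assume h: "x - 1 \<in> P n" "y - 1 \<in> P n" "0 \<le> n"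
  have e: "x * y - 1 = (x - 1) * (y - 1) + (x - 1) + (y - 1)" by (simp add: algebra_simps)
  have "(x - 1) * (y - 1) \<in> P n" using h by (intro P_mult_mono[of _ n _ n]) auto
  then show ?thesis unfolding e using h by (intro P_add)
qed

lemma one_inverse: "x - 1 \<in> P n \<Longrightarrow> 0 < n \<Longrightarrow> inverse x - 1 \<in> P n"
proof -
  assume h: "x - 1 \<in> P n" "0 < n"
  then have u: "x \<in> int_units v" by (rule one_unit)
  then have "inverse x - 1 = - (inverse x * (x - 1))"
    using unit_nonzero[OF u] by (simp add: algebra_simps)
  then show ?thesis using h P_unit_mult[OF unit_inverse[OF u]] by simp
qed

lemma unit_filtration_iff: "x \<in> unit_filtration v n \<longleftrightarrow> x \<in> int_units v \<and> x - 1 \<in> P (int n)"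
proof (cases "n = 0")
  case True
  then show ?thesis
    using P_diff[of x 0 1] by (auto simp: unit_filtration_def one_in_P unit_P)
next
  case False
  then show ?thesis
    using one_unit[of x "int n"] by (auto simp: unit_filtration_def)
qed

lemma equivp_mod: "equivp (\<lambda>x y. x - y \<in> P n)"
proof (rule equivpI)
  show "reflp (\<lambda>x y. x - y \<in> P n)" by (simp add: reflp_def)
  show "symp (\<lambda>x y. x - y \<in> P n)"
    by (rule sympI) (metis P_uminus minus_diff_eq)
  show "transp (\<lambda>x y. x - y \<in> P n)"
    by (rule transpI) (metis P_add diff_add_cancel add_diff_eq)
qed

lemma ex_uniformizer: obtains p where "p \<noteq> 0" "v p = 1"
  using uniformizer_exists by blast

section \<open>Finite quotients and sums over them\<close>

lemma residue_finite: "\<exists>T. finite T \<and> (\<forall>x\<in>P 0. \<exists>t\<in>T. x - t \<in> P 1)"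
proof -
  let ?r = "{(x, y). x \<in> P 0 \<and> y \<in> P 0 \<and> x - y \<in> P 1}"
  define c :: "'a set \<Rightarrow> 'a" where "c C = (SOME x. x \<in> C)" for C
  have c: "c C \<in> C" if "x \<in> C" for x C
    unfolding c_def using that by (rule someI)
  have "\<exists>t\<in>c ` (P 0 // ?r). x - t \<in> P 1" if x: "x \<in> P 0" for x
  proof
    show "c (?r `` {x}) \<in> c ` (P 0 // ?r)"
      using x by (intro imageI quotientI)
    have "x \<in> ?r `` {x}" using x by simp
    then have "c (?r `` {x}) \<in> ?r `` {x}" by (rule c)
    then show "x - c (?r `` {x}) \<in> P 1"
      by (simp only: Image_singleton_iff mem_Collect_eq prod.case)
  qed
  then show ?thesis using finite_residue_field by blast
qed

text \<open>Induction over the layers: multiplication by \<open>q\<close>, of valuation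
  \<open>m + int k\<close>, identifies the residue field with the quotient of
  \<open>P (m + int k)\<close> by its successor.\<close>

lemma quotient_finite: "\<exists>T. finite T \<and> (\<forall>x\<in>P m. \<exists>t\<in>T. x - t \<in> P (m + int k))"
proof (induction k)
  case 0
  show ?case by (rule exI[of _ "{0}"]) simp
next
  case (Suc k)
  then obtain T where T: "finite T" "\<And>x. x \<in> P m \<Longrightarrow> \<exists>t\<in>T. x - t \<in> P (m + int k)" by blast
  obtain S where S: "finite S" "\<And>x. x \<in> P 0 \<Longrightarrow> \<exists>t\<in>S. x - t \<in> P 1"
    using residue_finite by blast
  obtain p where p: "p \<noteq> 0" "v p = 1" using ex_uniformizer .
  define q where "q = p powi (m + int k)"
  have q: "q \<noteq> 0" "v q = m + int k" using p by (simp_all add: q_def val_power_int)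
  let ?T = "(\<lambda>(t, s). t + q * s) ` (T \<times> S)"
  have "\<exists>t\<in>?T. x - t \<in> P (m + int (Suc k))" if x: "x \<in> P m" for x
  proof -
    obtain t where t: "t \<in> T" "x - t \<in> P (m + int k)" using T x by blast
    have e: "x - t = q * ((x - t) / q)" using q by simp
    have "(x - t) / q \<in> P 0"
      using t(2) q P_scale[of q "(x - t) / q" "m + int k"] by simp
    then obtain s where s: "s \<in> S" "(x - t) / q - s \<in> P 1" using S by blast
    have "x - (t + q * s) = q * ((x - t) / q - s)"
      using q e by (simp add: algebra_simps)
    then have "x - (t + q * s) \<in> P (m + int (Suc k))"
      using s(2) q by (simp add: P_scale add.commute)
    then show ?thesis using t(1) s(1) by force
  qed
  then show ?case
    using T(1) S(1) by (intro exI[of _ ?T]) blast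
qed

lemma quotient_finite': "\<exists>T. finite T \<and> (\<forall>x\<in>P m. \<exists>t\<in>T. x - t \<in> P n)"
proof (cases "m \<le> n")
  case True
  then show ?thesis using quotient_finite[of m "nat (n - m)"] by simp
next
  case False
  then show ?thesis using P_mono[of _ m n] by (intro exI[of _ "{0}"]) simp
qed

text \<open>One fixed system of representatives of \<open>P a\<close> modulo
  \<open>P (a + 1)\<close>. A sum over it plays the part of an integral over \<open>P a\<close> of a
  function invariant under \<open>P (a + 1)\<close>.\<close>

definition reps :: "int \<Rightarrow> 'a set" where
  "reps a = (SOME S. transversal (\<lambda>x y. x - y \<in> P (a + 1)) (P a) S)"

lemma reps: "transversal (\<lambda>x y. x - y \<in> P (a + 1)) (P a) (reps a)"
proof -
  obtain T where "finite T" "\<forall>x\<in>P a. \<exists>t\<in>T. x - t \<in> P (a + 1)"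
    using quotient_finite'[of a "a + 1"] by blast
  then obtain S where "transversal (\<lambda>x y. x - y \<in> P (a + 1)) (P a) S"
    using transversal_exists[OF equivp_mod] by metis
  then show ?thesis unfolding reps_def by (rule someI)
qed

lemma finite_reps: "finite (reps a)" and reps_P: "x \<in> reps a \<Longrightarrow> x \<in> P a"
  using reps[of a] by (auto simp: transversal_def)

lemma reps_nonempty: "reps a \<noteq> {}"
  using reps[of a] P_zero[of a] unfolding transversal_def by blast

lemma card_reps: "card (reps a) \<noteq> 0"
  using reps_nonempty finite_reps by simp

lemma sum_reps_scale:
  fixes f :: "'a \<Rightarrow> 'c::comm_monoid_add"
  assumes c: "c \<noteq> 0" "v c = k" and b: "b = a + k"
    and f: "\<And>x y. x \<in> P b \<Longrightarrow> y \<in> P b \<Longrightarrow> x - y \<in> P (b + 1) \<Longrightarrow> f x = f y"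
  shows "(\<Sum>x\<in>reps a. f (c * x)) = sum f (reps b)"
proof (rule sum_transversal_reindex[OF reps reps])
  show "bij_betw ((*) c) (P a) (P b)"
  proof (rule bij_betw_byWitness[where f' = "\<lambda>x. x / c"])
    have "x / c \<in> P a" if "x \<in> P b" for x
    proof -
      have "c * (x / c) \<in> P b" using that c(1) by simp
      then have "x / c \<in> P (b - v c)" using P_scale c(1) by blast
      then show ?thesis using c(2) b by simp
    qed
    then show "(\<lambda>x. x / c) ` P b \<subseteq> P a" by blast
  qed (use c b in \<open>auto simp: P_scale\<close>)
  show "x - y \<in> P (a + 1)" if "c * x - c * y \<in> P (b + 1)" for x y
    using that c b P_scale[of c "x - y" "b + 1"] by (simp add: algebra_simps)
  show "c * x - c * y \<in> P (b + 1)" if "x - y \<in> P (a + 1)" for x y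
    using that c b P_scale[of c "x - y" "b + 1"] by (simp add: algebra_simps)
qed (rule f)

lemma sum_reps_shift:
  fixes f :: "'a \<Rightarrow> 'c::comm_monoid_add"
  assumes b: "b \<in> P a"
    and f: "\<And>x y. x \<in> P a \<Longrightarrow> y \<in> P a \<Longrightarrow> x - y \<in> P (a + 1) \<Longrightarrow> f x = f y"
  shows "(\<Sum>x\<in>reps a. f (b + x)) = sum f (reps a)"
proof (rule sum_transversal_reindex[OF reps reps])
  show "bij_betw ((+) b) (P a) (P a)"
    by (rule bij_betw_byWitness[where f' = "\<lambda>x. x - b"]) (use b in \<open>auto intro: P_add P_diff\<close>)
qed (simp, rule f, assumption+, simp)

lemma sum_reps_isolate:
  fixes f :: "'a \<Rightarrow> 'c::comm_monoid_add"
  assumes "\<And>x. x \<in> P (a + 1) \<Longrightarrow> f x = c" "\<And>x. x \<in> P a \<Longrightarrow> x \<notin> P (a + 1) \<Longrightarrow> f x = 0"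
  shows "sum f (reps a) = c"
proof -
  have "\<forall>x\<in>P a. \<exists>!z. z \<in> reps a \<and> x - z \<in> P (a + 1)"
    using reps[of a] unfolding transversal_def by (elim conjE)
  from bspec[OF this P_zero] have "\<exists>!z. z \<in> reps a \<and> 0 - z \<in> P (a + 1)" .
  then obtain z where z: "z \<in> reps a" "0 - z \<in> P (a + 1)" "\<And>y. y \<in> reps a \<Longrightarrow> 0 - y \<in> P (a + 1) \<Longrightarrow> y = z"
    by (elim ex1E) blast
  have "sum f (reps a) = f z + sum f (reps a - {z})"
    using z(1) finite_reps by (simp add: sum.remove)
  also have "sum f (reps a - {z}) = 0"
    using z(3) assms(2) reps_P by (intro sum.neutral) auto
  finally show ?thesis using assms(1) z(2) by simp
qed

text \<open>Orthogonality: translating the variable by \<open>b\<close> multiplies the sum by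
  \<open>\<psi> b\<close>, which is not 1.\<close>

lemma sum_additive_character:
  fixes \<psi> :: "'a \<Rightarrow> complex"
  assumes add: "\<And>x y. x \<in> P a \<Longrightarrow> y \<in> P a \<Longrightarrow> \<psi> (x + y) = \<psi> x * \<psi> y"
    and triv: "\<And>x. x \<in> P (a + 1) \<Longrightarrow> \<psi> x = 1"
    and nontriv: "b \<in> P a" "\<psi> b \<noteq> 1"
  shows "sum \<psi> (reps a) = 0"
proof -
  have "sum \<psi> (reps a) = (\<Sum>x\<in>reps a. \<psi> (b + x))"
  proof (rule sum_reps_shift[symmetric])
    fix x y assume "x \<in> P a" "y \<in> P a" "x - y \<in> P (a + 1)"
    then show "\<psi> x = \<psi> y"
      using add[of y "x - y"] triv[of "x - y"] P_diff by simp
  qed (use nontriv in simp)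
  also have "\<dots> = \<psi> b * sum \<psi> (reps a)"
    using add[OF nontriv(1) reps_P] by (simp add: sum_distrib_left)
  finally show ?thesis using nontriv(2) by simp
qed

section \<open>Powers and square roots of units\<close>

lemma pigeonhole_residue:
  fixes f :: "nat \<Rightarrow> 'a"
  assumes "\<And>n. f n \<in> P 0"
  obtains i j where "i < j" "f j - f i \<in> P 1"
proof -
  obtain T where T: "finite T" "\<And>x. x \<in> P 0 \<Longrightarrow> \<exists>t\<in>T. x - t \<in> P 1"
    using residue_finite by blast
  have "\<forall>n. \<exists>t. t \<in> T \<and> f n - t \<in> P 1" using T(2) assms by blast
  then obtain t where t: "\<And>n. t n \<in> T" "\<And>n. f n - t n \<in> P 1"
    by (metis choice)
  have "range t \<subseteq> T" using t(1) by blast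
  then have "finite (range t)" using T(1) finite_subset by blast
  then have "\<not> inj t" using infinite_UNIV_nat finite_imageD by blast
  then obtain i j where ij: "i < j" "t i = t j"
    by (metis injI nat_neq_iff)
  then show ?thesis
    using that[of i j] P_diff[OF t(2)[of j] t(2)[of i]] by simp
qed

lemma unit_power_one_unit:
  assumes "u \<in> int_units v"
  obtains h where "0 < h" "u ^ h - 1 \<in> P 1"
proof -
  obtain i j where ij: "i < j" "u ^ j - u ^ i \<in> P 1"
    using pigeonhole_residue[of "\<lambda>i. u ^ i"] unit_P[OF unit_power[OF assms]] by blast
  have "u ^ j - u ^ i = u ^ i * (u ^ (j - i) - 1)"
    using ij(1) by (simp add: right_diff_distrib flip: power_add)
  then have "u ^ (j - i) - 1 \<in> P 1"
    using ij(2) P_unit_mult[OF unit_power[OF assms], of i "u ^ (j - i) - 1"] by (simp only:)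
  then show ?thesis using that[of "j - i"] ij(1) by simp
qed

text \<open>This shows that the \<open>LEAST\<close> in \<open>residue_char\<close> is attained: two
  distinct natural numbers are congruent in the finite residue field, and their difference is a
  witness.\<close>

lemma residue_char_in: "0 < residue_char v \<and> of_nat (residue_char v) \<in> P 1"
proof -
  obtain i j where ij: "i < j" "of_nat j - of_nat i \<in> P 1"
    using pigeonhole_residue[of "\<lambda>i. of_nat i"] P_of_nat by blast
  then have "0 < j - i \<and> of_nat (j - i) \<in> P 1"
    using ij by (simp add: of_nat_diff)
  then show ?thesis
    unfolding residue_char_def by (rule LeastI)
qed

lemma two_unit:
  assumes "odd (residue_char v)"
  shows "2 \<in> int_units v"
proof (rule ccontr)
  assume "2 \<notin> int_units v"
  then have "of_nat 2 \<in> P 1"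
    using P_of_nat[of 2] by (simp add: int_units_iff)
  then have "residue_char v \<le> 2"
    unfolding residue_char_def by (intro Least_le) simp
  moreover have "residue_char v \<noteq> 1"
    using residue_char_in by auto
  ultimately show False
    using assms residue_char_in by (auto simp: le_Suc_eq numeral_2_eq_2)
qed

text \<open>In \<open>y ^ q - 1 = (y - 1) * (\<Sum>i<q. y ^ i)\<close> the sum is congruent to
  \<open>q\<close> modulo \<open>P 1\<close>, so every \<open>q\<close>-th power gains at least one
  step. Applied to the residue characteristic it bounds the exponent of one-units modulo a deep
  subgroup.\<close>

lemma one_unit_power:
  assumes q: "of_nat q \<in> P 1" and x: "x - 1 \<in> P 1"
  shows "x ^ (q ^ n) - 1 \<in> P (1 + int n)"
proof (induction n)
  case 0
  then show ?case using x by simp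
next
  case (Suc n)
  define y where "y = x ^ (q ^ n)"
  have y: "y - 1 \<in> P (1 + int n)" "y - 1 \<in> P 1"
    using Suc P_mono[of "y - 1" "1 + int n" 1] by (simp_all add: y_def)
  have yi: "y ^ i - 1 \<in> P 1" for i
    by (induction i) (auto intro: one_mult[OF y(2)])
  have "(\<Sum>i<q. y ^ i) = (\<Sum>i<q. y ^ i - 1) + of_nat q"
    by (simp add: sum_subtractf)
  also have "\<dots> \<in> P 1"
    using yi q by (intro P_add P_sum)
  finally have "(\<Sum>i<q. y ^ i) \<in> P 1" .
  then have "(y - 1) * (\<Sum>i<q. y ^ i) \<in> P (1 + int (Suc n))"
    by (rule P_mult_mono[OF y(1)]) simp
  also have "(y - 1) * (\<Sum>i<q. y ^ i) = y ^ q - 1"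
    by (simp add: power_diff_1_eq)
  finally show ?case by (simp add: y_def mult.commute flip: power_mult)
qed

lemma unit_power_close:
  assumes "u \<in> int_units v"
  obtains h where "0 < h" "u ^ h - 1 \<in> P n"
proof -
  obtain k where k: "0 < k" "u ^ k - 1 \<in> P 1" using unit_power_one_unit[OF assms] .
  have "(u ^ k) ^ (residue_char v ^ nat n) - 1 \<in> P (1 + int (nat n))"
    using one_unit_power residue_char_in k(2) by blast
  then have "u ^ (k * residue_char v ^ nat n) - 1 \<in> P n"
    using P_mono[of _ "1 + int (nat n)" n] by (simp add: power_mult)
  moreover have "0 < k * residue_char v ^ nat n"
    using k(1) residue_char_in by simp
  ultimately show ?thesis using that by blast
qed

text \<open>Newton's iteration for \<open>y\<^sup>2 = x\<close>, with the derivative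
  \<open>2 * y\<close> frozen at its value 2 at the point 1. The new error
  \<open>e * (1 - y) + e / 2 * (e / 2)\<close> is at least one step deeper because
  \<open>0 < n\<close>; this linear convergence suffices, and completeness gives the limit.\<close>

lemma one_unit_sqrt:
  assumes two: "2 \<in> int_units v" and x: "x - 1 \<in> P n" and n: "0 < n"
  obtains y where "y\<^sup>2 = x" "y - 1 \<in> P n"
proof -
  define Y where "Y = rec_nat 1 (\<lambda>_ y. y - (y\<^sup>2 - x) / 2)"
  have Y0: "Y 0 = 1" and YS: "Y (Suc k) = Y k - ((Y k)\<^sup>2 - x) / 2" for k
    by (simp_all add: Y_def)
  have two0: "(2::'a) \<noteq> 0" using two by (rule unit_nonzero)
  have inv: "Y k - 1 \<in> P n \<and> (Y k)\<^sup>2 - x \<in> P (n + int k)" for k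
  proof (induction k)
    case 0
    then show ?case using x P_uminus[of "x - 1"] by (simp add: Y0 del: P_uminus)
  next
    case (Suc k)
    define e where "e = (Y k)\<^sup>2 - x"
    have e: "e \<in> P (n + int k)" "Y k - 1 \<in> P n" using Suc by (auto simp: e_def)
    have e2: "e / 2 \<in> P (n + int k)" using e(1) two by (simp add: P_unit_divide)
    have 1: "Y (Suc k) - 1 = (Y k - 1) - e / 2" by (simp add: YS e_def)
    have "Y (Suc k) - 1 \<in> P n"
      unfolding 1 by (rule P_diff[OF e(2) P_mono[OF e2]]) simp
    moreover have "(Y (Suc k))\<^sup>2 - x = e * (1 - Y k) + e / 2 * (e / 2)"
    proof -
      define h where "h = e / 2"
      have e: "e = 2 * h" using two0 by (simp add: h_def)
      have "(Y (Suc k))\<^sup>2 - x = (Y k - h)\<^sup>2 - ((Y k)\<^sup>2 - e)"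
        by (simp add: YS h_def e_def)
      also have "\<dots> = e * (1 - Y k) + h * h"
        unfolding e by (simp add: algebra_simps power2_eq_square)
      finally show ?thesis unfolding h_def .
    qed
    moreover have "e * (1 - Y k) \<in> P (n + int (Suc k))"
    proof (rule P_mult_mono[OF e(1)])
      show "1 - Y k \<in> P n" using e(2) P_uminus[of "Y k - 1" n] by simp
    qed (use n in simp)
    moreover have "e / 2 * (e / 2) \<in> P (n + int (Suc k))"
      using n by (intro P_mult_mono[OF e2 e2]) simp
    ultimately show ?case by (metis P_add)
  qed
  have step: "Y (Suc k) - Y k \<in> P (n + int k)" for k
    using inv[of k] two by (simp add: YS P_unit_divide)
  have close: "Y (k + l) - Y k \<in> P (n + int k)" for k l
  proof (induction l)
    case (Suc l)
    have "Y (Suc (k + l)) - Y (k + l) \<in> P (n + int k)"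
      using step[of "k + l"] by (rule P_mono) simp
    then show ?case using P_add[OF _ Suc] by force
  qed simp
  have "\<forall>m. \<exists>N. \<forall>i\<ge>N. \<forall>j\<ge>N. Y i - Y j \<in> P m"
  proof
    fix m :: int
    have "Y i - Y j \<in> P m" if "nat m \<le> i" "nat m \<le> j" for i j
    proof -
      have "Y i - Y (nat m) \<in> P m" "Y j - Y (nat m) \<in> P m"
        using close[of "nat m" "i - nat m"] close[of "nat m" "j - nat m"] that n
          P_mono[of _ "n + int (nat m)" m] by auto
      then show ?thesis using P_diff by fastforce
    qed
    then show "\<exists>N. \<forall>i\<ge>N. \<forall>j\<ge>N. Y i - Y j \<in> P m" by blast
  qed
  then obtain L where L: "\<And>m. \<exists>N. \<forall>i\<ge>N. Y i - L \<in> P m" using complete by blast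
  have "L - 1 \<in> P n"
  proof -
    obtain N where "Y N - L \<in> P n" using L by blast
    then show ?thesis using P_diff[of "Y N - 1" n "Y N - L"] inv by simp
  qed
  moreover have "L\<^sup>2 - x = 0"
  proof (rule P_all)
    fix m :: nat
    obtain N where N: "\<forall>i\<ge>N. Y i - L \<in> P (int m)" using L by blast
    define i where "i = max N m"
    have a: "Y i - L \<in> P (int m)" using N by (simp add: i_def)
    have b: "(Y i)\<^sup>2 - x \<in> P (int m)"
      using inv[of i] n by (auto intro: P_mono simp: i_def)
    have "Y i \<in> P 0" "L \<in> P 0"
      using inv[of i] \<open>L - 1 \<in> P n\<close> one_unit n unit_P by blast+
    then have "(Y i - L) * (Y i + L) \<in> P (int m)"
      using a by (intro P_mult_mono[of _ "int m" _ 0] P_add) auto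
    moreover have "L\<^sup>2 - x = ((Y i)\<^sup>2 - x) - (Y i - L) * (Y i + L)"
      by (simp add: algebra_simps power2_eq_square)
    ultimately show "L\<^sup>2 - x \<in> P (int m)" using b by (metis P_diff)
  qed
  ultimately show ?thesis using that[of L] by simp
qed

lemma unit_filtration_mono: "x \<in> unit_filtration v m \<Longrightarrow> n \<le> m \<Longrightarrow> x \<in> unit_filtration v n"
  using P_mono by (force simp: unit_filtration_iff)

text \<open>With \<open>?s = 1 + (x + y)\<close> one has
  \<open>(1 + x) * (1 + y) = ?s * (1 + x * y / ?s)\<close>. The correction has valuation at least
  \<open>2 * (c - 1)\<close>, and \<open>2 \<le> c\<close> makes this at least \<open>c\<close>,
  where \<open>\<eta>\<close> is trivial.\<close>

lemma character_additive:
  fixes \<eta> :: "'a \<Rightarrow> complex"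
  assumes mult: "\<And>x y. x \<in> int_units v \<Longrightarrow> y \<in> int_units v \<Longrightarrow> \<eta> (x * y) = \<eta> x * \<eta> y"
    and triv: "\<And>u. u \<in> unit_filtration v c \<Longrightarrow> \<eta> u = 1"
    and c: "2 \<le> c" and x: "x \<in> P (int c - 1)" and y: "y \<in> P (int c - 1)"
  shows "\<eta> (1 + (x + y)) = \<eta> (1 + x) * \<eta> (1 + y)"
proof -
  let ?s = "1 + (x + y)"
  have xy: "x + y \<in> P (int c - 1)" using x y by (rule P_add)
  have u: "1 + x \<in> int_units v" "1 + y \<in> int_units v" "?s \<in> int_units v"
    using one_plus_unit[OF x] one_plus_unit[OF y] one_plus_unit[OF xy] c by auto
  have s0: "?s \<noteq> 0" using u(3) by (rule unit_nonzero)
  have "x * y \<in> P (int c)" using c by (intro P_mult_mono[OF x y]) simp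
  then have q: "x * y / ?s \<in> P (int c)" using P_unit_divide[OF u(3)] by blast
  have q1: "1 + x * y / ?s \<in> int_units v" using c by (intro one_plus_unit[OF q]) simp
  have "(1 + x) * (1 + y) = ?s * (1 + x * y / ?s)"
  proof -
    have "?s * (x * y / ?s) = x * y" using s0 by simp
    then show ?thesis by (simp only: distrib_left mult_1_right) (simp add: algebra_simps)
  qed
  then have "\<eta> (1 + x) * \<eta> (1 + y) = \<eta> ?s * \<eta> (1 + x * y / ?s)"
    using mult u q1 by metis
  also have "\<eta> (1 + x * y / ?s) = 1"
    using q q1 by (intro triv) (simp add: unit_filtration_iff)
  finally show ?thesis by simp
qed

lemma reps_zero_split:
  obtains z where "z \<in> reps a" "z \<in> P (a + 1)" "\<And>t. t \<in> reps a - {z} \<Longrightarrow> t \<in> P a \<and> t \<notin> P (a + 1)"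
proof -
  have "\<forall>x\<in>P a. \<exists>!z. z \<in> reps a \<and> x - z \<in> P (a + 1)"
    using reps[of a] unfolding transversal_def by (elim conjE)
  from bspec[OF this P_zero] obtain z where z: "z \<in> reps a" "0 - z \<in> P (a + 1)"
    "\<And>y. y \<in> reps a \<Longrightarrow> 0 - y \<in> P (a + 1) \<Longrightarrow> y = z"
    by (elim ex1E) blast
  show ?thesis
  proof (rule that[of z])
    show "z \<in> P (a + 1)" using z(2) by simp
    fix t assume t: "t \<in> reps a - {z}"
    then have "0 - t \<notin> P (a + 1)" using z(3) by blast
    then show "t \<in> P a \<and> t \<notin> P (a + 1)" using t reps_P by simp
  qed (rule z(1))
qed

end

section \<open>The unramified quadratic extension\<close>

context unramified_quadratic_extension
begin

lemma emb_zero [simp]: "\<iota> 0 = 0"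
  by (metis emb_add add_0 add_cancel_right_right)

lemma emb_minus [simp]: "\<iota> (- x) = - \<iota> x"
  using emb_add[of x "- x"] by (simp add: eq_neg_iff_add_eq_0 add.commute)

lemma emb_diff: "\<iota> (x - y) = \<iota> x - \<iota> y"
  using emb_add[of x "- y"] by simp

lemma emb_eq_0_iff [simp]: "\<iota> x = 0 \<longleftrightarrow> x = 0"
proof
  assume "\<iota> x = 0"
  then show "x = 0"
    using emb_mult[of x "inverse x"] emb_one by (cases "x = 0") auto
qed simp

lemma emb_eq_iff [simp]: "\<iota> x = \<iota> y \<longleftrightarrow> x = y"
  using emb_eq_0_iff[of "x - y"] by (simp add: emb_diff del: emb_eq_0_iff)

lemma emb_inverse: "\<iota> (inverse x) = inverse (\<iota> x)"
proof (cases "x = 0")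
  case False
  then have "\<iota> x * \<iota> (inverse x) = 1"
    by (simp add: emb_one flip: emb_mult)
  then show ?thesis by (metis inverse_unique)
qed simp

lemma emb_divide: "\<iota> (x / y) = \<iota> x / \<iota> y"
  by (simp add: divide_inverse emb_mult emb_inverse)

lemma emb_P: "\<iota> x \<in> E.P n \<longleftrightarrow> x \<in> F.P n"
  by (cases "x = 0") (auto simp: E.in_P F.in_P val_emb)

lemma emb_unit: "\<iota> x \<in> int_units vE \<longleftrightarrow> x \<in> int_units vF"
  by (simp add: E.int_units_iff F.int_units_iff emb_P)

lemma emb_one_P: "\<iota> x - 1 \<in> E.P n \<longleftrightarrow> x - 1 \<in> F.P n"
  using emb_P[of "x - 1" n] by (simp add: emb_diff emb_one)

lemma aut_zero [simp]: "s 0 = 0"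
  by (metis aut_add add_0 add_cancel_right_right)

lemma aut_one [simp]: "s 1 = 1"
  using aut_emb[of 1] by (simp add: emb_one)

lemma aut_minus [simp]: "s (- x) = - s x"
  using aut_add[of x "- x"] by (simp add: eq_neg_iff_add_eq_0 add.commute)

lemma aut_diff: "s (x - y) = s x - s y"
  using aut_add[of x "- y"] by simp

lemma aut_eq_0_iff [simp]: "s x = 0 \<longleftrightarrow> x = 0"
  using aut_bij aut_zero by (metis bij_pointE)

lemma aut_inverse: "s (inverse x) = inverse (s x)"
proof (cases "x = 0")
  case False
  then have "s x * s (inverse x) = 1"
    by (simp flip: aut_mult)
  then show ?thesis by (metis inverse_unique)
qed simp

lemma aut_divide: "s (x / y) = s x / s y"
  by (simp add: divide_inverse aut_mult aut_inverse)

lemma aut_power: "s (x ^ n) = s x ^ n"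
  by (induction n) (simp_all add: aut_mult)

sublocale FE: vector_space "\<lambda>a x. \<iota> a * x"
  by unfold_locales (simp_all add: emb_add emb_mult emb_one algebra_simps)

text \<open>Any element moved by \<open>s\<close> will do. Comparing a relation between 1 and
  \<open>\<delta>\<close> with its image under \<open>s\<close> kills the coefficient of
  \<open>\<delta>\<close>, so the two are independent; a vector outside their span would exceed
  dimension two.\<close>

lemma quadratic_generator:
  obtains \<delta> where "s \<delta> \<noteq> \<delta>" "\<forall>x. \<exists>a b. x = \<iota> a + \<iota> b * \<delta>"
proof -
  obtain \<delta> where d: "s \<delta> \<noteq> \<delta>" using aut_nontrivial by (metis eq_id_iff)
  have d1: "\<delta> \<noteq> 1" using d by auto
  have indep: "FE.independent {1, \<delta>}"
  proof (rule FE.independent_if_scalars_zero)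
    fix f x assume h: "(\<Sum>x\<in>{1, \<delta>}. \<iota> (f x) * x) = 0" "x \<in> {1, \<delta>}"
    have e: "\<iota> (f 1) + \<iota> (f \<delta>) * \<delta> = 0" using h(1) d1 by simp
    have "\<iota> (f 1) + \<iota> (f \<delta>) * s \<delta> = s (\<iota> (f 1) + \<iota> (f \<delta>) * \<delta>)"
      by (simp add: aut_add aut_mult aut_emb)
    also have "\<dots> = 0" unfolding e by simp
    finally have "\<iota> (f \<delta>) * s \<delta> = \<iota> (f \<delta>) * \<delta>"
      using e by (metis add_left_cancel)
    then have "f \<delta> = 0" using d by simp
    then show "f x = 0" using e h(2) by auto
  qed simp
  obtain B where B: "B \<subseteq> UNIV" "FE.independent B" "UNIV \<subseteq> FE.span B" "card B = FE.dim UNIV"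
    using FE.basis_exists by blast
  then have card: "card B = 2" using degree_two by simp
  then have fin: "finite B" using card.infinite by fastforce
  have "x \<in> FE.span {1, \<delta>}" for x
  proof (rule ccontr)
    assume x: "x \<notin> FE.span {1, \<delta>}"
    then have "FE.independent (insert x {1, \<delta>})"
      using indep FE.independent_insertI by blast
    moreover have "insert x {1, \<delta>} \<subseteq> FE.span B" using B(3) by blast
    ultimately have "card (insert x {1, \<delta>}) \<le> card B"
      using FE.independent_span_bound[OF fin] by blast
    moreover have "x \<notin> {1, \<delta>}" using x FE.span_base by blast
    ultimately show False using card d1 by simp
  qed
  then have "x \<in> FE.span (insert 1 {\<delta>})" for x by simp
  then have ex: "\<exists>a. x - \<iota> a * 1 \<in> range (\<lambda>b. \<iota> b * \<delta>)" for x
    unfolding FE.span_breakdown_eq FE.span_singleton .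
  have "\<exists>a b. x = \<iota> a + \<iota> b * \<delta>" for x
  proof -
    obtain a where "x - \<iota> a * 1 \<in> range (\<lambda>b. \<iota> b * \<delta>)" using ex by blast
    then obtain b where "x - \<iota> a = \<iota> b * \<delta>" by auto
    then have "x = \<iota> a + \<iota> b * \<delta>" by (simp add: diff_eq_eq add.commute)
    then show ?thesis by blast
  qed
  then show ?thesis using that d by blast
qed

lemma fixed_in_F: "s x = x \<Longrightarrow> x \<in> range \<iota>"
proof -
  assume x: "s x = x"
  obtain \<delta> where d: "s \<delta> \<noteq> \<delta>" "\<forall>x. \<exists>a b. x = \<iota> a + \<iota> b * \<delta>"
    using quadratic_generator by blast
  obtain a b where ab: "x = \<iota> a + \<iota> b * \<delta>" using d(2) by blast
  have "\<iota> b * (s \<delta> - \<delta>) = s x - x"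
    by (simp add: ab aut_add aut_mult aut_emb algebra_simps)
  then have "b = 0" using x d(1) by simp
  then show ?thesis using ab by simp
qed

text \<open>Both \<open>\<delta>\<close> and \<open>s \<delta>\<close> are roots of one monic
  quadratic polynomial over \<open>F\<close>, and they differ, so their sum is the coefficient
  \<open>\<iota> b\<close>. Hence \<open>s\<close> is an involution on the generators.\<close>

lemma aut_aut [simp]: "s (s x) = x"
proof -
  obtain \<delta> where d: "s \<delta> \<noteq> \<delta>" "\<forall>x. \<exists>a b. x = \<iota> a + \<iota> b * \<delta>"
    using quadratic_generator by blast
  obtain a b where ab: "\<delta> * \<delta> = \<iota> a + \<iota> b * \<delta>" using d(2) by blast
  have "s \<delta> * s \<delta> = \<iota> a + \<iota> b * s \<delta>"
    by (metis ab aut_add aut_emb aut_mult)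
  then have "(s \<delta> - \<delta>) * (s \<delta> + \<delta> - \<iota> b) = 0"
    using ab by (simp add: algebra_simps)
  then have "s \<delta> + \<delta> - \<iota> b = 0" using d(1) by simp
  then have sd: "s \<delta> = \<iota> b - \<delta>" by (simp add: algebra_simps)
  obtain c e where "x = \<iota> c + \<iota> e * \<delta>" using d(2) by blast
  then show ?thesis by (simp add: aut_add aut_mult aut_emb aut_diff sd)
qed

text \<open>The norm of \<open>E\<close> over \<open>F\<close>, taken as an element of
  \<open>F\<close>. The inverse image exists because \<open>x * s x\<close> is fixed by
  \<open>s\<close>.\<close>

definition nm :: "'e \<Rightarrow> 'f" where "nm x = inv_into UNIV \<iota> (x * s x)"

lemma emb_nm: "\<iota> (nm x) = x * s x"
  unfolding nm_def by (rule f_inv_into_f) (simp add: fixed_in_F aut_mult mult.commute)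

lemma nm_mult: "nm (x * y) = nm x * nm y"
proof -
  have "\<iota> (nm (x * y)) = \<iota> (nm x * nm y)" by (simp add: emb_nm emb_mult aut_mult ac_simps)
  then show ?thesis by simp
qed

lemma nm_emb [simp]: "nm (\<iota> a) = a * a"
proof -
  have "\<iota> (nm (\<iota> a)) = \<iota> (a * a)" by (simp add: emb_nm emb_mult aut_emb)
  then show ?thesis by simp
qed

lemma nm_one [simp]: "nm 1 = 1"
  using nm_emb[of 1] by (simp add: emb_one)

lemma nm_eq_0_iff [simp]: "nm x = 0 \<longleftrightarrow> x = 0"
proof -
  have "nm x = 0 \<longleftrightarrow> \<iota> (nm x) = 0" by simp
  then show ?thesis by (simp add: emb_nm)
qed

lemma nm_eq_1_iff: "nm x = 1 \<longleftrightarrow> x * s x = 1"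
proof -
  have "nm x = 1 \<longleftrightarrow> \<iota> (nm x) = \<iota> 1" by simp
  then show ?thesis unfolding emb_nm emb_one .
qed

lemma nm_inverse: "nm (inverse x) = inverse (nm x)"
proof -
  have "\<iota> (nm (inverse x)) = \<iota> (inverse (nm x))" by (simp add: emb_nm emb_inverse aut_inverse)
  then show ?thesis by simp
qed

lemma nm_divide: "nm (x / y) = nm x / nm y"
  by (simp add: divide_inverse nm_mult nm_inverse)

end

locale odd_unramified_quadratic_extension = unramified_quadratic_extension +
  assumes odd_residue_char: "odd (residue_char vF)"
begin

lemma two_F: "2 \<in> int_units vF"
  using F.two_unit odd_residue_char by blast

lemma two_E: "2 \<in> int_units vE"
proof -
  have "\<iota> (1 + 1) = 1 + 1" unfolding emb_add emb_one ..
  then have "\<iota> 2 = 2" unfolding one_add_one .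
  then show ?thesis using two_F emb_unit[of 2] by simp
qed

text \<open>One-units have \<open>2\<^sup>n\<close>-th roots for all \<open>n\<close>, so their conjugates have valuation \<open>0\<close>; every unit
  has a power which is a one-unit.\<close>

lemma val_aut_unit:
  assumes "u \<in> int_units vE"
  shows "s u \<in> int_units vE"
proof -
  have one: "vE (s x) = 0" if "x - 1 \<in> E.P 1" for x
  proof -
    have "2 ^ n dvd vE (s x)" for n
      using that
    proof (induction n arbitrary: x)
      case (Suc n)
      obtain y where y: "y\<^sup>2 = x" "y - 1 \<in> E.P 1"
        using E.one_unit_sqrt[OF two_E Suc.prems zero_less_one] .
      have "y \<noteq> 0" using E.unit_nonzero[OF E.one_unit[OF y(2) zero_less_one]] .
      then have "vE (s x) = 2 * vE (s y)"
        using E.val_mult[of "s y" "s y"] by (simp add: power2_eq_square aut_mult flip: y(1))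
      then show ?case using Suc.IH[OF y(2)] by simp
    qed simp
    \<comment> \<open>An integer divisible by \<open>2 ^ n\<close>, with \<open>n\<close> its own
      absolute value, is zero.\<close>
    then have "2 ^ nat \<bar>vE (s x)\<bar> dvd vE (s x)" .
    moreover have "\<bar>vE (s x)\<bar> < 2 ^ nat \<bar>vE (s x)\<bar>"
      by (metis abs_ge_zero int_nat_eq of_nat_less_two_power)
    ultimately show ?thesis
      by (meson dvd_imp_le_int linorder_not_less order_trans abs_ge_self)
  qed
  obtain h where h: "0 < h" "u ^ h - 1 \<in> E.P 1" using E.unit_power_one_unit[OF assms] .
  have u0: "u \<noteq> 0" using assms by (rule E.unit_nonzero)
  have "int h * vE (s u) = 0"
    using one[OF h(2)] u0 by (simp add: aut_power E.val_power)
  then show ?thesis using h(1) u0 by (simp add: int_units_def)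
qed

text \<open>The extension is unramified, so \<open>x\<close> has the valuation of some
  \<open>\<iota> q\<close>, which \<open>s\<close> fixes. Dividing by it reduces the claim to
  units.\<close>

lemma val_aut: "x \<noteq> 0 \<Longrightarrow> vE (s x) = vE x"
proof -
  assume x: "x \<noteq> 0"
  obtain p where p: "p \<noteq> 0" "vF p = 1" using F.ex_uniformizer .
  define q where "q = p powi (vE x)"
  have q: "q \<noteq> 0" "vF q = vE x" using p by (simp_all add: q_def F.val_power_int)
  have vq: "vE (\<iota> q) = vE x" using q val_emb by simp
  have "x / \<iota> q \<in> int_units vE"
    using x q(1) vq by (simp add: int_units_def E.val_divide)
  from val_aut_unit[OF this] have "s x / \<iota> q \<in> int_units vE"
    by (simp add: aut_divide aut_emb)
  then show ?thesis using x q(1) vq by (simp add: int_units_def E.val_divide)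
qed

lemma aut_P [simp]: "s x \<in> E.P n \<longleftrightarrow> x \<in> E.P n"
  by (cases "x = 0") (auto simp: E.in_P val_aut)

lemma aut_one_P [simp]: "s x - 1 \<in> E.P n \<longleftrightarrow> x - 1 \<in> E.P n"
  using aut_P[of "x - 1" n] by (simp add: aut_diff del: aut_P)

lemma aut_unit [simp]: "s x \<in> int_units vE \<longleftrightarrow> x \<in> int_units vE"
  by (simp add: E.int_units_iff)

lemma val_nm: "x \<noteq> 0 \<Longrightarrow> vF (nm x) = 2 * vE x"
  using val_emb[of "nm x"] E.val_mult[of x "s x"] by (simp add: emb_nm val_aut)

lemma nm_unit: "x \<in> int_units vE \<Longrightarrow> nm x \<in> int_units vF"
  by (simp add: int_units_def val_nm)

lemma norm_one_unit:
  assumes "x * s x = 1"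
  shows "x \<in> int_units vE"
proof -
  have "x \<noteq> 0" using assms by auto
  moreover have "nm x = 1" using assms nm_eq_1_iff by simp
  ultimately show ?thesis using val_nm[of x] by (simp add: int_units_def)
qed

lemma nm_one_P:
  assumes "x - 1 \<in> E.P n" "0 \<le> n"
  shows "nm x - 1 \<in> F.P n"
proof -
  have "x * s x - 1 \<in> E.P n" using assms by (intro E.one_mult) simp_all
  then show ?thesis using emb_one_P[of "nm x" n] by (simp add: emb_nm)
qed

text \<open>Here \<open>u\<close> is a square root in \<open>F\<close> of the norm of
  \<open>x\<close>, which exists in odd residue characteristic, and \<open>\<iota> u\<close> has
  norm \<open>u * u\<close>. The factor \<open>e\<close> of norm one is the entry of a central
  matrix in \<open>U(1,1)\<close>.\<close>

lemma norm_one_factor: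
  assumes "nm x - 1 \<in> F.P n" "0 < n"
  obtains u e where "x = \<iota> u * e" "u - 1 \<in> F.P n" "e * s e = 1"
proof -
  obtain u where u: "u\<^sup>2 = nm x" "u - 1 \<in> F.P n"
    using F.one_unit_sqrt[OF two_F assms] .
  have u0: "u \<noteq> 0" using F.one_unit[OF u(2) assms(2)] F.unit_nonzero by blast
  have "nm x = u * u" using u(1) by (simp add: power2_eq_square)
  then have "nm (x / \<iota> u) = 1" using u0 by (simp add: nm_divide)
  then have "x / \<iota> u * s (x / \<iota> u) = 1" unfolding nm_eq_1_iff .
  moreover have "x = \<iota> u * (x / \<iota> u)" using u0 by simp
  ultimately show ?thesis using that u(2) by blast
qed

end

section \<open>Smooth actions of the unipotents and the torus of \<open>SL\<^sub>2\<close>\<close>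

definition linear_endo :: "(complex \<Rightarrow> 'v \<Rightarrow> 'v::ab_group_add) \<Rightarrow> 'v set \<Rightarrow> ('v \<Rightarrow> 'v) \<Rightarrow> bool" where
  "linear_endo scl V T \<longleftrightarrow> (\<forall>x\<in>V. T x \<in> V) \<and> (\<forall>x\<in>V. \<forall>y\<in>V. T (x + y) = T x + T y) \<and>
     (\<forall>a. \<forall>x\<in>V. T (scl a x) = scl a (T x))"

lemma linear_endoD:
  assumes "linear_endo scl V T"
  shows "x \<in> V \<Longrightarrow> T x \<in> V" "x \<in> V \<Longrightarrow> y \<in> V \<Longrightarrow> T (x + y) = T x + T y"
    "x \<in> V \<Longrightarrow> T (scl a x) = scl a (T x)"
  using assms by (auto simp: linear_endo_def)

locale complex_subspace = vector_space scl for scl :: "complex \<Rightarrow> 'v \<Rightarrow> 'v::ab_group_add" +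
  fixes V :: "'v set"
  assumes subspace_V: "subspace V"
begin

lemma V_zero [simp]: "0 \<in> V"
  using subspace_V by (rule subspace_0)

lemma V_add [simp]: "x \<in> V \<Longrightarrow> y \<in> V \<Longrightarrow> x + y \<in> V"
  using subspace_V by (rule subspace_add)

lemma V_diff [simp]: "x \<in> V \<Longrightarrow> y \<in> V \<Longrightarrow> x - y \<in> V"
  using subspace_V by (rule subspace_diff)

lemma V_scl [simp]: "x \<in> V \<Longrightarrow> scl a x \<in> V"
  using subspace_V by (rule subspace_scale)

lemma V_sum [simp]: "(\<And>i. i \<in> A \<Longrightarrow> f i \<in> V) \<Longrightarrow> sum f A \<in> V"
  using subspace_V by (rule subspace_sum)

lemma endo_zero: "linear_endo scl V T \<Longrightarrow> T 0 = 0"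
  using linear_endoD(3)[of scl V T 0 0] by simp

lemma endo_sum:
  assumes T: "linear_endo scl V T" and f: "\<And>i. i \<in> A \<Longrightarrow> f i \<in> V"
  shows "T (sum f A) = (\<Sum>i\<in>A. T (f i))"
  using f
proof (induction A rule: infinite_finite_induct)
  case (insert a A)
  then show ?case using linear_endoD(2)[OF T, of "f a" "sum f A"] by simp
qed (use endo_zero[OF T] in simp_all)

lemma endo_diff:
  assumes T: "linear_endo scl V T" and "x \<in> V" "y \<in> V"
  shows "T (x - y) = T x - T y"
  using linear_endoD(2)[OF T, of "x - y" y] assms by (simp add: algebra_simps)

lemma sum_const_scl: "(\<Sum>i\<in>A. x) = scl (of_nat (card A)) x"
  using scale_sum_left[of "\<lambda>_. 1" A x] by simp

end

text \<open>The maps \<open>nu b\<close>, \<open>nl c\<close>, \<open>td d\<close> and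
  \<open>w\<close> model the upper and lower unipotents, \<open>diag(inverse d, d)\<close> and the
  Weyl element \<open>mat2 0 1 (-1) 0\<close>. Working from relations between them keeps the
  computation over \<open>F\<close>, although the torus of \<open>U(1,1)\<close> has entries in
  \<open>E\<close>.\<close>

locale sl2_action = nonarch_local_field v + complex_subspace scl V
  for v :: "'a::field \<Rightarrow> int" and scl :: "complex \<Rightarrow> 'v \<Rightarrow> 'v::ab_group_add" and V :: "'v set" +
  fixes nu nl td :: "'a \<Rightarrow> 'v \<Rightarrow> 'v" and w :: "'v \<Rightarrow> 'v"
  assumes nu_endo: "\<And>b. linear_endo scl V (nu b)"
    and nl_endo: "\<And>c. linear_endo scl V (nl c)"
    and td_endo: "\<And>d. d \<noteq> 0 \<Longrightarrow> linear_endo scl V (td d)"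
    and w_endo: "linear_endo scl V w"
    and nu_zero: "\<And>x. x \<in> V \<Longrightarrow> nu 0 x = x"
    and nu_add: "\<And>a b x. x \<in> V \<Longrightarrow> nu (a + b) x = nu a (nu b x)"
    and nl_zero: "\<And>x. x \<in> V \<Longrightarrow> nl 0 x = x"
    and nl_add: "\<And>a b x. x \<in> V \<Longrightarrow> nl (a + b) x = nl a (nl b x)"
    and td_one: "\<And>x. x \<in> V \<Longrightarrow> td 1 x = x"
    and td_mult: "\<And>c d x. c \<noteq> 0 \<Longrightarrow> d \<noteq> 0 \<Longrightarrow> x \<in> V \<Longrightarrow> td (c * d) x = td c (td d x)"
    and td_nu: "\<And>d b x. d \<noteq> 0 \<Longrightarrow> x \<in> V \<Longrightarrow> td d (nu b x) = nu (b / (d * d)) (td d x)"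
    and td_nl: "\<And>d c x. d \<noteq> 0 \<Longrightarrow> x \<in> V \<Longrightarrow> td d (nl c x) = nl (c * (d * d)) (td d x)"
    and nl_nu: "\<And>b c x. 1 + b * c \<noteq> 0 \<Longrightarrow> x \<in> V \<Longrightarrow>
      nl c (nu b x) = nu (b / (1 + b * c)) (td (1 + b * c) (nl (c / (1 + b * c)) x))"
    and nu_nl: "\<And>b c x. 1 + b * c \<noteq> 0 \<Longrightarrow> x \<in> V \<Longrightarrow>
      nu b (nl c x) = nl (c / (1 + b * c)) (td (inverse (1 + b * c)) (nu (b / (1 + b * c)) x))"
    and nu_w: "\<And>b x. x \<in> V \<Longrightarrow> nu b (w x) = w (nl (- b) x)"
    and nl_nu_w: "\<And>b x. b \<noteq> 0 \<Longrightarrow> x \<in> V \<Longrightarrow>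
      nl (- inverse b) (nu b x) = w (td b (nl (inverse b) x))"
    and w_inj: "\<And>x. x \<in> V \<Longrightarrow> w x = 0 \<Longrightarrow> x = 0"
    and nu_smooth: "\<And>x. x \<in> V \<Longrightarrow> \<exists>n. \<forall>b\<in>ideal_power v n. nu b x = x"
    and cuspidal: "span {nu b x - x | b x. x \<in> V} = V"
begin

lemma nu_V [simp]: "x \<in> V \<Longrightarrow> nu b x \<in> V"
  using nu_endo linear_endoD by blast

lemma nl_V [simp]: "x \<in> V \<Longrightarrow> nl b x \<in> V"
  using nl_endo linear_endoD by blast

lemma td_V [simp]: "d \<noteq> 0 \<Longrightarrow> x \<in> V \<Longrightarrow> td d x \<in> V"
  using td_endo linear_endoD by blast

lemma w_V [simp]: "x \<in> V \<Longrightarrow> w x \<in> V"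
  using w_endo linear_endoD by blast

lemmas nu_scl = linear_endoD(3)[OF nu_endo]
lemmas nl_scl = linear_endoD(3)[OF nl_endo]
lemmas td_scl = linear_endoD(3)[OF td_endo]
lemmas w_scl = linear_endoD(3)[OF w_endo]
lemmas nu_sum = endo_sum[OF nu_endo]
lemmas nl_sum = endo_sum[OF nl_endo]
lemmas td_sum = endo_sum[OF td_endo]

lemma nu_commute: "x \<in> V \<Longrightarrow> nu a (nu b x) = nu b (nu a x)"
  by (metis add.commute nu_add)

lemma nu_eq_0_iff: "x \<in> V \<Longrightarrow> nu b x = 0 \<longleftrightarrow> x = 0"
  by (metis add.left_inverse endo_zero nu_add nu_endo nu_zero)

lemma td_eq_0: "d \<noteq> 0 \<Longrightarrow> x \<in> V \<Longrightarrow> td d x = 0 \<Longrightarrow> x = 0"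
  using td_mult[of "inverse d" d x] td_one endo_zero[OF td_endo, of "inverse d"] by simp

section \<open>Averages over upper unipotents and Jacquet's lemma\<close>

definition fixed_nu :: "int \<Rightarrow> 'v \<Rightarrow> bool" where
  "fixed_nu n x \<longleftrightarrow> x \<in> V \<and> (\<forall>b\<in>P n. nu b x = x)"

lemma fixed_nu_mono: "fixed_nu m x \<Longrightarrow> m \<le> n \<Longrightarrow> fixed_nu n x"
  using P_mono by (auto simp: fixed_nu_def)

lemma fixed_nu_cong: "fixed_nu n x \<Longrightarrow> a - b \<in> P n \<Longrightarrow> nu a x = nu b x"
  using nu_add[of x b "a - b"] by (auto simp: fixed_nu_def)

text \<open>For a vector fixed by \<open>N(P n)\<close> this is, up to the index, its average over
  \<open>N(P (n - 1))\<close>; on other vectors it depends on the chosen representatives.\<close>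

definition nu_sum_step :: "int \<Rightarrow> 'v \<Rightarrow> 'v" where
  "nu_sum_step n x = (\<Sum>r\<in>reps (n - 1). nu r x)"

lemma step_V [simp]: "x \<in> V \<Longrightarrow> nu_sum_step n x \<in> V"
  by (simp add: nu_sum_step_def)

lemma step_endo: "linear_endo scl V (nu_sum_step n)"
  unfolding linear_endo_def nu_sum_step_def
  by (auto simp: linear_endoD(2)[OF nu_endo] nu_scl sum.distrib scale_sum_right)

lemma step_nu: "x \<in> V \<Longrightarrow> nu_sum_step n (nu b x) = nu b (nu_sum_step n x)"
  by (simp add: nu_sum_step_def nu_sum nu_commute)

text \<open>The representatives may be multiples \<open>c * r\<close> of representatives at another
  depth. This is how torus elements, which rescale \<open>nu\<close>, are seen to respect the
  step.\<close>

lemma step_scaled: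
  assumes x: "fixed_nu n x" and c: "c \<noteq> 0" "v c = n - 1 - a"
  shows "nu_sum_step n x = (\<Sum>r\<in>reps a. nu (c * r) x)"
  unfolding nu_sum_step_def
  by (rule sum_reps_scale[OF c, symmetric]) (use fixed_nu_cong[OF x] in auto)

lemma step_fixed:
  assumes x: "fixed_nu n x"
  shows "fixed_nu (n - 1) (nu_sum_step n x)"
  unfolding fixed_nu_def
proof (intro conjI ballI)
  have xV: "x \<in> V" using x by (simp add: fixed_nu_def)
  then show "nu_sum_step n x \<in> V" by simp
  fix b assume b: "b \<in> P (n - 1)"
  have "nu b (nu_sum_step n x) = (\<Sum>r\<in>reps (n - 1). nu (b + r) x)"
    using xV by (simp add: nu_sum_step_def nu_sum nu_add)
  also have "\<dots> = nu_sum_step n x"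
    unfolding nu_sum_step_def
    by (rule sum_reps_shift[OF b]) (use fixed_nu_cong[OF x] in auto)
  finally show "nu b (nu_sum_step n x) = nu_sum_step n x" .
qed

lemma step_of_fixed:
  assumes x: "fixed_nu (n - 1) x"
  shows "nu_sum_step n x = scl (of_nat (card (reps (n - 1)))) x"
proof -
  have "nu_sum_step n x = (\<Sum>r\<in>reps (n - 1). x)"
    unfolding nu_sum_step_def using x reps_P by (intro sum.cong) (auto simp: fixed_nu_def)
  then show ?thesis by (simp only: sum_const_scl)
qed

fun nu_sums :: "nat \<Rightarrow> int \<Rightarrow> 'v \<Rightarrow> 'v" where
  "nu_sums 0 n x = x"
| "nu_sums (Suc k) n x = nu_sums k (n - 1) (nu_sum_step n x)"

lemma sums_V [simp]: "x \<in> V \<Longrightarrow> nu_sums k n x \<in> V"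
  by (induction k arbitrary: n x) simp_all

lemma sums_endo: "linear_endo scl V (nu_sums k n)"
proof (induction k arbitrary: n)
  case 0
  then show ?case by (simp add: linear_endo_def)
next
  case (Suc k)
  then show ?case
    using step_endo[of n] Suc[of "n - 1"] by (simp add: linear_endo_def)
qed

lemma sums_nu: "x \<in> V \<Longrightarrow> nu_sums k n (nu b x) = nu b (nu_sums k n x)"
  by (induction k arbitrary: n x) (simp_all add: step_nu)

lemma sums_fixed: "fixed_nu n x \<Longrightarrow> fixed_nu (n - int k) (nu_sums k n x)"
proof (induction k arbitrary: n x)
  case (Suc k)
  then show ?case using Suc.IH[OF step_fixed[OF Suc.prems]] by (simp add: algebra_simps)
qed simp

text \<open>Summing over layers that already fix the vector only multiplies it by indices, so the
  depth at which the sums start is immaterial.\<close>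

lemma sums_of_fixed:
  assumes "fixed_nu n x"
  shows "\<exists>a. a \<noteq> 0 \<and> nu_sums k (n + int k) x = scl a x"
proof (induction k)
  case 0
  then show ?case by (intro exI[of _ 1]) simp
next
  case (Suc k)
  then obtain a where a: "a \<noteq> 0" "nu_sums k (n + int k) x = scl a x" by blast
  let ?m = "n + int (Suc k)"
  have x: "x \<in> V" using assms by (simp add: fixed_nu_def)
  have "nu_sum_step ?m x = scl (of_nat (card (reps (?m - 1)))) x"
    by (rule step_of_fixed) (rule fixed_nu_mono[OF assms], simp)
  then have "nu_sums (Suc k) ?m x = nu_sums k (n + int k) (scl (of_nat (card (reps (?m - 1)))) x)"
    by simp
  also have "\<dots> = scl (of_nat (card (reps (?m - 1)))) (scl a x)"
    using linear_endoD(3)[OF sums_endo x] a by simp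
  finally show ?case
    using a(1) card_reps by (intro exI[of _ "of_nat (card (reps (?m - 1))) * a"]) simp
qed

lemma sums_add: "nu_sums (k + l) n x = nu_sums l (n - int k) (nu_sums k n x)"
  by (induction k arbitrary: n x) (simp_all add: algebra_simps)

text \<open>Jacquet's lemma. The vectors killed by all sufficiently long sums form a subspace. It
  contains every \<open>nu b y - y\<close>, because \<open>nu b\<close> commutes with the sums and
  fixes their values once \<open>b\<close> lies in the range of summation. Cuspidality says that
  these vectors span \<open>V\<close>.\<close>

lemma sums_vanish:
  assumes x: "fixed_nu n x"
  shows "\<exists>k. nu_sums k n x = 0"
proof -
  \<comment> \<open>All late starting depths \<open>n\<close> are quantified over, so that vectors
    fixed at different depths can be added.\<close>
  define Q where "Q x \<longleftrightarrow> (\<exists>N. \<forall>n\<ge>N. \<exists>K. \<forall>k\<ge>K. nu_sums k n x = 0)" for x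
  define S where "S = {x \<in> V. Q x}"
  have "subspace S"
  proof (rule subspaceI)
    have "nu_sums k n 0 = 0" for k n using endo_zero[OF sums_endo] .
    then show "0 \<in> S" by (simp add: S_def Q_def)
  next
    fix x y assume xy: "x \<in> S" "y \<in> S"
    then have V: "x \<in> V" "y \<in> V" and "Q x" "Q y" by (simp_all add: S_def)
    then obtain M N where M: "\<And>n. M \<le> n \<Longrightarrow> \<exists>K. \<forall>k\<ge>K. nu_sums k n x = 0"
      and N: "\<And>n. N \<le> n \<Longrightarrow> \<exists>K. \<forall>k\<ge>K. nu_sums k n y = 0"
      unfolding Q_def by blast
    have "\<exists>K. \<forall>k\<ge>K. nu_sums k n (x + y) = 0" if "max M N \<le> n" for n
    proof -
      obtain K where K: "\<forall>k\<ge>K. nu_sums k n x = 0" using M[of n] \<open>max M N \<le> n\<close> by auto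
      obtain L where L: "\<forall>k\<ge>L. nu_sums k n y = 0" using N[of n] \<open>max M N \<le> n\<close> by auto
      have "nu_sums k n (x + y) = 0" if "max K L \<le> k" for k
        using linear_endoD(2)[OF sums_endo V] K L that by simp
      then show ?thesis by blast
    qed
    then have "Q (x + y)" unfolding Q_def by blast
    then show "x + y \<in> S" using V by (simp add: S_def)
  next
    fix a x assume "x \<in> S"
    then have xV: "x \<in> V" and "Q x" by (simp_all add: S_def)
    have e: "nu_sums k n (scl a x) = scl a (nu_sums k n x)" for k n
      using linear_endoD(3)[OF sums_endo xV] .
    have "Q (scl a x)"
      using \<open>Q x\<close> unfolding Q_def e by (metis scale_zero_right)
    then show "scl a x \<in> S" using xV by (simp add: S_def)
  qed
  moreover
  have "nu b y - y \<in> S" if y: "y \<in> V" for b y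
  proof -
    obtain N where N: "\<forall>b\<in>P N. nu b y = y" using nu_smooth[OF y] by blast
    have "\<exists>K. \<forall>k\<ge>K. nu_sums k n (nu b y - y) = 0" if n: "N \<le> n" for n
    proof (intro exI allI impI)
      fix k assume k: "nat (n - v b) \<le> k"
      have "fixed_nu n y" using N y n P_mono by (auto simp: fixed_nu_def)
      then have "fixed_nu (n - int k) (nu_sums k n y)" by (rule sums_fixed)
      moreover have "b \<in> P (n - int k)" using k unfolding in_P by linarith
      ultimately have "nu b (nu_sums k n y) = nu_sums k n y" by (simp add: fixed_nu_def)
      then show "nu_sums k n (nu b y - y) = 0"
        using y sums_nu[OF y] endo_diff[OF sums_endo, of "nu b y" y] by simp
    qed
    then have "Q (nu b y - y)" unfolding Q_def by blast
    then show ?thesis using y by (simp add: S_def)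
  qed
  then have "{nu b x - x | b x. x \<in> V} \<subseteq> S" by blast
  ultimately have "span {nu b x - x | b x. x \<in> V} \<subseteq> S"
    by (intro span_minimal)
  then have "Q x" using cuspidal x by (auto simp: fixed_nu_def S_def)
  then obtain N where N: "\<And>n. N \<le> n \<Longrightarrow> \<exists>K. \<forall>k\<ge>K. nu_sums k n x = 0" unfolding Q_def by blast
  \<comment> \<open>The start is moved from \<open>n\<close> to at least \<open>N\<close>; the
    \<open>l\<close> additional layers fix \<open>x\<close> and contribute only the nonzero scalar
    \<open>a\<close>.\<close>
  define l where "l = nat (N - n)"
  have "N \<le> n + int l" by (simp add: l_def)
  from N[OF this] obtain K where K: "\<forall>k\<ge>K. nu_sums k (n + int l) x = 0" by blast
  obtain a where a: "a \<noteq> 0" "nu_sums l (n + int l) x = scl a x"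
    using sums_of_fixed[OF x] by blast
  have "nu_sums (l + K) (n + int l) x = 0" using K by simp
  then have "scl a (nu_sums K n x) = 0"
    using linear_endoD(3)[OF sums_endo, of x] x a(2) by (simp add: sums_add fixed_nu_def)
  then show ?thesis using a(1) by auto
qed

section \<open>Vectors on which the torus acts through a character\<close>

definition torus_type :: "int \<Rightarrow> int \<Rightarrow> nat \<Rightarrow> ('a \<Rightarrow> complex) \<Rightarrow> 'v \<Rightarrow> bool" where
  "torus_type i j k \<eta> x \<longleftrightarrow> fixed_nu i x \<and> (\<forall>c\<in>P j. nl c x = x) \<and>
     (\<forall>d\<in>unit_filtration v k. td d x = scl (\<eta> d) x)"

lemma typeD:
  assumes "torus_type i j k \<eta> x"
  shows "x \<in> V" "fixed_nu i x" "\<And>b. b \<in> P i \<Longrightarrow> nu b x = x" "\<And>c. c \<in> P j \<Longrightarrow> nl c x = x"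
    "\<And>d. d \<in> unit_filtration v k \<Longrightarrow> td d x = scl (\<eta> d) x"
  using assms by (auto simp: torus_type_def fixed_nu_def)

lemma type_mono:
  assumes "torus_type i j k \<eta> x" "i \<le> i'" "j \<le> j'" "k \<le> k'"
  shows "torus_type i' j' k' \<eta> x"
  unfolding torus_type_def
  using typeD[OF assms(1)] assms(2-4) fixed_nu_mono P_mono unit_filtration_mono by blast

lemma type_zero: "torus_type i j k \<eta> 0"
  unfolding torus_type_def fixed_nu_def
  using endo_zero[OF nu_endo] endo_zero[OF nl_endo] endo_zero[OF td_endo] unit_nonzero
  by (auto simp: unit_filtration_iff)

lemma type_add:
  assumes "torus_type i j k \<eta> x" "torus_type i j k \<eta> y"
  shows "torus_type i j k \<eta> (x + y)"
  unfolding torus_type_def fixed_nu_def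
  using typeD[OF assms(1)] typeD[OF assms(2)] linear_endoD(2)[OF nu_endo]
    linear_endoD(2)[OF nl_endo] linear_endoD(2)[OF td_endo] unit_nonzero
  by (auto simp: unit_filtration_iff scale_right_distrib)

lemma type_scl:
  assumes "torus_type i j k \<eta> x"
  shows "torus_type i j k \<eta> (scl a x)"
  unfolding torus_type_def fixed_nu_def
  using typeD[OF assms(1)] nu_scl nl_scl td_scl unit_nonzero
  by (auto simp: unit_filtration_iff mult.commute)

lemma type_sum: "(\<And>a. a \<in> A \<Longrightarrow> torus_type i j k \<eta> (f a)) \<Longrightarrow> torus_type i j k \<eta> (sum f A)"
  by (induction A rule: infinite_finite_induct) (auto intro: type_zero type_add)

lemma type_nl_nu:
  assumes x: "torus_type i j k \<eta> x" and d: "1 + b * c \<in> unit_filtration v k" and c: "c \<in> P j"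
  shows "nl c (nu b x) = scl (\<eta> (1 + b * c)) (nu (b / (1 + b * c)) x)"
proof -
  have u: "1 + b * c \<in> int_units v" using d by (simp add: unit_filtration_iff)
  then have "c / (1 + b * c) \<in> P j" using P_unit_divide c by blast
  moreover have "1 + b * c \<noteq> 0" using u by (rule unit_nonzero)
  ultimately show ?thesis using typeD[OF x] d by (simp add: nl_nu nu_scl)
qed

lemma nu_divide_cong:
  assumes x: "fixed_nu i x" and u: "1 + b * c \<in> int_units v" and bc: "b * b * c \<in> P i"
  shows "nu (b / (1 + b * c)) x = nu b x"
proof (rule fixed_nu_cong[OF x])
  have "b / (1 + b * c) - b = - (b * b * c / (1 + b * c))"
    using unit_nonzero[OF u] by (simp add: field_simps)
  then show "b / (1 + b * c) - b \<in> P i"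
    using bc P_unit_divide[OF u] by simp
qed

text \<open>For \<open>r\<close> in \<open>P (i - 1)\<close> and \<open>c\<close> in
  \<open>P (j + 1)\<close> the product \<open>r * c\<close> lies in \<open>P (Suc k)\<close>, where
  the commutation relation only produces values \<open>\<eta> (1 + r * c) = 1\<close>. So
  \<open>nl c\<close> fixes each summand \<open>nu r x\<close>. The sum \<open>i + j\<close> is
  preserved, which makes the step repeatable.\<close>

lemma type_step:
  assumes x: "torus_type i j k \<eta> x" and ij: "i + j = int (Suc k)"
    and triv: "\<And>u. u \<in> unit_filtration v (Suc k) \<Longrightarrow> \<eta> u = 1"
  shows "torus_type (i - 1) (j + 1) k \<eta> (nu_sum_step i x)"
  unfolding torus_type_def
proof (intro conjI ballI)
  have xV: "x \<in> V" using typeD[OF x] by blast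
  show "fixed_nu (i - 1) (nu_sum_step i x)"
    using typeD[OF x] by (intro step_fixed)
  fix c assume c: "c \<in> P (j + 1)"
  have "nl c (nu r x) = nu r x" if r: "r \<in> P (i - 1)" for r
  proof -
    have rc: "r * c \<in> P (int (Suc k))" using r c ij by (intro P_mult_mono[OF r c]) simp
    then have uf: "1 + r * c \<in> unit_filtration v (Suc k)"
      using one_plus_unit[OF rc] by (simp add: unit_filtration_iff)
    then have "nl c (nu r x) = scl (\<eta> (1 + r * c)) (nu (r / (1 + r * c)) x)"
      by (intro type_nl_nu[OF x] unit_filtration_mono[OF uf]) (use c P_mono[of c "j + 1" j] in auto)
    also have "\<dots> = nu (r / (1 + r * c)) x" using triv[OF uf] by simp
    also have "\<dots> = nu r x"
    proof (rule nu_divide_cong)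
      have "r * (r * c) \<in> P i" using ij by (intro P_mult_mono[OF r rc]) simp
      then show "r * r * c \<in> P i" by (simp add: mult.assoc)
    qed (use typeD[OF x] uf in \<open>simp_all add: unit_filtration_iff\<close>)
    finally show ?thesis .
  qed
  then show "nl c (nu_sum_step i x) = nu_sum_step i x"
    unfolding nu_sum_step_def using xV reps_P by (simp add: nl_sum)
next
  have xV: "x \<in> V" using typeD[OF x] by blast
  fix d assume d: "d \<in> unit_filtration v k"
  then have du: "d \<in> int_units v" by (simp add: unit_filtration_iff)
  then have d0: "d \<noteq> 0" by (rule unit_nonzero)
  let ?e = "inverse (d * d)"
  have e: "?e \<noteq> 0" "v ?e = 0" using du d0 by (simp_all add: val_inverse val_mult int_units_def)
  have "td d (nu_sum_step i x) = (\<Sum>r\<in>reps (i - 1). td d (nu r x))"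
    unfolding nu_sum_step_def using xV d0 by (simp add: td_sum)
  also have "\<dots> = (\<Sum>r\<in>reps (i - 1). scl (\<eta> d) (nu (?e * r) x))"
    using xV d0 typeD[OF x] d by (simp add: td_nu nu_scl divide_inverse mult.commute)
  also have "\<dots> = scl (\<eta> d) (nu_sum_step i x)"
    using step_scaled[OF typeD(2)[OF x] e(1), of "i - 1"] e(2) by (simp add: scale_sum_right)
  finally show "td d (nu_sum_step i x) = scl (\<eta> d) (nu_sum_step i x)" .
qed

text \<open>Multiplication by \<open>r\<close> carries \<open>P a\<close> onto \<open>P k\<close>,
  and there \<open>\<eta> (1 + z)\<close> is an additive character of the last layer on which
  \<open>\<eta>\<close> is nontrivial.\<close>

lemma sum_character_scaled:
  fixes \<eta> :: "'a \<Rightarrow> complex"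
  assumes mult: "\<And>x y. x \<in> int_units v \<Longrightarrow> y \<in> int_units v \<Longrightarrow> \<eta> (x * y) = \<eta> x * \<eta> y"
    and triv: "\<And>u. u \<in> unit_filtration v (Suc k) \<Longrightarrow> \<eta> u = 1"
    and nontriv: "\<exists>u\<in>unit_filtration v k. \<eta> u \<noteq> 1" and k: "1 \<le> k"
    and r: "r \<noteq> 0" "v r = int k - a"
  shows "(\<Sum>y\<in>reps a. \<eta> (1 + r * y)) = 0"
proof -
  let ?f = "\<lambda>z. \<eta> (1 + z)"
  have add: "?f (x + y) = ?f x * ?f y" if "x \<in> P (int k)" "y \<in> P (int k)" for x y
    using character_additive[of \<eta> "Suc k" x y] mult triv k that by simp
  have t: "?f x = 1" if "x \<in> P (int k + 1)" for x
    using one_plus_unit[OF that] that by (intro triv) (simp add: unit_filtration_iff add.commute)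
  have cong: "?f x = ?f y" if "x \<in> P (int k)" "y \<in> P (int k)" "x - y \<in> P (int k + 1)" for x y
    using add[of y "x - y"] t[OF that(3)] P_diff[OF that(1,2)] that(2) by simp
  obtain u where u: "u \<in> unit_filtration v k" "\<eta> u \<noteq> 1" using nontriv by blast
  have "(\<Sum>y\<in>reps a. ?f (r * y)) = sum ?f (reps (int k))"
    by (rule sum_reps_scale[OF r _ cong]) simp_all
  also have "\<dots> = 0"
    by (rule sum_additive_character[OF add t, where b = "u - 1"]) (use u in \<open>simp_all add: unit_filtration_iff\<close>)
  finally show ?thesis .
qed

text \<open>Summing the step over the lower unipotents of \<open>P j\<close> recovers
  \<open>x\<close>. Indeed \<open>nl y\<close> multiplies \<open>nu r x\<close> by
  \<open>\<eta> (1 + r * y)\<close>, a nontrivial character in \<open>y\<close> when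
  \<open>r\<close> has exact valuation \<open>i - 1\<close>, so only the class of
  \<open>r = 0\<close> survives.\<close>

lemma step_nonzero_ramified:
  assumes x: "torus_type i j k \<eta> x" "x \<noteq> 0" and ij: "i + j = int (Suc k)"
    and mult: "\<And>x y. x \<in> int_units v \<Longrightarrow> y \<in> int_units v \<Longrightarrow> \<eta> (x * y) = \<eta> x * \<eta> y"
    and triv: "\<And>u. u \<in> unit_filtration v (Suc k) \<Longrightarrow> \<eta> u = 1"
    and nontriv: "\<exists>u\<in>unit_filtration v k. \<eta> u \<noteq> 1" and k: "1 \<le> k"
  shows "nu_sum_step i x \<noteq> 0"
proof
  assume zero: "nu_sum_step i x = 0"
  have xV: "x \<in> V" using typeD[OF x(1)] by blast
  have nl_nu_r: "nl y (nu r x) = scl (\<eta> (1 + r * y)) (nu r x)" if r: "r \<in> P (i - 1)" and y: "y \<in> P j" for r y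
  proof -
    have ry: "r * y \<in> P (int k)" using ij by (intro P_mult_mono[OF r y]) simp
    then have uf: "1 + r * y \<in> unit_filtration v k"
      using one_plus_unit[OF ry] k by (simp add: unit_filtration_iff)
    have "r * (r * y) \<in> P i" using ij k by (intro P_mult_mono[OF r ry]) simp
    then have "nu (r / (1 + r * y)) x = nu r x"
      using typeD[OF x(1)] uf by (intro nu_divide_cong) (simp_all add: unit_filtration_iff mult.assoc)
    then show ?thesis using type_nl_nu[OF x(1) uf y] by simp
  qed
  have "(\<Sum>y\<in>reps j. nl y (nu_sum_step i x)) = (\<Sum>y\<in>reps j. \<Sum>r\<in>reps (i - 1). scl (\<eta> (1 + r * y)) (nu r x))"
    unfolding nu_sum_step_def using xV nl_nu_r reps_P by (intro sum.cong) (simp_all add: nl_sum)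
  also have "\<dots> = (\<Sum>r\<in>reps (i - 1). \<Sum>y\<in>reps j. scl (\<eta> (1 + r * y)) (nu r x))"
    by (rule sum.swap)
  also have "\<dots> = (\<Sum>r\<in>reps (i - 1). scl (\<Sum>y\<in>reps j. \<eta> (1 + r * y)) (nu r x))"
    by (simp add: scale_sum_left)
  also have "\<dots> = scl (of_nat (card (reps j))) x"
  proof (rule sum_reps_isolate)
    fix r assume r: "r \<in> P (i - 1 + 1)"
    have "\<eta> (1 + r * y) = 1" if y: "y \<in> reps j" for y
    proof -
      have "r * y \<in> P (int (Suc k))" using ij by (intro P_mult_mono[OF r reps_P[OF y]]) simp
      then show ?thesis using one_plus_unit by (intro triv) (force simp: unit_filtration_iff)
    qed
    then show "scl (\<Sum>y\<in>reps j. \<eta> (1 + r * y)) (nu r x) = scl (of_nat (card (reps j))) x"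
      using r typeD[OF x(1)] by simp
  next
    fix r assume "r \<in> P (i - 1)" "r \<notin> P (i - 1 + 1)"
    then have "r \<noteq> 0" "v r = int k - j" using ij by (auto simp: in_P)
    from sum_character_scaled[OF mult triv nontriv k this]
    show "scl (\<Sum>y\<in>reps j. \<eta> (1 + r * y)) (nu r x) = 0" by simp
  qed
  finally show False
    using zero x(2) card_reps endo_zero[OF nl_endo] by simp
qed

text \<open>This is a computation in a principal series of \<open>SL\<^sub>2\<close> over the residue field: \<open>x\<close> is fixed by the
  lower unipotents, and the sum over the upper unipotents followed by the sum over the lower ones
  is evaluated by means of the Bruhat decomposition.\<close>

lemma step_nonzero_tame:
  assumes x: "torus_type i j 0 \<eta> x" "x \<noteq> 0" and ij: "i + j = 1"
    and triv: "\<And>u. u \<in> unit_filtration v 1 \<Longrightarrow> \<eta> u = 1"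
  shows "nu_sum_step i x \<noteq> 0"
proof
  assume zero: "nu_sum_step i x = 0"
  have xV: "x \<in> V" and xf: "fixed_nu i x" using typeD[OF x(1)] by blast+
  obtain p where p: "p \<noteq> 0" "v p = 1" using ex_uniformizer .
  define p0 where "p0 = p powi (i - 1)"
  have p0: "p0 \<noteq> 0" "v p0 = i - 1" using p by (simp_all add: p0_def val_power_int)
  obtain z where z: "z \<in> reps 0" "z \<in> P 1" and rest: "\<And>t. t \<in> reps 0 - {z} \<Longrightarrow> t \<in> P 0 \<and> t \<notin> P 1"
    using reps_zero_split[of 0] by auto
  \<comment> \<open>The representative \<open>z\<close> stands for the zero class, so
    \<open>R\<close> represents the nonzero residue classes.\<close>
  define R where "R = reps 0 - {z}"
  have R: "t \<in> int_units v" if "t \<in> R" for t using rest that by (simp add: R_def int_units_iff)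
  have finR: "finite R" using finite_reps by (simp add: R_def)
  have split: "sum f (reps 0) = f z + sum f R" for f :: "'a \<Rightarrow> 'v"
    using z(1) finite_reps by (simp add: R_def sum.remove)
  define \<sigma> where "\<sigma> = sum \<eta> R"
  \<comment> \<open>The vector from the other Bruhat cell. Below, \<open>fy\<close> shows it fixed
    by \<open>nu\<close> on \<open>P (i - 1)\<close>, one layer more than is given for
    \<open>x\<close>.\<close>
  define y where "y = w (td p0 x)"
  have yV: "y \<in> V" using xV p0 by (simp add: y_def)
  have y0: "y \<noteq> 0" using x(2) xV p0 w_inj td_eq_0 td_V unfolding y_def by metis
  \<comment> \<open>The whole sum is zero and the zero class contributes \<open>x\<close>, so the
    nonzero classes contribute \<open>- x\<close>; a unit \<open>c\<close> only permutes the
    classes.\<close>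
  have rn: "sum (\<lambda>t. nu (c * p0 * t) x) R = - x" if c: "c \<in> int_units v" for c
  proof -
    have cp: "c * p0 \<noteq> 0" "v (c * p0) = i - 1 - 0" using c p0 by (simp_all add: int_units_def val_mult)
    have "(\<Sum>t\<in>reps 0. nu (c * p0 * t) x) = 0"
      using step_scaled[OF xf cp] zero by simp
    moreover have "nu (c * p0 * z) x = x"
    proof (rule typeD(3)[OF x(1)])
      show "c * p0 * z \<in> P i" using cp z(2) by (simp add: P_scale)
    qed
    ultimately show ?thesis by (simp add: split eq_neg_iff_add_eq_0 add.commute)
  qed
  have G: "(\<Sum>b\<in>reps j. nl b (nu (p0 * t) x)) =
      scl (\<eta> t) y + (\<Sum>u\<in>R. scl (\<eta> u) (nu (inverse u * p0 * t) x))" if t: "t \<in> R" for t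
  proof -
    define a where "a = p0 * t"
    have tu: "t \<in> int_units v" using R[OF t] .
    have a: "a \<noteq> 0" "v a = i - 1" using p0 tu by (simp_all add: a_def int_units_def val_mult)
    have aP: "a \<in> P (i - 1)" using a by (simp add: in_P)
    \<comment> \<open>Substituting \<open>u = 1 + a * b\<close> turns the sum over \<open>b\<close>
      into one over residues: \<open>u = 0\<close> gives the Weyl term, and a unit \<open>u\<close>
      gives a scalar times an upper unipotent applied to \<open>x\<close>.\<close>
    define g where "g u = nl ((u - 1) / a) (nu a x)" for u
    have nl_fix: "nl b (nu a x) = nu a x" if b: "b \<in> P (j + 1)" for b
    proof -
      have ab: "a * b \<in> P 1" using ij by (intro P_mult_mono[OF aP b]) simp
      then have uf: "1 + a * b \<in> unit_filtration v 1"
        using one_plus_unit[OF ab] by (simp add: unit_filtration_iff)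
      then have "nl b (nu a x) = scl (\<eta> (1 + a * b)) (nu (a / (1 + a * b)) x)"
        by (intro type_nl_nu[OF x(1) unit_filtration_mono[OF uf]]) (use b P_mono[of b "j + 1" j] in auto)
      also have "\<dots> = nu (a / (1 + a * b)) x" using triv[OF uf] by simp
      also have "\<dots> = nu a x"
      proof (rule nu_divide_cong[OF xf])
        have "a * (a * b) \<in> P i" by (rule P_mult_mono[OF aP ab]) simp
        then show "a * a * b \<in> P i" by (simp add: mult.assoc)
      qed (use uf in \<open>simp add: unit_filtration_iff\<close>)
      finally show ?thesis .
    qed
    have gcong: "g r = g s" if "r - s \<in> P 1" for r s
    proof -
      have "(r - s) / a \<in> P (j + 1)"
      proof -
        have "a * ((r - s) / a) \<in> P 1" using that a by simp
        then have "(r - s) / a \<in> P (1 - v a)" using P_scale[OF a(1)] by blast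
        moreover have "1 - v a = j + 1" using a ij by simp
        ultimately show ?thesis by simp
      qed
      moreover have "(r - 1) / a = (s - 1) / a + (r - s) / a" by (simp add: diff_divide_distrib)
      ultimately show ?thesis unfolding g_def using xV nl_fix by (simp add: nl_add)
    qed
    have "(\<Sum>b\<in>reps j. nl b (nu a x)) = (\<Sum>b\<in>reps j. g (1 + a * b))"
      using a by (simp add: g_def)
    also have "\<dots> = (\<Sum>b\<in>reps 0. g (1 + b))"
      by (rule sum_reps_scale[OF a, of 0 j "\<lambda>b. g (1 + b)"]) (use ij in \<open>auto intro: gcong\<close>)
    also have "\<dots> = sum g (reps 0)"
      by (rule sum_reps_shift) (auto intro: gcong simp: one_in_P)
    also have "\<dots> = g 0 + sum g R"
      using gcong[of z 0] z(2) by (simp add: split)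
    also have "g 0 = scl (\<eta> t) y"
    proof -
      have ja: "inverse a \<in> P j" using a ij by (simp add: in_P val_inverse)
      have "g 0 = nl (- inverse a) (nu a x)" by (simp add: g_def divide_inverse)
      also have "\<dots> = w (td a x)"
        using a(1) xV typeD(4)[OF x(1) ja] by (simp add: nl_nu_w)
      also have "td a x = scl (\<eta> t) (td p0 x)"
        using p0 tu xV typeD(5)[OF x(1), of t] unit_nonzero[OF tu]
        by (simp add: a_def td_mult td_scl unit_filtration_def)
      finally show ?thesis using p0 xV by (simp add: y_def w_scl)
    qed
    also have "sum g R = (\<Sum>u\<in>R. scl (\<eta> u) (nu (inverse u * p0 * t) x))"
    proof (rule sum.cong)
      fix u assume "u \<in> R"
      then have u: "u \<in> int_units v" by (rule R)
      have e: "1 + a * ((u - 1) / a) = u" using a(1) by simp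
      have "u - 1 \<in> P 0" using unit_P[OF u] by (intro P_diff) (simp_all add: one_in_P)
      then have "a * ((u - 1) / a) \<in> P 0" using a(1) by simp
      then have "(u - 1) / a \<in> P (0 - v a)" using P_scale[OF a(1)] by blast
      moreover have "0 - v a = j" using a ij by simp
      ultimately have "(u - 1) / a \<in> P j" by simp
      then have "g u = scl (\<eta> u) (nu (a / u) x)"
        using type_nl_nu[OF x(1), of a "(u - 1) / a"] u unfolding e g_def
        by (simp add: unit_filtration_def)
      then show "g u = scl (\<eta> u) (nu (inverse u * p0 * t) x)"
        by (simp add: a_def divide_inverse ac_simps)
    qed simp
    finally show ?thesis by (simp add: a_def)
  qed
  let ?q = "of_nat (card (reps j)) :: complex"
  \<comment> \<open>The step, assumed zero, is summed over the lower unipotents. Evaluating this sum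
    produces the linear relation \<open>main\<close> between \<open>x\<close> and
    \<open>y\<close>.\<close>
  have "0 = (\<Sum>b\<in>reps j. nl b (nu_sum_step i x))"
    unfolding zero by (simp add: endo_zero[OF nl_endo])
  also have "\<dots> = (\<Sum>b\<in>reps j. \<Sum>t\<in>reps 0. nl b (nu (p0 * t) x))"
    using step_scaled[OF xf p0(1), of 0] p0 xV by (simp add: nl_sum)
  also have "\<dots> = (\<Sum>t\<in>reps 0. \<Sum>b\<in>reps j. nl b (nu (p0 * t) x))"
    by (rule sum.swap)
  also have "\<dots> = (\<Sum>b\<in>reps j. nl b (nu (p0 * z) x)) + (\<Sum>t\<in>R. \<Sum>b\<in>reps j. nl b (nu (p0 * t) x))"
    by (rule split)
  also have "(\<Sum>b\<in>reps j. nl b (nu (p0 * z) x)) = scl ?q x"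
  proof -
    have "p0 * z \<in> P i" using p0 z(2) by (simp add: P_scale)
    then have "(\<Sum>b\<in>reps j. nl b (nu (p0 * z) x)) = (\<Sum>b\<in>reps j. x)"
      using typeD(3,4)[OF x(1)] reps_P by (intro sum.cong) simp_all
    then show ?thesis by (simp only: sum_const_scl)
  qed
  also have "(\<Sum>t\<in>R. \<Sum>b\<in>reps j. nl b (nu (p0 * t) x)) =
      scl \<sigma> y + (\<Sum>t\<in>R. \<Sum>u\<in>R. scl (\<eta> u) (nu (inverse u * p0 * t) x))"
    using G by (simp add: sum.distrib \<sigma>_def scale_sum_left)
  also have "(\<Sum>t\<in>R. \<Sum>u\<in>R. scl (\<eta> u) (nu (inverse u * p0 * t) x)) =
      (\<Sum>u\<in>R. scl (\<eta> u) (\<Sum>t\<in>R. nu (inverse u * p0 * t) x))"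
    by (subst sum.swap) (simp add: scale_sum_right)
  also have "\<dots> = (\<Sum>u\<in>R. scl (\<eta> u) (- x))"
    using rn[OF unit_inverse[OF R]] by (intro sum.cong) simp_all
  also have "\<dots> = - scl \<sigma> x"
    by (simp add: \<sigma>_def scale_sum_left sum_negf)
  finally have main: "scl (\<sigma> - ?q) x = scl \<sigma> y"
    by (simp add: scale_left_diff_distrib algebra_simps) 
  show False
  \<comment> \<open>If equality holds, the relation kills \<open>y\<close>, since \<open>?q\<close>
    is not zero. Otherwise \<open>x\<close> is a multiple of \<open>y\<close>, hence fixed by
    \<open>nu\<close> on \<open>P (i - 1)\<close>, and its step is a nonzero multiple of
    \<open>x\<close>.\<close>
  proof (cases "\<sigma> = ?q")
    case True
    then have "scl \<sigma> y = 0" using main by simp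
    then show False using True y0 card_reps by simp
  next
    case False
    have fy: "nu b y = y" if b: "b \<in> P (i - 1)" for b
    proof -
      have "- b / (p0 * p0) \<in> P j"
      proof -
        have "p0 * p0 * (- b / (p0 * p0)) \<in> P (i - 1)" using b p0 by simp
        then have "- b / (p0 * p0) \<in> P (i - 1 - v (p0 * p0))"
          using P_scale[of "p0 * p0"] p0(1) by (metis mult_eq_0_iff)
        moreover have "i - 1 - v (p0 * p0) = j" using p0 ij by (simp add: val_mult)
        ultimately show ?thesis by simp
      qed
      then have "td p0 x = td p0 (nl (- b / (p0 * p0)) x)" using typeD(4)[OF x(1)] by simp
      also have "\<dots> = nl (- b) (td p0 x)" using p0 xV by (simp add: td_nl)
      finally show ?thesis using xV p0 by (simp add: y_def nu_w)
    qed
    have xe: "x = scl (\<sigma> / (\<sigma> - ?q)) y"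
    proof -
      have "scl (\<sigma> / (\<sigma> - ?q)) y = scl (1 / (\<sigma> - ?q)) (scl \<sigma> y)" by simp
      also have "\<dots> = scl (1 / (\<sigma> - ?q)) (scl (\<sigma> - ?q) x)" using main by (simp only:)
      also have "\<dots> = x" using False by simp
      finally show ?thesis ..
    qed
    have "fixed_nu (i - 1) x"
      unfolding fixed_nu_def
    proof (intro conjI ballI)
      fix b assume b: "b \<in> P (i - 1)"
      have "nu b (scl (\<sigma> / (\<sigma> - ?q)) y) = scl (\<sigma> / (\<sigma> - ?q)) y"
        unfolding nu_scl[OF yV] fy[OF b] ..
      then show "nu b x = x" unfolding xe[symmetric] .
    qed (rule xV)
    then show False using step_of_fixed zero x(2) card_reps by simp
  qed
qed

lemma no_split_type:
  assumes x: "torus_type i j k \<eta> x" "x \<noteq> 0" and ij: "i + j = int (Suc k)"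
    and mult: "\<And>x y. x \<in> int_units v \<Longrightarrow> y \<in> int_units v \<Longrightarrow> \<eta> (x * y) = \<eta> x * \<eta> y"
    and triv: "\<And>u. u \<in> unit_filtration v (Suc k) \<Longrightarrow> \<eta> u = 1"
    and nontriv: "k = 0 \<or> (\<exists>u\<in>unit_filtration v k. \<eta> u \<noteq> 1)"
  shows False
proof -
  have nz: "nu_sum_step i x \<noteq> 0" if "torus_type i j k \<eta> x" "x \<noteq> 0" "i + j = int (Suc k)" for i j x
  proof (cases "k = 0")
    case True
    then show ?thesis using step_nonzero_tame[of i j \<eta> x] that triv by simp
  next
    case False
    then show ?thesis using step_nonzero_ramified[OF that mult triv] nontriv by simp
  qed
  have "nu_sums l i x \<noteq> 0" if "torus_type i j k \<eta> x" "x \<noteq> 0" "i + j = int (Suc k)" for l i j x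
    using that
  proof (induction l arbitrary: i j x)
    case (Suc l)
    have "torus_type (i - 1) (j + 1) k \<eta> (nu_sum_step i x)"
      using type_step[OF Suc.prems(1,3)] triv by blast
    then show ?case using Suc.IH[of "i - 1" "j + 1"] nz[OF Suc.prems] Suc.prems(3) by simp
  qed simp
  then show False
    using sums_vanish[OF typeD(2)[OF x(1)]] x ij by blast
qed

text \<open>Conjugation by \<open>nu b\<close> for a suitable \<open>b\<close> diagonalizes the action of \<open>nl\<close> on \<open>P (j - 1)\<close>, since
  \<open>\<eta>\<close> is ramified enough.\<close>

lemma type_descent:
  assumes x: "torus_type i j k \<eta> x" "x \<noteq> 0" and ij: "int (Suc k) < i + j" "i + j \<le> 2 * int k + 1"
    and mult: "\<And>x y. x \<in> int_units v \<Longrightarrow> y \<in> int_units v \<Longrightarrow> \<eta> (x * y) = \<eta> x * \<eta> y"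
    and triv: "\<And>u. u \<in> unit_filtration v (Suc k) \<Longrightarrow> \<eta> u = 1"
    and nontriv: "\<exists>u\<in>unit_filtration v k. \<eta> u \<noteq> 1"
  shows "\<exists>y. y \<noteq> 0 \<and> torus_type i (j - 1) k \<eta> y"
proof -
  have k: "1 \<le> k" using ij by simp
  have xV: "x \<in> V" and xf: "fixed_nu i x" using typeD[OF x(1)] by blast+
  \<comment> \<open>Chosen so that a product of \<open>P ?m\<close> and \<open>P (j - 1)\<close>
    lies in \<open>P k\<close>, the last layer on which \<open>\<eta>\<close> is nontrivial.\<close>
  let ?m = "int (Suc k) - j"
  have nlcong: "nl y x = nl y' x" if "y - y' \<in> P j" for y y'
    using nl_add[OF xV, of y' "y - y'"] typeD(4)[OF x(1) that] by simp
  \<comment> \<open>From \<open>Suc k < i + j\<close> the product \<open>b * y\<close> lies in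
    \<open>P (Suc k)\<close>, so commuting \<open>nu b\<close> past \<open>nl y\<close> leaves no
    trace. The torus is controlled only on one-units of depth \<open>k\<close>: there
    \<open>d * d\<close> is close enough to 1 to leave \<open>nl y x\<close> unchanged.\<close>
  have nl_type: "torus_type i j k \<eta> (nl y x)" if y: "y \<in> P (j - 1)" for y
    unfolding torus_type_def fixed_nu_def
  proof (intro conjI ballI)
    show "nl y x \<in> V" using xV by simp
    show "nl c (nl y x) = nl y x" if "c \<in> P j" for c
      using nl_add[OF xV, of y c] nl_add[OF xV, of c y] typeD(4)[OF x(1) that] by (simp add: add.commute)
  next
    fix b assume b: "b \<in> P i"
    have byk: "b * y \<in> P (int (Suc k))" using ij by (intro P_mult_mono[OF b y]) simp
    then have u: "1 + b * y \<in> int_units v" using one_plus_unit by force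
    have iu: "inverse (1 + b * y) \<in> unit_filtration v (Suc k)"
      using one_inverse[of "1 + b * y" "int (Suc k)"] byk unit_inverse[OF u] by (simp add: unit_filtration_iff)
    have "nu b (nl y x) = nl (y / (1 + b * y)) (td (inverse (1 + b * y)) (nu (b / (1 + b * y)) x))"
      using u xV by (intro nu_nl) (auto dest: unit_nonzero)
    also have "nu (b / (1 + b * y)) x = x"
      using typeD(3)[OF x(1)] P_unit_divide[OF u] b by blast
    also have "td (inverse (1 + b * y)) x = x"
      using typeD(5)[OF x(1) unit_filtration_mono[OF iu]] triv[OF iu] by simp
    also have "nl (y / (1 + b * y)) x = nl y x"
    proof (rule nlcong)
      have "y / (1 + b * y) - y = - (y * (b * y) / (1 + b * y))"
        using unit_nonzero[OF u] by (simp add: field_simps)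
      moreover have "y * (b * y) \<in> P j" by (rule P_mult_mono[OF y byk]) simp
      ultimately show "y / (1 + b * y) - y \<in> P j" using P_unit_divide[OF u] by simp
    qed
    finally show "nu b (nl y x) = nl y x" .
  next
    fix d assume d: "d \<in> unit_filtration v k"
    then have d0: "d \<noteq> 0" by (simp add: unit_filtration_iff unit_nonzero)
    have "d * d - 1 \<in> P (int k)" using d by (intro one_mult) (simp_all add: unit_filtration_iff)
    then have "y * (d * d - 1) \<in> P j" using k by (intro P_mult_mono[OF y]) auto
    then have "nl (y * (d * d)) x = nl y x" by (intro nlcong) (simp add: algebra_simps)
    then show "td d (nl y x) = scl (\<eta> d) (nl y x)"
      using d0 xV typeD(5)[OF x(1) d] by (simp add: td_nl nl_scl)
  qed
  have rel: "nl y (nu b x) = scl (\<eta> (1 + b * y)) (nu b (nl y x))"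
    if b: "b \<in> P ?m" and y: "y \<in> P (j - 1)" for b y
  proof -
    have byk': "b * y \<in> P (int k)" by (rule P_mult_mono[OF b y]) simp
    then have u: "1 + b * y \<in> int_units v" using one_plus_unit k by force
    then have uf: "1 + b * y \<in> unit_filtration v k" using byk' by (simp add: unit_filtration_iff)
    have "nl y (nu b x) = nu (b / (1 + b * y)) (td (1 + b * y) (nl (y / (1 + b * y)) x))"
      using u xV by (intro nl_nu) (auto dest: unit_nonzero)
    also have "nl (y / (1 + b * y)) x = nl y x"
    proof (rule nlcong)
      have "y / (1 + b * y) - y = - (y * (b * y) / (1 + b * y))"
        using unit_nonzero[OF u] by (simp add: field_simps)
      moreover have "y * (b * y) \<in> P j" using k by (intro P_mult_mono[OF y byk']) simp
      ultimately show "y / (1 + b * y) - y \<in> P j" using P_unit_divide[OF u] by simp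
    qed
    also have "td (1 + b * y) (nl y x) = scl (\<eta> (1 + b * y)) (nl y x)"
      using typeD(5)[OF nl_type[OF y] uf] .
    also have "nu (b / (1 + b * y)) (scl (\<eta> (1 + b * y)) (nl y x)) =
        scl (\<eta> (1 + b * y)) (nu (b / (1 + b * y)) (nl y x))"
      using xV by (simp add: nu_scl)
    also have "nu (b / (1 + b * y)) (nl y x) = nu b (nl y x)"
    proof (rule nu_divide_cong[OF typeD(2)[OF nl_type[OF y]] u])
      \<comment> \<open>This is where \<open>i + j \<le> 2 * int k + 1\<close> enters: the product
        lies in \<open>P (?m + int k)\<close>, hence in \<open>P i\<close>.\<close>
      have "b * (b * y) \<in> P i" using ij by (intro P_mult_mono[OF b byk']) simp
      then show "b * b * y \<in> P i" by (simp add: mult.assoc)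
    qed
    finally show ?thesis .
  qed
  \<comment> \<open>\<open>S b\<close> is the Fourier component of \<open>x\<close> on which
    \<open>nl c\<close> acts by the inverse of \<open>\<eta> (1 + b * c)\<close>; by
    \<open>rel\<close>, applying \<open>nu b\<close> cancels that scalar. The components add up to a
    nonzero multiple of \<open>x\<close>, so one of them is nonzero.\<close>
  define S where "S b = (\<Sum>y\<in>reps (j - 1). scl (\<eta> (1 + b * y)) (nl y x))" for b
  have "(\<Sum>b\<in>reps ?m. S b) = (\<Sum>y\<in>reps (j - 1). scl (\<Sum>b\<in>reps ?m. \<eta> (1 + b * y)) (nl y x))"
    unfolding S_def by (subst sum.swap) (simp add: scale_sum_left)
  also have "\<dots> = scl (of_nat (card (reps ?m))) x"
  proof (rule sum_reps_isolate)
    fix y assume y: "y \<in> P (j - 1 + 1)"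
    have "\<eta> (1 + b * y) = 1" if b: "b \<in> reps ?m" for b
    proof -
      have "b * y \<in> P (int (Suc k))" by (rule P_mult_mono[OF reps_P[OF b] y]) simp
      then show ?thesis using one_plus_unit by (intro triv) (force simp: unit_filtration_iff)
    qed
    then show "scl (\<Sum>b\<in>reps ?m. \<eta> (1 + b * y)) (nl y x) = scl (of_nat (card (reps ?m))) x"
      using y typeD(4)[OF x(1)] by simp
  next
    fix y assume "y \<in> P (j - 1)" "y \<notin> P (j - 1 + 1)"
    then have "y \<noteq> 0" "v y = int k - ?m" by (auto simp: in_P)
    from sum_character_scaled[OF mult triv nontriv k this]
    show "scl (\<Sum>b\<in>reps ?m. \<eta> (1 + b * y)) (nl y x) = 0" by (simp add: mult.commute)
  qed
  finally have "(\<Sum>b\<in>reps ?m. S b) \<noteq> 0" using x(2) card_reps by simp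
  then obtain b where b: "b \<in> reps ?m" "S b \<noteq> 0" by (metis sum.neutral)
  have bP: "b \<in> P ?m" using reps_P b(1) by blast
  have S: "torus_type i j k \<eta> (S b)"
    unfolding S_def by (intro type_sum type_scl nl_type reps_P)
  define y where "y = nu b (S b)"
  have ye: "y = (\<Sum>c\<in>reps (j - 1). nl c (nu b x))"
    unfolding y_def S_def using xV rel[OF bP reps_P] by (simp add: nu_sum nu_scl)
  have "torus_type i (j - 1) k \<eta> y"
    unfolding torus_type_def
  proof (intro conjI ballI)
    show "fixed_nu i y"
      using typeD(1-3)[OF S] by (auto simp: fixed_nu_def y_def nu_commute[of _ _ b])
  next
    fix c assume c: "c \<in> P (j - 1)"
    have "nl c y = (\<Sum>r\<in>reps (j - 1). nl (c + r) (nu b x))"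
      unfolding ye using xV by (simp add: nl_sum nl_add)
    also have "\<dots> = y"
      unfolding ye
    proof (rule sum_reps_shift[OF c])
      fix r r' assume r: "r \<in> P (j - 1)" "r' \<in> P (j - 1)" and d: "r - r' \<in> P (j - 1 + 1)"
      have "b * (r - r') \<in> P (int (Suc k))" by (rule P_mult_mono[OF bP d]) simp
      then have "\<eta> (1 + b * (r - r')) = 1"
        using one_plus_unit by (intro triv) (force simp: unit_filtration_iff)
      moreover have "b * r' \<in> P (int k)" "b * (r - r') \<in> P (int k)"
        using P_mult_mono[OF bP r(2)] P_mult_mono[OF bP d] by auto
      then have "\<eta> (1 + (b * r' + b * (r - r'))) = \<eta> (1 + b * r') * \<eta> (1 + b * (r - r'))"
        using character_additive[of \<eta> "Suc k" "b * r'" "b * (r - r')"] mult triv k by simp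
      ultimately have "\<eta> (1 + b * r) = \<eta> (1 + b * r')" by (simp add: algebra_simps)
      then show "nl r (nu b x) = nl r' (nu b x)"
        using rel[OF bP] r nlcong[of r r'] d by simp
    qed
    finally show "nl c y = y" .
  next
    fix d assume d: "d \<in> unit_filtration v k"
    then have du: "d \<in> int_units v" by (simp add: unit_filtration_iff)
    then have ddu: "d * d \<in> int_units v" by (simp add: unit_mult)
    have "td d y = nu (b / (d * d)) (td d (S b))"
      unfolding y_def using unit_nonzero[OF du] typeD(1)[OF S] by (intro td_nu)
    also have "\<dots> = scl (\<eta> d) (nu (b / (d * d)) (S b))"
      using typeD(1)[OF S] typeD(5)[OF S d] by (simp add: nu_scl)
    also have "nu (b / (d * d)) (S b) = nu b (S b)"
    proof (rule fixed_nu_cong[OF typeD(2)[OF S]])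
      have "d * d - 1 \<in> P (int k)" using d by (intro one_mult) (simp_all add: unit_filtration_iff)
      then have "b * (d * d - 1) \<in> P i" by (rule P_mult_mono[OF bP]) (use ij in linarith)
      moreover have "b / e - b = - (b * (e - 1) / e)" if "e \<noteq> 0" for e
        using that by (simp add: field_simps)
      then have "b / (d * d) - b = - (b * (d * d - 1) / (d * d))"
        using unit_nonzero[OF ddu] by blast
      ultimately show "b / (d * d) - b \<in> P i" using P_unit_divide[OF ddu] by simp
    qed
    finally show "td d y = scl (\<eta> d) y" by (simp add: y_def)
  qed
  moreover have "y \<noteq> 0" using b(2) nu_eq_0_iff typeD(1)[OF S] by (simp add: y_def)
  ultimately show ?thesis by blast
qed

lemma no_split_type':
  assumes "torus_type i j k \<eta> x" "x \<noteq> 0" "int (Suc k) \<le> i + j" "i + j \<le> 2 * int k + 1"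
    and mult: "\<And>x y. x \<in> int_units v \<Longrightarrow> y \<in> int_units v \<Longrightarrow> \<eta> (x * y) = \<eta> x * \<eta> y"
    and triv: "\<And>u. u \<in> unit_filtration v (Suc k) \<Longrightarrow> \<eta> u = 1"
    and nontriv: "\<exists>u\<in>unit_filtration v k. \<eta> u \<noteq> 1"
  shows False
  using assms(1-4)
proof (induction "nat (i + j)" arbitrary: j x rule: less_induct)
  case less
  show False
  proof (cases "i + j = int (Suc k)")
    case True
    then show False using no_split_type[OF less.prems(1,2) _ mult triv] nontriv by blast
  next
    case False
    then obtain y where "y \<noteq> 0" "torus_type i (j - 1) k \<eta> y"
      using type_descent[OF less.prems(1,2) _ less.prems(4) mult triv nontriv] less.prems(3) by force
    then show False using less.hyps[of "j - 1" y] less.prems(3,4) False by simp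
  qed
qed

text \<open>Compare both sides of the commutation relation of \<open>nu b\<close> and \<open>nl c\<close>.\<close>

lemma type_character_trivial:
  assumes x: "torus_type i j 0 \<eta> x" "x \<noteq> 0" and m: "1 \<le> m" "i + j \<le> int m"
    and u: "u \<in> unit_filtration v m"
  shows "\<eta> u = 1"
proof -
  obtain p where p: "p \<noteq> 0" "v p = 1" using ex_uniformizer .
  define b where "b = p powi i"
  have b: "b \<noteq> 0" "v b = i" using p by (simp_all add: b_def val_power_int)
  define c where "c = (u - 1) / b"
  have bc: "1 + b * c = u" using b(1) by (simp add: c_def)
  have uu: "u \<in> int_units v" "u - 1 \<in> P (int m)" using u by (simp_all add: unit_filtration_iff)
  have "b * c \<in> P (int m)" using uu(2) b(1) by (simp add: c_def)
  then have "c \<in> P (int m - i)" using P_scale[OF b(1)] b(2) by blast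
  then have c: "c \<in> P j" by (rule P_mono) (use m(2) in simp)
  have bP: "b \<in> P i" using b by (simp add: in_P)
  have uf: "1 + b * c \<in> unit_filtration v 0"
    unfolding bc using uu(1) by (simp add: unit_filtration_def)
  have bu: "b / u \<in> P i" using bP P_unit_divide[OF uu(1)] by blast
  have "nl c (nu b x) = scl (\<eta> u) (nu (b / u) x)"
    using type_nl_nu[OF x(1) uf c] unfolding bc .
  then have "scl (\<eta> u) x = x"
    unfolding typeD(3)[OF x(1) bP] typeD(3)[OF x(1) bu] typeD(4)[OF x(1) c] by (rule sym)
  then have "scl (\<eta> u - 1) x = 0" by (simp add: scale_left_diff_distrib)
  then show ?thesis using x(2) by simp
qed

theorem type_level:
  assumes x: "torus_type i j 0 \<eta> x" "x \<noteq> 0"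
    and mult: "\<And>x y. x \<in> int_units v \<Longrightarrow> y \<in> int_units v \<Longrightarrow> \<eta> (x * y) = \<eta> x * \<eta> y"
  shows "2 \<le> i + j" and "u \<in> unit_filtration v (nat (i + j) div 2) \<Longrightarrow> \<eta> u = 1"
proof -
  show two: "2 \<le> i + j"
  proof (rule ccontr)
    assume "\<not> 2 \<le> i + j"
    \<comment> \<open>The level is enlarged to exactly 1. There \<open>\<eta>\<close> is trivial on
      one-units, and the tame case \<open>k = 0\<close> applies.\<close>
    then have "torus_type i (1 - i) 0 \<eta> x" using type_mono[OF x(1)] by simp
    then show False
      using no_split_type[of i "1 - i" 0 \<eta> x] type_character_trivial[of i "1 - i" \<eta> x 1] x(2) mult by simp
  qed
  define m where "m = nat (i + j)"
  define c where "c = (LEAST c. \<forall>u\<in>unit_filtration v c. \<eta> u = 1)"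
  have triv: "\<forall>u\<in>unit_filtration v m. \<eta> u = 1"
    using type_character_trivial[OF x, of m] two by (auto simp: m_def)
  have c: "\<forall>u\<in>unit_filtration v c. \<eta> u = 1" unfolding c_def by (rule LeastI[of _ m]) (rule triv)
  have cm: "c \<le> m" unfolding c_def by (rule Least_le) (rule triv)
  have "c \<le> m div 2"
  proof (rule ccontr)
    assume h: "\<not> c \<le> m div 2"
    then obtain k where k: "c = Suc k" by (cases c) auto
    have "\<exists>u\<in>unit_filtration v k. \<eta> u \<noteq> 1"
      using not_less_Least[of k "\<lambda>c. \<forall>u\<in>unit_filtration v c. \<eta> u = 1"] k unfolding c_def by auto
    moreover have "torus_type i j k \<eta> x" using x(1) by (rule type_mono) simp_all
    moreover have "int (Suc k) \<le> i + j" using cm two k by (simp add: m_def)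
    moreover have "i + j \<le> 2 * int k + 1" using h two k by (simp add: m_def)
    moreover have "\<And>u. u \<in> unit_filtration v (Suc k) \<Longrightarrow> \<eta> u = 1" using c k by blast
    ultimately show False using no_split_type'[of i j k \<eta> x] x(2) mult by blast
  qed
  then show "\<eta> u = 1" if "u \<in> unit_filtration v (nat (i + j) div 2)"
    using c that unit_filtration_mono unfolding m_def by blast
qed

end

section \<open>Two by two matrices and the group \<open>U(1,1)\<close>\<close>

lemma mat2_nth [simp]:
  "mat2 a b c d $ 1 $ 1 = a" "mat2 a b c d $ 1 $ 2 = b"
  "mat2 a b c d $ 2 $ 1 = c" "mat2 a b c d $ 2 $ 2 = d"
  by (simp_all add: mat2_def)

lemma mat2_eq_iff: "mat2 a b c d = mat2 a' b' c' d' \<longleftrightarrow> a = a' \<and> b = b' \<and> c = c' \<and> d = d'"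
  by (auto simp: vec_eq_iff forall_2)

lemma int_matrix_iff: "(\<forall>i j. mat2 a b c d $ i $ j \<in> S) \<longleftrightarrow> a \<in> S \<and> b \<in> S \<and> c \<in> S \<and> d \<in> S"
  by (auto simp: forall_2)

lemma mat2_cases: obtains a b c d where "(g :: 'a::field^2^2) = mat2 a b c d"
proof -
  have "g = mat2 (g $ 1 $ 1) (g $ 1 $ 2) (g $ 2 $ 1) (g $ 2 $ 2)"
    by (simp add: vec_eq_iff forall_2)
  then show ?thesis by (rule that)
qed

lemma mat2_mult: "mat2 a b c d ** mat2 a' b' c' d' =
    mat2 (a * a' + b * c') (a * b' + b * d') (c * a' + d * c') (c * b' + d * d')"
  by (simp add: vec_eq_iff forall_2 matrix_matrix_mult_def sum_2)

lemma mat_eq_mat2: "mat z = mat2 z 0 0 (z::'a::field)"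
  by (simp add: vec_eq_iff forall_2 mat_def)

lemma transpose_mat2: "transpose (mat2 a b c d) = mat2 a c b d"
  by (simp add: vec_eq_iff forall_2 transpose_def)

lemma map_matrix_mat2: "map_matrix f (mat2 a b c d) = mat2 (f a) (f b) (f c) (f d)"
  by (simp add: vec_eq_iff forall_2 map_matrix_def)

lemma det_mat2: "det (mat2 a b c d) = a * d - b * c"
  by (simp add: det_2)

lemma matrix_inv_inverse:
  fixes g :: "'a::field^2^2"
  assumes "invertible g"
  shows "g ** matrix_inv g = mat 1 \<and> matrix_inv g ** g = mat 1"
  unfolding matrix_inv_def by (rule someI_ex) (use assms in \<open>simp add: invertible_def\<close>)

text \<open>\<open>matrix_inv\<close> is a choice among two-sided inverses; for square matrices a
  right inverse determines it.\<close>

lemma matrix_inv_unique: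
  fixes g h :: "'a::field^2^2"
  assumes "g ** h = mat 1"
  shows "matrix_inv g = h"
proof -
  have "invertible g" using assms invertible_right_inverse by blast
  then have "matrix_inv g ** g = mat 1" by (rule matrix_inv_inverse[THEN conjunct2])
  then show ?thesis
    by (metis assms matrix_mul_assoc matrix_mul_lid matrix_mul_rid)
qed

lemma matrix_inv_mat2:
  fixes a b c d :: "'a::field"
  assumes D: "D = a * d - b * c" "D \<noteq> 0"
  shows "matrix_inv (mat2 a b c d) = mat2 (d / D) (- b / D) (- c / D) (a / D)"
proof (rule matrix_inv_unique)
  have "a * d / D - b * c / D = 1"
    using D(2) by (simp add: D(1) flip: diff_divide_distrib)
  then show "mat2 a b c d ** mat2 (d / D) (- b / D) (- c / D) (a / D) = mat 1"
    by (simp add: mat2_mult mat_eq_mat2 mat2_eq_iff mult.commute)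
qed

lemma alpha_conj_mat2:
  "p \<noteq> 0 \<Longrightarrow> alpha_conj p (mat2 a b c d) = mat2 a (b / p) (p * c) (d::'a::field)"
  by (simp add: alpha_conj_def matrix_inv_mat2[of p] mat2_mult mat2_eq_iff)

context unramified_quadratic_extension
begin

section \<open>Unitary matrices, the diagonal torus and the big cell\<close>

lemma U11_carrier: "g \<in> carrier (U11 s) \<longleftrightarrow>
    invertible g \<and> map_matrix s g ** mat2 0 1 (-1) 0 ** transpose g = mat2 0 1 (-1) 0"
  by (simp add: U11_def matrix_group_def)

lemma U11_one [simp]: "\<one>\<^bsub>U11 s\<^esub> = mat 1"
  by (simp add: U11_def matrix_group_def)

lemma U11_mult [simp]: "g \<otimes>\<^bsub>U11 s\<^esub> h = g ** h"
  by (simp add: U11_def matrix_group_def)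

text \<open>The candidate is the adjoint for the form \<open>J\<close>. Its two diagonal entries use
  \<open>s a * d - s b * c = 1\<close> once as it stands and once conjugated by
  \<open>s\<close>.\<close>

lemma U11_right_inverse:
  assumes "s a * b = s b * a" "s a * d - s b * c = 1" "s c * d = s d * c"
  shows "mat2 a b c d ** mat2 (s d) (- s b) (- s c) (s a) = mat 1"
proof -
  have "a * s d - b * s c = 1"
    using arg_cong[OF assms(2), of s] by (simp add: aut_diff aut_mult)
  then show ?thesis
    using assms by (simp add: mat2_mult mat_eq_mat2 mat2_eq_iff algebra_simps)
qed

lemma U11_mat2: "mat2 a b c d \<in> carrier (U11 s) \<longleftrightarrow>
    s a * b = s b * a \<and> s a * d - s b * c = 1 \<and> s c * d = s d * c"
proof
  assume "mat2 a b c d \<in> carrier (U11 s)"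
  then show "s a * b = s b * a \<and> s a * d - s b * c = 1 \<and> s c * d = s d * c"
    by (simp add: U11_carrier map_matrix_mat2 transpose_mat2 mat2_mult mat2_eq_iff algebra_simps)
next
  assume h: "s a * b = s b * a \<and> s a * d - s b * c = 1 \<and> s c * d = s d * c"
  then have "invertible (mat2 a b c d)"
    using U11_right_inverse invertible_right_inverse by blast
  moreover have "a * s d - b * s c = 1"
    using arg_cong[OF conjunct1[OF conjunct2[OF h]], of s] by (simp add: aut_diff aut_mult)
  ultimately show "mat2 a b c d \<in> carrier (U11 s)"
    using h by (simp add: U11_carrier map_matrix_mat2 transpose_mat2 mat2_mult mat2_eq_iff algebra_simps)
qed

lemma U11_inverse_in:
  assumes "mat2 a b c d \<in> carrier (U11 s)"
  shows "mat2 (s d) (- s b) (- s c) (s a) \<in> carrier (U11 s)"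
proof -
  have "mat2 a b c d ** mat2 (s d) (- s b) (- s c) (s a) = mat 1"
    using assms U11_right_inverse by (simp add: U11_mat2)
  then have "mat2 (s d) (- s b) (- s c) (s a) ** mat2 a b c d = mat 1"
    by (simp add: matrix_left_right_inverse)
  then have e: "s d * a - s b * c = 1" "s d * b - s b * d = 0" "s a * c - s c * a = 0"
    by (simp_all add: mat2_mult mat_eq_mat2 mat2_eq_iff algebra_simps)
  have "d * s a - b * s c = 1" using arg_cong[OF e(1), of s] by (simp add: aut_diff aut_mult)
  then show ?thesis using e by (simp add: U11_mat2 algebra_simps)
qed

lemma U11_mult_in:
  assumes "g \<in> carrier (U11 s)" "h \<in> carrier (U11 s)"
  shows "g ** h \<in> carrier (U11 s)"
proof -
  have "map_matrix s (g ** h) = map_matrix s g ** map_matrix s h"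
    by (simp add: vec_eq_iff map_matrix_def matrix_matrix_mult_def sum_2 aut_add aut_mult)
  then have "map_matrix s (g ** h) ** mat2 0 1 (-1) 0 ** transpose (g ** h) =
      map_matrix s g ** (map_matrix s h ** mat2 0 1 (-1) 0 ** transpose h) ** transpose g"
    by (simp add: matrix_transpose_mul matrix_mul_assoc)
  then show ?thesis using assms by (simp add: U11_carrier invertible_mult)
qed

lemma U11_mat: "z * s z = 1 \<Longrightarrow> mat z \<in> carrier (U11 s)"
  by (simp add: mat_eq_mat2 U11_mat2 mult.commute)

lemma U11_group: "group (U11 s)"
proof (rule groupI)
  show "\<one>\<^bsub>U11 s\<^esub> \<in> carrier (U11 s)" using U11_mat[of 1] by simp
  fix g assume g: "g \<in> carrier (U11 s)"
  obtain a b c d where e: "g = mat2 a b c d" by (rule mat2_cases)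
  let ?h = "mat2 (s d) (- s b) (- s c) (s a)"
  have "g ** ?h = mat 1" using g U11_right_inverse unfolding e by (simp add: U11_mat2)
  then have "?h ** g = mat 1" by (simp add: matrix_left_right_inverse)
  then show "\<exists>h\<in>carrier (U11 s). h \<otimes>\<^bsub>U11 s\<^esub> g = \<one>\<^bsub>U11 s\<^esub>"
    using U11_inverse_in g e by auto
qed (simp_all add: U11_mult_in matrix_mul_assoc)

lemma U11_inv: "g \<in> carrier (U11 s) \<Longrightarrow> inv\<^bsub>U11 s\<^esub> g = matrix_inv g"
proof -
  assume g: "g \<in> carrier (U11 s)"
  have "g ** inv\<^bsub>U11 s\<^esub> g = mat 1"
    using group.r_inv[OF U11_group g] by simp
  then show ?thesis using matrix_inv_unique by metis
qed

lemma U11_matrix_inv: "g \<in> carrier (U11 s) \<Longrightarrow> matrix_inv g \<in> carrier (U11 s)"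
  using group.inv_closed[OF U11_group] U11_inv by metis

lemma U11_matrix_inv_mult:
  "g \<in> carrier (U11 s) \<Longrightarrow> matrix_inv g ** g = mat 1 \<and> g ** matrix_inv g = mat 1"
  using matrix_inv_inverse[of g] by (auto simp: U11_carrier)

lemma U11_upper [simp]: "mat2 1 (\<iota> b) 0 1 \<in> carrier (U11 s)"
  by (simp add: U11_mat2 aut_emb)

lemma U11_lower [simp]: "mat2 1 0 (\<iota> c) 1 \<in> carrier (U11 s)"
  by (simp add: U11_mat2 aut_emb)

lemma U11_diag [simp]: "d \<noteq> 0 \<Longrightarrow> mat2 (inverse (s d)) 0 0 d \<in> carrier (U11 s)"
  by (simp add: U11_mat2 aut_inverse)

lemma U11_diag' [simp]: "t \<noteq> 0 \<Longrightarrow> mat2 t 0 0 (inverse (s t)) \<in> carrier (U11 s)"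
  by (simp add: U11_mat2 aut_inverse)

lemma U11_weyl [simp]: "mat2 0 1 (-1) 0 \<in> carrier (U11 s)"
  by (simp add: U11_mat2)

lemma diag_upper:
  assumes "d \<noteq> 0"
  shows "mat2 (inverse (s d)) 0 0 d ** mat2 1 (\<iota> b) 0 1 =
    mat2 1 (\<iota> (b / nm d)) 0 1 ** mat2 (inverse (s d)) 0 0 d"
proof -
  have "\<iota> (b / nm d) = \<iota> b * inverse d * inverse (s d)"
    unfolding emb_divide emb_nm by (simp add: divide_inverse)
  then show ?thesis using assms by (simp add: mat2_mult mat2_eq_iff)
qed

lemma diag_lower:
  assumes "d \<noteq> 0"
  shows "mat2 (inverse (s d)) 0 0 d ** mat2 1 0 (\<iota> c) 1 =
    mat2 1 0 (\<iota> (c * nm d)) 1 ** mat2 (inverse (s d)) 0 0 d"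
  using assms by (simp add: mat2_mult mat2_eq_iff emb_mult emb_nm divide_inverse)

lemma U11_emb:
  assumes "a * d - b * c = 1"
  shows "mat2 (\<iota> a) (\<iota> b) (\<iota> c) (\<iota> d) \<in> carrier (U11 s)"
proof -
  have "\<iota> (a * d - b * c) = 1" using assms emb_one by simp
  then show ?thesis by (simp add: U11_mat2 aut_emb emb_diff emb_mult mult.commute)
qed

text \<open>Unitarity says that \<open>b / d\<close> and \<open>c / d\<close> are fixed by \<open>s\<close>.\<close>

lemma U11_big_cell:
  assumes g: "mat2 a b c d \<in> carrier (U11 s)" and d: "d \<noteq> 0"
  obtains b' c' where "b = \<iota> b' * d" "c = \<iota> c' * d"
    "mat2 a b c d = mat2 1 (\<iota> b') 0 1 ** mat2 (inverse (s d)) 0 0 d ** mat2 1 0 (\<iota> c') 1"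
proof -
  have e: "s a * d - s b * c = 1" "s c * d = s d * c" using g by (simp_all add: U11_mat2)
  have "s d * b = s b * d" using U11_inverse_in[OF g] by (simp add: U11_mat2 mult.commute)
  then have "s (b / d) = b / d" using d by (simp add: aut_divide field_simps)
  then obtain b' where b: "b / d = \<iota> b'" using fixed_in_F by blast
  have "s (c / d) = c / d" using d e(2) by (simp add: aut_divide field_simps)
  then obtain c' where c: "c / d = \<iota> c'" using fixed_in_F by blast
  have bd: "b = \<iota> b' * d" and cd: "c = \<iota> c' * d" using b c d by (simp_all add: field_simps)
  have "a * s d - b * s c = 1" using arg_cong[OF e(1), of s] by (simp add: aut_diff aut_mult)
  then have "a * s d = 1 + \<iota> b' * d * \<iota> c' * s d"
    unfolding cd by (simp add: bd aut_mult aut_emb algebra_simps)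
  then have "a = inverse (s d) + \<iota> b' * d * \<iota> c'" using d by (simp add: field_simps)
  then show ?thesis using bd cd by (intro that[of b' c']) (simp_all add: mat2_mult mat2_eq_iff)
qed

end

section \<open>Cuspidal representations\<close>

locale cuspidal_U11 = odd_unramified_quadratic_extension vF vE \<iota> s
  for vF :: "'f::field \<Rightarrow> int" and vE :: "'e::field \<Rightarrow> int" and \<iota> s +
  fixes p :: 'f and scl :: "complex \<Rightarrow> 'v \<Rightarrow> 'v::ab_group_add" and V :: "'v set"
    and \<pi> :: "'e^2^2 \<Rightarrow> 'v \<Rightarrow> 'v"
  assumes p: "p \<noteq> 0" "vF p = 1"
    and irreducible: "irreducible_representation scl V (U11 s) \<pi>"
    and admissible: "admissible vE scl V (U11 s) \<pi>"
    and supercuspidal: "supercuspidal \<iota> scl V \<pi>"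
begin

lemma rep: "representation scl V (U11 s) \<pi>"
  using irreducible by (simp add: irreducible_representation_def)

sublocale complex_subspace scl V
  using rep by (simp add: complex_subspace_def complex_subspace_axioms_def Defs.representation_def)

lemma V_nonzero: obtains x where "x \<in> V" "x \<noteq> 0"
  using irreducible V_zero unfolding irreducible_representation_def by blast

lemma act_endo: "g \<in> carrier (U11 s) \<Longrightarrow> linear_endo scl V (\<pi> g)"
  using rep by (auto simp: linear_endo_def Defs.representation_def)

lemma act_V [simp]: "g \<in> carrier (U11 s) \<Longrightarrow> x \<in> V \<Longrightarrow> \<pi> g x \<in> V"
  using act_endo linear_endoD by blast

lemma act_act: "g \<in> carrier (U11 s) \<Longrightarrow> h \<in> carrier (U11 s) \<Longrightarrow> x \<in> V \<Longrightarrow> \<pi> g (\<pi> h x) = \<pi> (g ** h) x"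
  using rep by (simp add: Defs.representation_def)

lemma act_one: "x \<in> V \<Longrightarrow> \<pi> (mat 1) x = x"
  using rep by (simp add: Defs.representation_def)

lemma act_eq_0:
  assumes g: "g \<in> carrier (U11 s)" and x: "x \<in> V" and z: "\<pi> g x = 0"
  shows "x = 0"
proof -
  have "\<pi> (matrix_inv g) (\<pi> g x) = x"
    using g x U11_matrix_inv U11_matrix_inv_mult by (simp add: act_act act_one)
  then show ?thesis using z endo_zero[OF act_endo[OF U11_matrix_inv[OF g]]] by simp
qed

text \<open>Openness of the stabilizer, read off at the identity. The depth is made positive so that
  diagonal entries close to 1 are units.\<close>

lemma smooth:
  assumes "x \<in> V"
  obtains n where "0 < n" "\<And>a b c d. mat2 a b c d \<in> carrier (U11 s) \<Longrightarrow> a - 1 \<in> E.P n \<Longrightarrow> b \<in> E.P n \<Longrightarrow>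
    c \<in> E.P n \<Longrightarrow> d - 1 \<in> E.P n \<Longrightarrow> \<pi> (mat2 a b c d) x = x"
proof -
  have "open_in_group vE (U11 s) {g \<in> carrier (U11 s). \<pi> g x = x}"
    using admissible assms by (simp add: admissible_def)
  moreover have "mat 1 \<in> {g \<in> carrier (U11 s). \<pi> g x = x}"
    using assms act_one U11_mat[of 1] by simp
  ultimately obtain n where n: "\<And>h. h \<in> carrier (U11 s) \<Longrightarrow>
      \<forall>i j. h $ i $ j - mat 1 $ i $ j \<in> E.P n \<Longrightarrow> h \<in> {g \<in> carrier (U11 s). \<pi> g x = x}"
    unfolding open_in_group_def by blast
  show ?thesis
  proof (rule that[of "max 1 n"])
    fix a b c d assume h: "mat2 a b c d \<in> carrier (U11 s)" "a - 1 \<in> E.P (max 1 n)" "b \<in> E.P (max 1 n)"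
      "c \<in> E.P (max 1 n)" "d - 1 \<in> E.P (max 1 n)"
    have "\<forall>i j. mat2 a b c d $ i $ j - mat 1 $ i $ j \<in> E.P n"
      using h(2-5) E.P_mono[of _ "max 1 n" n] by (simp add: forall_2 mat_eq_mat2)
    then show "\<pi> (mat2 a b c d) x = x" using n[OF h(1)] by simp
  qed simp
qed

section \<open>The action of the unipotents and of the torus\<close>

definition nu :: "'f \<Rightarrow> 'v \<Rightarrow> 'v" where "nu b = \<pi> (mat2 1 (\<iota> b) 0 1)"
definition nl :: "'f \<Rightarrow> 'v \<Rightarrow> 'v" where "nl c = \<pi> (mat2 1 0 (\<iota> c) 1)"
text \<open>Indexed by the lower right entry, at which the conductor evaluates
  \<open>\<eta>\<close>. On \<open>\<iota> d\<close> it is the torus of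
  \<open>SL\<^sub>2(F)\<close>.\<close>

definition tt :: "'e \<Rightarrow> 'v \<Rightarrow> 'v" where "tt d = \<pi> (mat2 (inverse (s d)) 0 0 d)"
definition wl :: "'v \<Rightarrow> 'v" where "wl = \<pi> (mat2 0 1 (-1) 0)"

lemma tt_V [simp]: "d \<noteq> 0 \<Longrightarrow> x \<in> V \<Longrightarrow> tt d x \<in> V"
  by (simp add: tt_def)

lemma tt_endo: "d \<noteq> 0 \<Longrightarrow> linear_endo scl V (tt d)"
  unfolding tt_def by (intro act_endo U11_diag)

lemma tt_one: "x \<in> V \<Longrightarrow> tt 1 x = x"
  using act_one by (simp add: tt_def mat_eq_mat2)

lemma tt_mult: "c \<noteq> 0 \<Longrightarrow> d \<noteq> 0 \<Longrightarrow> x \<in> V \<Longrightarrow> tt (c * d) x = tt c (tt d x)"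
  by (simp add: tt_def act_act mat2_mult aut_mult)

lemma tt_nu: "d \<noteq> 0 \<Longrightarrow> x \<in> V \<Longrightarrow> tt d (nu b x) = nu (b / nm d) (tt d x)"
  by (simp add: tt_def nu_def act_act diag_upper)

lemma tt_nl: "d \<noteq> 0 \<Longrightarrow> x \<in> V \<Longrightarrow> tt d (nl c x) = nl (c * nm d) (tt d x)"
  by (simp add: tt_def nl_def act_act diag_lower)

text \<open>Restricting the torus to \<open>F\<close> puts the averaging results at disposal. The
  relations are identities of two by two matrices; a torus element of \<open>F\<close> scales the
  root groups by \<open>nm (\<iota> d) = d * d\<close>.\<close>

sublocale A: sl2_action vF scl V nu nl "\<lambda>d. tt (\<iota> d)" wl
proof unfold_locales
  show "\<exists>n. \<forall>b\<in>F.P n. nu b x = x" if x: "x \<in> V" for x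
    by (rule smooth[OF x]) (force simp: nu_def emb_P)
  show "span {nu b x - x |b x. x \<in> V} = V"
    using supercuspidal unfolding supercuspidal_def nu_def .
  show "tt (\<iota> d) (nu b x) = nu (b / (d * d)) (tt (\<iota> d) x)" if "d \<noteq> 0" "x \<in> V" for d b x
    using that by (simp add: tt_nu)
  show "tt (\<iota> d) (nl c x) = nl (c * (d * d)) (tt (\<iota> d) x)" if "d \<noteq> 0" "x \<in> V" for d c x
    using that by (simp add: tt_nl)
  show "nl c (nu b x) = nu (b / (1 + b * c)) (tt (\<iota> (1 + b * c)) (nl (c / (1 + b * c)) x))"
    if u: "1 + b * c \<noteq> 0" and "x \<in> V" for b c x
  proof -
    define u where "u = 1 + b * c"
    have u0: "u \<noteq> 0" using u by (simp add: u_def)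
    have e: "\<iota> u = 1 + \<iota> b * \<iota> c" by (simp add: u_def emb_add emb_one emb_mult)
    have "mat2 1 0 (\<iota> c) 1 ** mat2 1 (\<iota> b) 0 1 =
        mat2 1 (\<iota> (b / u)) 0 1 ** (mat2 (inverse (s (\<iota> u))) 0 0 (\<iota> u) ** mat2 1 0 (\<iota> (c / u)) 1)"
      using u0 by (simp add: mat2_mult mat2_eq_iff aut_emb emb_divide field_simps) (simp add: e)
    then show ?thesis
      using u0 that(2) unfolding u_def[symmetric] by (simp add: nu_def nl_def tt_def act_act U11_mult_in)
  qed
  show "nu b (nl c x) = nl (c / (1 + b * c)) (tt (\<iota> (inverse (1 + b * c))) (nu (b / (1 + b * c)) x))"
    if u: "1 + b * c \<noteq> 0" and "x \<in> V" for b c x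
  proof -
    define u where "u = 1 + b * c"
    have u0: "u \<noteq> 0" using u by (simp add: u_def)
    have e: "\<iota> u = 1 + \<iota> b * \<iota> c" by (simp add: u_def emb_add emb_one emb_mult)
    have "mat2 1 (\<iota> b) 0 1 ** mat2 1 0 (\<iota> c) 1 =
        mat2 1 0 (\<iota> (c / u)) 1 ** (mat2 (inverse (s (\<iota> (inverse u)))) 0 0 (\<iota> (inverse u)) ** mat2 1 (\<iota> (b / u)) 0 1)"
    proof -
      have "s (\<iota> (inverse u)) = inverse (\<iota> u)" "\<iota> (inverse u) = inverse (\<iota> u)"
        unfolding aut_emb by (simp_all only: emb_inverse)
      moreover have "\<iota> c * (\<iota> b / \<iota> u) + inverse (\<iota> u) = 1"
      proof -
        have "\<iota> c * (\<iota> b / \<iota> u) + inverse (\<iota> u) = (1 + \<iota> b * \<iota> c) / \<iota> u"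
          by (simp add: divide_inverse algebra_simps del: FE.scale_scale)
        then show ?thesis using u0 unfolding e[symmetric] by simp
      qed
      moreover have "\<iota> u \<noteq> 0" using u0 by simp
      ultimately show ?thesis
        by (simp add: mat2_mult mat2_eq_iff emb_divide e)
    qed
    then show ?thesis
      using u0 that(2) unfolding u_def[symmetric] by (simp add: nu_def nl_def tt_def act_act U11_mult_in)
  qed
  show "nl (- inverse b) (nu b x) = wl (tt (\<iota> b) (nl (inverse b) x))"
    if b: "b \<noteq> 0" and "x \<in> V" for b x
  proof -
    have "mat2 1 0 (\<iota> (- inverse b)) 1 ** mat2 1 (\<iota> b) 0 1 =
        mat2 0 1 (-1) 0 ** (mat2 (inverse (s (\<iota> b))) 0 0 (\<iota> b) ** mat2 1 0 (\<iota> (inverse b)) 1)"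
      using b by (simp add: mat2_mult mat2_eq_iff aut_emb emb_inverse)
    then show ?thesis
      using b that(2) by (simp add: nu_def nl_def tt_def wl_def act_act U11_mult_in del: emb_minus)
  qed
  show "wl x = 0 \<Longrightarrow> x = 0" if "x \<in> V" for x
    using that act_eq_0[OF U11_weyl] by (simp add: wl_def)
  show "nu b (wl x) = wl (nl (- b) x)" if "x \<in> V" for b x
    using that by (simp add: nu_def nl_def wl_def act_act mat2_mult del: emb_minus) simp
qed (simp_all add: nu_def nl_def wl_def act_endo tt_endo tt_one tt_mult emb_mult emb_one emb_add
      act_act act_one mat2_mult add.commute mat_eq_mat2[of 1, symmetric])

end

text \<open>Finite Fourier analysis: the displayed sums, taken over all \<open>N\<close>-th roots of
  unity \<open>a\<close>, add up to \<open>N\<close> times \<open>x\<close>, so one of them is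
  nonzero. The eigenvalue is the inverse of \<open>a\<close>. The explicit form lets the eigenvector
  inherit properties of the orbit of \<open>x\<close>.\<close>

lemma (in complex_subspace) cyclic_eigenvector:
  assumes T: "linear_endo scl V T" and x: "x \<in> V" "x \<noteq> 0" and N: "0 < N" "(T ^^ N) x = x"
  obtains a where "a \<noteq> 0" "(\<Sum>l<N. scl (a ^ l) ((T ^^ l) x)) \<noteq> 0"
    "scl a (T (\<Sum>l<N. scl (a ^ l) ((T ^^ l) x))) = (\<Sum>l<N. scl (a ^ l) ((T ^^ l) x))"
proof -
  have TV: "(T ^^ l) x \<in> V" for l
    by (induction l) (use x linear_endoD(1)[OF T] in auto)
  define z where "z k = cis (2 * pi * real k / real N)" for k
  have bij: "bij_betw z {..<N} {z. z ^ N = 1}"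
    unfolding z_def using Complex.bij_betw_roots_unity[OF N(1)] .
  have z1: "z k ^ N = 1" if "k < N" for k using bij that by (auto simp: bij_betw_def)
  \<comment> \<open>The symmetry in \<open>k\<close> and \<open>l\<close> turns the sum over the
    roots into a geometric series with ratio \<open>z l\<close>.\<close>
  have zp: "z k ^ l = z l ^ k" for k l by (simp add: z_def Complex.DeMoivre algebra_simps)
  have "(\<Sum>k<N. z k ^ l) = (if l = 0 then of_nat N else 0)" if l: "l < N" for l
  proof (cases "l = 0")
    case False
    have "z l \<noteq> 1"
    proof
      assume "z l = 1"
      moreover have "z 0 = 1" by (simp add: z_def)
      ultimately have "z l = z 0" by simp
      then show False
        using inj_onD[OF bij_betw_imp_inj_on[OF bij]] l N(1) False by blast
    qed
    moreover have "(\<Sum>k<N. z l ^ k) * (z l - 1) = z l ^ N - 1"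
      by (simp add: power_diff_1_eq mult.commute)
    ultimately show ?thesis using z1[OF l] False by (simp add: zp[of _ l])
  qed simp
  then have "(\<Sum>k<N. \<Sum>l<N. scl (z k ^ l) ((T ^^ l) x)) =
      (\<Sum>l<N. scl (if l = 0 then of_nat N else 0) ((T ^^ l) x))"
    by (subst sum.swap) (simp flip: scale_sum_left)
  also have "\<dots> = (\<Sum>l<N. if l = 0 then scl (of_nat N) x else 0)"
    by (intro sum.cong) auto
  also have "\<dots> = scl (of_nat N) x" using N(1) by simp
  finally have "(\<Sum>k<N. \<Sum>l<N. scl (z k ^ l) ((T ^^ l) x)) \<noteq> 0" using x(2) N(1) by simp
  then obtain k where k: "k < N" "(\<Sum>l<N. scl (z k ^ l) ((T ^^ l) x)) \<noteq> 0"
    by (metis (no_types, lifting) lessThan_iff sum.neutral)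
  define f where "f l = scl (z k ^ l) ((T ^^ l) x)" for l
  have "f N = f 0" using N(2) z1[OF k(1)] by (simp add: f_def)
  then have "(\<Sum>l<N. f (Suc l)) = sum f {..<N}"
    using sum.lessThan_Suc_shift[of f N] by simp
  moreover have "scl (z k) (T (sum f {..<N})) = (\<Sum>l<N. f (Suc l))"
    using TV endo_sum[OF T, of "{..<N}" f] linear_endoD(3)[OF T]
    by (simp add: f_def scale_sum_right)
  moreover have "z k \<noteq> 0" by (simp add: z_def)
  ultimately show ?thesis
    by (intro that[of "z k"]) (use k(2) in \<open>simp_all add: f_def\<close>)
qed

context cuspidal_U11
begin

lemma tt_scl: "d \<noteq> 0 \<Longrightarrow> x \<in> V \<Longrightarrow> tt d (scl a x) = scl a (tt d x)"
  using linear_endoD(3)[OF tt_endo] by blast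

lemma tt_commute: "c \<noteq> 0 \<Longrightarrow> d \<noteq> 0 \<Longrightarrow> x \<in> V \<Longrightarrow> tt c (tt d x) = tt d (tt c x)"
  by (metis mult.commute tt_mult)

lemma tt_smooth:
  assumes x: "x \<in> V"
  obtains n where "0 < n" "\<And>d. d - 1 \<in> E.P n \<Longrightarrow> tt d x = x"
proof -
  obtain n where n: "0 < n" "\<And>a b c d. mat2 a b c d \<in> carrier (U11 s) \<Longrightarrow> a - 1 \<in> E.P n \<Longrightarrow> b \<in> E.P n \<Longrightarrow>
      c \<in> E.P n \<Longrightarrow> d - 1 \<in> E.P n \<Longrightarrow> \<pi> (mat2 a b c d) x = x"
    using smooth[OF x] by blast
  have "tt d x = x" if d: "d - 1 \<in> E.P n" for d
  proof -
    have "d \<noteq> 0" using E.one_unit[OF d n(1)] E.unit_nonzero by blast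
    then show ?thesis
      unfolding tt_def using d n(1) by (intro n(2)) (simp_all add: E.one_inverse)
  qed
  then show ?thesis using that n(1) by blast
qed

lemma tt_power:
  assumes "d \<noteq> 0" "x \<in> V"
  shows "(tt d ^^ l) x = tt (d ^ l) x"
  using assms by (induction l) (simp_all add: tt_one tt_mult)

definition eigen :: "'e set \<Rightarrow> ('e \<Rightarrow> complex) \<Rightarrow> 'v \<Rightarrow> bool" where
  "eigen H \<eta> x \<longleftrightarrow> x \<in> V \<and> (\<forall>d\<in>H. tt d x = scl (\<eta> d) x)"

lemma eigen_character:
  assumes x: "x \<in> V" "x \<noteq> 0" and ev: "\<And>d. d \<in> int_units vE \<Longrightarrow> \<exists>a. tt d x = scl a x"
  obtains \<eta> where "unit_character vE \<eta>" "eigen (int_units vE) \<eta> x"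
proof -
  define \<eta> where "\<eta> d = (SOME a. tt d x = scl a x)" for d
  have e: "tt d x = scl (\<eta> d) x" if "d \<in> int_units vE" for d
    unfolding \<eta>_def using ev[OF that] by (rule someI_ex)
  have eq: "a = b" if "scl a x = scl b x" for a b
    using that x(2) by simp
  obtain n where n: "0 < n" "\<And>d. d - 1 \<in> E.P n \<Longrightarrow> tt d x = x" using tt_smooth[OF x(1)] by blast
  have "unit_character vE \<eta>"
    unfolding unit_character_def
  proof (intro conjI ballI exI)
    fix c d assume c: "c \<in> int_units vE" and d: "d \<in> int_units vE"
    have c0: "c \<noteq> 0" and d0: "d \<noteq> 0" using c d E.unit_nonzero by blast+
    show "\<eta> (c * d) = \<eta> c * \<eta> d"
      using tt_mult[OF c0 d0 x(1)] e[OF c] e[OF d] e[OF E.unit_mult[OF c d]] tt_scl[OF c0 x(1)]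
      by (intro eq) (simp add: mult.commute)
  next
    fix d assume d: "d \<in> int_units vE"
    then have d0: "d \<noteq> 0" by (rule E.unit_nonzero)
    show "\<eta> d \<noteq> 0"
    proof
      assume "\<eta> d = 0"
      then have "\<pi> (mat2 (inverse (s d)) 0 0 d) x = 0" using e[OF d] by (simp add: tt_def)
      then show False using act_eq_0[OF U11_diag[OF d0] x(1)] x(2) by blast
    qed
  next
    fix d assume d: "d \<in> unit_filtration vE (nat n)"
    then have "d \<in> int_units vE" "tt d x = x" using n by (simp_all add: E.unit_filtration_iff)
    then have "scl (\<eta> d) x = scl 1 x" using e by simp
    then show "\<eta> d = 1" by (rule eq)
  qed
  then show ?thesis using that[of \<eta>] e x(1) by (simp add: eigen_def)
qed

text \<open>A smooth vector sees only a finite quotient of the units, whose representatives are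
  diagonalized one at a time. Each new eigenvector is a combination of torus translates of the
  previous one, and the torus is commutative, so eigenvalues already obtained persist.\<close>

lemma torus_eigenvector:
  assumes X: "X \<subseteq> V" "subspace X"
    and stable: "\<And>d x. d \<in> int_units vE \<Longrightarrow> x \<in> X \<Longrightarrow> tt d x \<in> X"
    and ne: "x0 \<in> X" "x0 \<noteq> 0"
  obtains \<eta> x where "unit_character vE \<eta>" "x \<in> X" "x \<noteq> 0" "eigen (int_units vE) \<eta> x"
proof -
  have "x0 \<in> V" using ne X(1) by blast
  then obtain n where n: "0 < n" "\<And>d. d - 1 \<in> E.P n \<Longrightarrow> tt d x0 = x0" using tt_smooth by blast
  define Q where "Q x \<longleftrightarrow> x \<in> X \<and> x \<noteq> 0 \<and> (\<forall>d. d - 1 \<in> E.P n \<longrightarrow> tt d x = x)" for x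
  obtain T where "finite T" "\<forall>x\<in>E.P 0. \<exists>t\<in>T. x - t \<in> E.P n" using E.quotient_finite' by blast
  then obtain R where R: "transversal (\<lambda>x y. x - y \<in> E.P n) (int_units vE) R"
    using transversal_exists[OF E.equivp_mod, of T "int_units vE" n] E.unit_P by blast
  have Ru: "R \<subseteq> int_units vE" and finR: "finite R" using R by (simp_all add: transversal_def)
  have "\<exists>x. Q x \<and> (\<forall>r\<in>S. \<exists>a. tt r x = scl a x)" if "finite S" "S \<subseteq> R" for S
    using that
  proof (induction S rule: finite_induct)
    case empty
    then show ?case using ne n by (auto simp: Q_def)
  next
    case (insert r S)
    then obtain x where x: "Q x" "\<forall>r\<in>S. \<exists>a. tt r x = scl a x" by blast
    have xX: "x \<in> X" "x \<noteq> 0" and xV: "x \<in> V" using x(1) X(1) by (auto simp: Q_def)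
    have r: "r \<in> int_units vE" using insert.prems Ru by blast
    then have r0: "r \<noteq> 0" by (rule E.unit_nonzero)
    obtain N where N: "0 < N" "r ^ N - 1 \<in> E.P n" using E.unit_power_close[OF r] .
    have TN: "(tt r ^^ N) x = x" using N(2) x(1) r0 xV by (simp add: tt_power Q_def)
    obtain a where a: "a \<noteq> 0" "(\<Sum>l<N. scl (a ^ l) ((tt r ^^ l) x)) \<noteq> 0"
      "scl a (tt r (\<Sum>l<N. scl (a ^ l) ((tt r ^^ l) x))) = (\<Sum>l<N. scl (a ^ l) ((tt r ^^ l) x))"
      using cyclic_eigenvector[OF tt_endo[OF r0] xV xX(2) N(1) TN] .
    define y where "y = (\<Sum>l<N. scl (a ^ l) (tt (r ^ l) x))"
    have y: "y \<noteq> 0" "scl a (tt r y) = y" using a r0 xV by (simp_all add: y_def tt_power)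
    have yX: "y \<in> X" unfolding y_def
      by (intro subspace_sum[OF X(2)] subspace_scale[OF X(2)] stable xX(1) E.unit_power[OF r])
    have comm: "tt d y = scl b y" if d: "d \<noteq> 0" "tt d x = scl b x" for d b
    proof -
      have "tt d y = (\<Sum>l<N. tt d (scl (a ^ l) (tt (r ^ l) x)))"
        unfolding y_def by (rule endo_sum[OF tt_endo[OF d(1)]]) (use r0 xV in simp)
      also have "\<dots> = (\<Sum>l<N. scl b (scl (a ^ l) (tt (r ^ l) x)))"
      proof (rule sum.cong)
        fix l
        have rl: "r ^ l \<noteq> 0" using r0 by simp
        show "tt d (scl (a ^ l) (tt (r ^ l) x)) = scl b (scl (a ^ l) (tt (r ^ l) x))"
          using tt_commute[OF d(1) rl xV] d xV rl by (simp add: tt_scl mult.commute)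
      qed simp
      finally show ?thesis unfolding y_def by (simp only: scale_sum_right)
    qed
    have "tt d y = y" if d: "d - 1 \<in> E.P n" for d
    proof -
      have "d \<noteq> 0" using E.one_unit[OF d n(1)] E.unit_nonzero by blast
      then show ?thesis using comm[of d 1] x(1) d by (simp add: Q_def)
    qed
    moreover have "\<exists>b. tt t y = scl b y" if t: "t \<in> insert r S" for t
    proof (cases "t = r")
      case True
      have "tt r y = scl (inverse a) (scl a (tt r y))" using a(1) by simp
      then show ?thesis using y(2) True by metis
    next
      case False
      then obtain b where "tt t x = scl b x" using x(2) t by blast
      moreover have "t \<noteq> 0" using False t insert.prems Ru E.unit_nonzero by blast
      ultimately show ?thesis using comm by blast
    qed
    ultimately show ?case using y(1) yX by (auto simp: Q_def)
  qed
  from this[OF finR order_refl] obtain x where x: "Q x" "\<forall>r\<in>R. \<exists>a. tt r x = scl a x" by blast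
  have xV: "x \<in> V" using x(1) X(1) by (auto simp: Q_def)
  have "\<exists>a. tt d x = scl a x" if d: "d \<in> int_units vE" for d
  proof -
    obtain r where r: "r \<in> R" "d - r \<in> E.P n" using R d unfolding transversal_def by blast
    have ru: "r \<in> int_units vE" using r Ru by blast
    then have r0: "r \<noteq> 0" and d0: "d \<noteq> 0" using d E.unit_nonzero by blast+
    have "d / r - 1 = (d - r) / r" using r0 by (simp add: diff_divide_distrib)
    then have "tt (d / r) x = x" using x(1) r(2) E.P_unit_divide[OF ru] by (simp add: Q_def)
    then have "tt d x = tt r x" using tt_mult[of r "d / r" x] r0 d0 xV by simp
    then show ?thesis using x(2) r(1) by simp
  qed
  then obtain \<eta> where "unit_character vE \<eta>" "eigen (int_units vE) \<eta> x"
    using eigen_character[OF xV] x(1) unfolding Q_def by blast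
  then show ?thesis using that x(1) unfolding Q_def by blast
qed

lemma mat_tt: "z * s z = 1 \<Longrightarrow> \<pi> (mat z) = tt z"
proof -
  assume "z * s z = 1"
  then have "inverse (s z) = z" by (metis inverse_inverse_eq inverse_unique mult.commute)
  then show ?thesis by (simp add: tt_def mat_eq_mat2)
qed

lemma norm_one_nonzero: "z * s z = 1 \<Longrightarrow> z \<noteq> 0" for z
  by auto

text \<open>Norm-one scalars are central, so the vectors on which they act through
  \<open>\<eta>\<close> form an invariant subspace; being nonzero, it is \<open>V\<close> by
  irreducibility.\<close>

lemma central_propagate:
  assumes x: "x \<in> V" "x \<noteq> 0" and \<eta>: "\<And>z. z * s z = 1 \<Longrightarrow> tt z x = scl (\<eta> z) x"
  shows "extends_central_character s scl V \<pi> \<eta>"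
proof -
  define Z where "Z = {y \<in> V. \<forall>z. z * s z = 1 \<longrightarrow> tt z y = scl (\<eta> z) y}"
  have "subspace Z"
  proof (rule subspaceI)
    show "0 \<in> Z" using endo_zero[OF tt_endo] norm_one_nonzero by (auto simp: Z_def)
    show "y + y' \<in> Z" if "y \<in> Z" "y' \<in> Z" for y y'
      using that linear_endoD(2)[OF tt_endo] norm_one_nonzero by (auto simp: Z_def scale_right_distrib)
    show "scl a y \<in> Z" if "y \<in> Z" for a y
      using that tt_scl norm_one_nonzero by (auto simp: Z_def mult.commute)
  qed
  moreover have "\<pi> g y \<in> Z" if g: "g \<in> carrier (U11 s)" and y: "y \<in> Z" for g y
  proof -
    have yV: "y \<in> V" using y by (simp add: Z_def)
    have "tt z (\<pi> g y) = scl (\<eta> z) (\<pi> g y)" if z: "z * s z = 1" for z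
    proof -
      have "mat z ** g = g ** mat z"
        by (rule mat2_cases[of g]) (simp add: mat_eq_mat2 mat2_mult mult.commute)
      then have "tt z (\<pi> g y) = \<pi> g (tt z y)"
        using U11_mat[OF z] g yV by (simp add: act_act flip: mat_tt[OF z])
      then show ?thesis using y z linear_endoD(3)[OF act_endo[OF g] yV] by (simp add: Z_def)
    qed
    then show ?thesis using g yV by (simp add: Z_def)
  qed
  moreover have "Z \<subseteq> V" "x \<in> Z" using x \<eta> by (auto simp: Z_def)
  ultimately have "Z = V"
    using irreducible x(2) unfolding irreducible_representation_def by blast
  then show ?thesis unfolding extends_central_character_def Z_def using mat_tt by auto
qed

lemma eigen_central:
  assumes "eigen (int_units vE) \<eta> x" "x \<noteq> 0"
  shows "extends_central_character s scl V \<pi> \<eta>"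
  using central_propagate[of x \<eta>] assms norm_one_unit by (auto simp: eigen_def)

lemma central_tt:
  "extends_central_character s scl V \<pi> \<eta> \<Longrightarrow> z * s z = 1 \<Longrightarrow> x \<in> V \<Longrightarrow> tt z x = scl (\<eta> z) x"
  unfolding extends_central_character_def by (metis mat_tt)

lemma central_character:
  obtains \<eta> where "unit_character vE \<eta>" "extends_central_character s scl V \<pi> \<eta>"
proof -
  obtain x where x: "x \<in> V" "x \<noteq> 0" by (rule V_nonzero)
  have units0: "d \<noteq> 0" if "d \<in> int_units vE" for d using that by (rule E.unit_nonzero)
  obtain \<eta> y where "unit_character vE \<eta>" "y \<noteq> 0" "eigen (int_units vE) \<eta> y"
    by (rule torus_eigenvector[of V x]) (use x units0 subspace_V in auto)
  then show ?thesis using that eigen_central by blast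
qed

section \<open>Torus translates and exact conductors of the characters of N\<close>

lemma fixed_nu_tt:
  assumes "A.fixed_nu n x" "d \<in> int_units vE"
  shows "A.fixed_nu n (tt d x)"
  unfolding A.fixed_nu_def
proof (intro conjI ballI)
  have x: "x \<in> V" using assms(1) by (simp add: A.fixed_nu_def)
  have d: "d \<noteq> 0" using assms(2) by (rule E.unit_nonzero)
  show "tt d x \<in> V" using d x by simp
  fix b assume "b \<in> F.P n"
  then have "b * nm d \<in> F.P n"
    using F.P_unit_mult[OF nm_unit[OF assms(2)]] by (simp add: mult.commute)
  then have "nu (b * nm d) x = x" using assms(1) by (simp add: A.fixed_nu_def)
  then show "nu b (tt d x) = tt d x" using tt_nu[OF d x, of "b * nm d"] d by simp
qed

lemma step_tt:
  assumes x: "A.fixed_nu n x" and d: "d \<in> int_units vE"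
  shows "A.nu_sum_step n (tt d x) = tt d (A.nu_sum_step n x)"
proof -
  have xV: "x \<in> V" using x by (simp add: A.fixed_nu_def)
  have d0: "d \<noteq> 0" using d by (rule E.unit_nonzero)
  have c: "inverse (nm d) \<noteq> 0" "vF (inverse (nm d)) = n - 1 - (n - 1)"
    using F.unit_inverse[OF nm_unit[OF d]] by (simp_all add: int_units_def)
  have "tt d (A.nu_sum_step n x) = (\<Sum>r\<in>F.reps (n - 1). tt d (nu r x))"
    unfolding A.nu_sum_step_def by (rule endo_sum[OF tt_endo[OF d0]]) (use xV in simp)
  also have "\<dots> = (\<Sum>r\<in>F.reps (n - 1). nu (inverse (nm d) * r) (tt d x))"
    using d0 xV by (simp add: tt_nu divide_inverse mult.commute)
  also have "\<dots> = A.nu_sum_step n (tt d x)"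
    by (rule A.step_scaled[OF fixed_nu_tt[OF x d] c, symmetric])
  finally show ?thesis ..
qed

text \<open>The part of \<open>V\<close> where \<open>N\<close> acts by characters trivial on
  \<open>P n\<close> and nontrivial on \<open>P (n - 1)\<close>. Unlike the space of a single
  character of \<open>N\<close>, it is stable under the unit torus.\<close>

definition step_kernel :: "int \<Rightarrow> 'v set" where
  "step_kernel n = {x. A.fixed_nu n x \<and> A.nu_sum_step n x = 0}"

lemma step_kernel_V: "x \<in> step_kernel n \<Longrightarrow> x \<in> V"
  by (simp add: step_kernel_def A.fixed_nu_def)

lemma subspace_step_kernel: "subspace (step_kernel n)"
proof (rule subspaceI)
  show "0 \<in> step_kernel n"
    using endo_zero[OF A.step_endo] endo_zero[OF A.nu_endo] by (simp add: step_kernel_def A.fixed_nu_def)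
  show "x + y \<in> step_kernel n" if "x \<in> step_kernel n" "y \<in> step_kernel n" for x y
    using that linear_endoD(2)[OF A.step_endo] linear_endoD(2)[OF A.nu_endo]
    by (simp add: step_kernel_def A.fixed_nu_def)
  show "scl a x \<in> step_kernel n" if "x \<in> step_kernel n" for a x
    using that linear_endoD(3)[OF A.step_endo] linear_endoD(3)[OF A.nu_endo]
    by (simp add: step_kernel_def A.fixed_nu_def)
qed

lemma step_kernel_tt: "x \<in> step_kernel n \<Longrightarrow> d \<in> int_units vE \<Longrightarrow> tt d x \<in> step_kernel n"
  using fixed_nu_tt step_tt endo_zero[OF tt_endo] E.unit_nonzero by (simp add: step_kernel_def)

lemma step_kernel_nu: "x \<in> step_kernel n \<Longrightarrow> nu b x \<in> step_kernel n"
  using A.step_nu[of x n b] endo_zero[OF A.nu_endo] A.nu_commute[of x _ b]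
  by (simp add: step_kernel_def A.fixed_nu_def)

text \<open>The last nonzero sum before the sums vanish is killed by the next step.\<close>

lemma step_kernel_nonzero: obtains n x where "x \<in> step_kernel n" "x \<noteq> 0"
proof -
  obtain x where x: "x \<in> V" "x \<noteq> 0" by (rule V_nonzero)
  obtain n where n: "A.fixed_nu n x" using A.nu_smooth[OF x(1)] x(1) by (auto simp: A.fixed_nu_def)
  define k where "k = (LEAST k. A.nu_sums k n x = 0)"
  have "A.nu_sums k n x = 0" unfolding k_def using A.sums_vanish[OF n] by (rule LeastI_ex)
  then obtain l where l: "k = Suc l" using x(2) by (cases k) auto
  let ?y = "A.nu_sums l n x"
  have y: "?y \<noteq> 0" using not_less_Least[of l "\<lambda>k. A.nu_sums k n x = 0"] l unfolding k_def by auto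
  have "A.nu_sum_step (n - int l) ?y = 0"
    using \<open>A.nu_sums k n x = 0\<close> A.sums_add[of l 1 n x] l by simp
  then have "?y \<in> step_kernel (n - int l)" using A.sums_fixed[OF n] by (simp add: step_kernel_def)
  then show ?thesis using that y by blast
qed

end

text \<open>The subgroup of \<open>H\<close> acting through \<open>\<eta>\<close> is enlarged one step of the norm filtration at a time.\<close>

locale torus_character = cuspidal_U11 vF vE \<iota> s p scl V \<pi>
  for vF :: "'f::field \<Rightarrow> int" and vE :: "'e::field \<Rightarrow> int" and \<iota> s p
    and scl :: "complex \<Rightarrow> 'v \<Rightarrow> 'v::ab_group_add" and V \<pi> +
  fixes H :: "'e set" and \<eta> :: "'e \<Rightarrow> complex"
  assumes units_H: "\<iota> ` int_units vF \<subseteq> H" and H_units: "H \<subseteq> int_units vE"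
    and H_mult: "\<And>g h. g \<in> H \<Longrightarrow> h \<in> H \<Longrightarrow> g * h \<in> H"
    and H_inverse: "\<And>h. h \<in> H \<Longrightarrow> inverse h \<in> H"
    and char_mult: "\<And>g h. g \<in> H \<Longrightarrow> h \<in> H \<Longrightarrow> \<eta> (g * h) = \<eta> g * \<eta> h"
    and char_nonzero: "\<And>h. h \<in> H \<Longrightarrow> \<eta> h \<noteq> 0"
    and char_smooth: "\<exists>n. \<forall>h\<in>H. h - 1 \<in> ideal_power vE n \<longrightarrow> \<eta> h = 1"
    and char_central: "\<And>h x. h \<in> H \<Longrightarrow> h * s h = 1 \<Longrightarrow> x \<in> V \<Longrightarrow> tt h x = scl (\<eta> h) x"
begin

text \<open>Measured by the norm and not by the distance to 1: the torus moves the characters of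
  \<open>N\<close> by the norm, and elements of norm one are central.\<close>

definition norm_filtration :: "int \<Rightarrow> 'e set" where
  "norm_filtration k = {h \<in> H. nm h - 1 \<in> F.P k}"

lemma one_H: "1 \<in> H"
  using units_H emb_one F.unit_one by (metis image_subset_iff)

lemma char_one: "\<eta> 1 = 1"
  using char_mult[OF one_H one_H] char_nonzero[OF one_H] by simp

lemma nm_H: "h \<in> H \<Longrightarrow> nm h \<in> int_units vF"
  using nm_unit H_units by blast

lemma filtration_mult: "g \<in> norm_filtration k \<Longrightarrow> h \<in> norm_filtration k \<Longrightarrow> 0 \<le> k \<Longrightarrow> g * h \<in> norm_filtration k"
  using H_mult F.one_mult by (simp add: norm_filtration_def nm_mult)

lemma filtration_quotient:
  assumes "g \<in> H" "h \<in> H" "nm g - nm h \<in> F.P k"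
  shows "g / h \<in> norm_filtration k"
proof -
  have h0: "nm h \<noteq> 0" using F.unit_nonzero[OF nm_H[OF assms(2)]] .
  have "nm (g / h) - 1 = (nm g - nm h) / nm h"
    using h0 by (simp add: nm_divide diff_divide_distrib)
  then show ?thesis
    using assms H_mult[OF assms(1) H_inverse[OF assms(2)]] F.P_unit_divide[OF nm_H[OF assms(2)]]
    by (simp add: norm_filtration_def divide_inverse)
qed

text \<open>An element whose norm is close to 1 is \<open>\<iota> u * e\<close> with
  \<open>e\<close> of norm one and \<open>u\<close> close to 1. The factor \<open>e\<close> acts
  through \<open>\<eta>\<close> by centrality, while \<open>\<iota> u\<close> fixes the smooth
  vector and has \<open>\<eta> (\<iota> u) = 1\<close>.\<close>

lemma eigen_deep:
  assumes x: "x \<in> V"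
  obtains k :: nat where "eigen (norm_filtration (int k)) \<eta> x"
proof -
  obtain n where n: "0 < n" "\<And>d. d - 1 \<in> E.P n \<Longrightarrow> tt d x = x" using tt_smooth[OF x] by blast
  obtain m where m: "\<forall>h\<in>H. h - 1 \<in> E.P m \<longrightarrow> \<eta> h = 1" using char_smooth by blast
  define k where "k = max 1 (max n m)"
  have "tt h x = scl (\<eta> h) x" if "h \<in> norm_filtration k" for h
  proof -
    have h: "h \<in> H" "nm h - 1 \<in> F.P k" using that by (simp_all add: norm_filtration_def)
    have "0 < k" by (simp add: k_def)
    then obtain u e where ue: "h = \<iota> u * e" "u - 1 \<in> F.P k" "e * s e = 1"
      using norm_one_factor[OF h(2)] by blast
    have uu: "u \<in> int_units vF" using F.one_unit[OF ue(2) \<open>0 < k\<close>] .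
    then have uH: "\<iota> u \<in> H" using units_H by blast
    have u0: "\<iota> u \<noteq> 0" using F.unit_nonzero[OF uu] by simp
    have "e = h * inverse (\<iota> u)" using ue(1) u0 by simp
    then have eH: "e \<in> H" using H_mult[OF h(1) H_inverse[OF uH]] by simp
    have e0: "e \<noteq> 0" using ue(3) by auto
    have k: "\<iota> u - 1 \<in> E.P k" using ue(2) emb_one_P by blast
    have un: "\<iota> u - 1 \<in> E.P n" "\<iota> u - 1 \<in> E.P m"
      using E.P_mono[OF k, of n] E.P_mono[OF k, of m] by (simp_all add: k_def)
    have "tt h x = tt (\<iota> u) (scl (\<eta> e) x)"
      using tt_mult[OF u0 e0 x] char_central[OF eH ue(3) x] ue(1) by simp
    also have "\<dots> = scl (\<eta> e) x" using tt_scl[OF u0 x] n(2)[OF un(1)] by simp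
    also have "\<eta> e = \<eta> h" using char_mult[OF uH eH] m uH un(2) ue(1) by simp
    finally show ?thesis .
  qed
  then show ?thesis using that[of "nat k"] x by (simp add: eigen_def k_def)
qed

text \<open>The candidates \<open>y x\<close> are, up to a factor, the projections of the translates
  \<open>nu x z\<close> to the \<open>\<eta>\<close>-part under the larger group \<open>?H\<close>.
  If all of them vanished, so would the sum of \<open>nu (- x) (y x)\<close> over \<open>x\<close>.
  But a class other than that of 1 contributes a full averaging step, which is zero on
  \<open>step_kernel n\<close>, whereas the class of 1 contributes a nonzero multiple of
  \<open>z\<close>.\<close>

lemma eigen_step:
  assumes z: "z \<in> step_kernel n" "z \<noteq> 0" and k: "1 \<le> k" and eig: "eigen (norm_filtration k) \<eta> z"
  shows "\<exists>y. y \<in> step_kernel n \<and> y \<noteq> 0 \<and> eigen (norm_filtration (k - 1)) \<eta> y"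
proof -
  let ?H = "norm_filtration (k - 1)" and ?R = "\<lambda>g h. nm g - nm h \<in> F.P k"
  have zV: "z \<in> V" using z(1) by (rule step_kernel_V)
  have HH: "h \<in> H" "h \<in> int_units vE" "h \<noteq> 0" "nm h \<in> int_units vF" "nm h \<noteq> 0" if "h \<in> ?H" for h
    using that H_units E.unit_nonzero nm_H by (auto simp: norm_filtration_def)
  have eqR: "equivp ?R"
    using equivp_pullback[OF F.equivp_mod[of k], of nm] .
  obtain T where T: "finite T" "\<And>x. x \<in> F.P 0 \<Longrightarrow> \<exists>t\<in>T. x - t \<in> F.P k"
    using F.quotient_finite'[of 0 k] by blast
  define c where "c t = (SOME h. h \<in> ?H \<and> nm h - t \<in> F.P k)" for t
  have "\<exists>g\<in>c ` T. ?R h g" if h: "h \<in> ?H" for h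
  proof -
    obtain t where t: "t \<in> T" "nm h - t \<in> F.P k" using T(2) F.unit_P[OF HH(4)[OF h]] by blast
    have ct: "c t \<in> ?H \<and> nm (c t) - t \<in> F.P k"
      unfolding c_def by (rule someI[of _ h]) (use h t in simp)
    have "(nm h - t) - (nm (c t) - t) \<in> F.P k"
      using F.P_diff[OF t(2) conjunct2[OF ct]] .
    then show ?thesis using t(1) by auto
  qed
  then obtain S where S: "transversal ?R ?H S"
    using transversal_exists[OF eqR, of "c ` T" ?H] T(1) by blast
  have SH: "S \<subseteq> ?H" using S by (simp add: transversal_def)
  define zh where "zh h = scl (inverse (\<eta> h)) (tt h z)" for h
  have zhK: "zh h \<in> step_kernel n" if "h \<in> ?H" for h
    unfolding zh_def using step_kernel_tt[OF z(1) HH(2)[OF that]] subspace_step_kernel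
    by (rule subspace_scale[rotated])
  have zh_cong: "zh g = zh h" if g: "g \<in> ?H" and h: "h \<in> ?H" and gh: "?R g h" for g h
  proof -
    define q where "q = g / h"
    have q: "q \<in> norm_filtration k" unfolding q_def using filtration_quotient HH g h gh by blast
    then have qH: "q \<in> H" by (simp add: norm_filtration_def)
    then have q0: "q \<noteq> 0" using H_units E.unit_nonzero by blast
    have g_eq: "g = h * q" using HH(3)[OF h] by (simp add: q_def)
    have "tt g z = scl (\<eta> q) (tt h z)"
      unfolding g_eq using tt_mult[OF HH(3)[OF h] q0 zV] tt_scl[OF HH(3)[OF h] zV] eig q
      by (simp add: eigen_def)
    moreover have "\<eta> g = \<eta> h * \<eta> q" unfolding g_eq using char_mult HH(1)[OF h] qH by blast
    ultimately show ?thesis using char_nonzero[OF qH] by (simp add: zh_def)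
  qed
  define f where "f x h = scl (inverse (\<eta> h)) (tt h (nu x z))" for x h
  have f_eq: "f x h = nu (x / nm h) (zh h)" if "h \<in> ?H" for x h
    using tt_nu[OF HH(3)[OF that] zV] HH(3)[OF that] zV by (simp add: f_def zh_def A.nu_scl)
  have fK: "f x h \<in> step_kernel n" if "h \<in> ?H" for x h
    unfolding f_eq[OF that] by (intro step_kernel_nu zhK that)
  define y where "y x = sum (f x) S" for x
  have yK: "y x \<in> step_kernel n" for x
    unfolding y_def using SH fK by (intro subspace_sum[OF subspace_step_kernel]) blast
  have eigy: "eigen ?H \<eta> (y x)" if x: "x \<in> F.P (n - k)" for x
    unfolding eigen_def
  proof (intro conjI ballI)
    show "y x \<in> V" using yK by (rule step_kernel_V)
    fix g assume g: "g \<in> ?H"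
    have fcong: "f x h = f x h'" if h: "h \<in> ?H" "h' \<in> ?H" "?R h h'" for h h'
    proof -
      have "x / nm h - x / nm h' = - (x * (nm h - nm h') / (nm h * nm h'))"
        using HH(5)[OF h(1)] HH(5)[OF h(2)] by (simp add: field_simps)
      moreover have "x * (nm h - nm h') \<in> F.P n" by (rule F.P_mult_mono[OF x h(3)]) simp
      ultimately have "x / nm h - x / nm h' \<in> F.P n"
        using F.P_unit_divide[OF F.unit_mult[OF HH(4)[OF h(1)] HH(4)[OF h(2)]]] by simp
      then have "nu (x / nm h) (zh h') = nu (x / nm h') (zh h')"
        using zhK[OF h(2)] A.fixed_nu_cong[of n] unfolding step_kernel_def by blast
      then show ?thesis using f_eq h zh_cong[OF h] by simp
    qed
    have "tt g (y x) = (\<Sum>h\<in>S. tt g (f x h))"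
      unfolding y_def using SH fK step_kernel_V
      by (intro endo_sum[OF tt_endo[OF HH(3)[OF g]]]) blast
    also have "\<dots> = (\<Sum>h\<in>S. scl (\<eta> g) (f x (g * h)))"
    proof (rule sum.cong)
      fix h assume "h \<in> S"
      then have h: "h \<in> ?H" using SH by blast
      have "tt g (f x h) = scl (inverse (\<eta> h)) (tt (g * h) (nu x z))"
        unfolding f_def using HH(3)[OF g] HH(3)[OF h] zV by (simp add: tt_scl tt_mult)
      moreover have "inverse (\<eta> h) = \<eta> g * inverse (\<eta> (g * h))"
        using char_mult[OF HH(1)[OF g] HH(1)[OF h]] char_nonzero HH(1) g h by simp
      ultimately show "tt g (f x h) = scl (\<eta> g) (f x (g * h))" by (simp add: f_def)
    qed simp
    also have "\<dots> = scl (\<eta> g) (\<Sum>h\<in>S. f x (g * h))" by (simp only: scale_sum_right)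
    also have "(\<Sum>h\<in>S. f x (g * h)) = y x"
      unfolding y_def
    proof (rule sum_transversal_reindex[OF S S])
      have gi: "inverse g \<in> ?H"
        using filtration_quotient[OF one_H HH(1)[OF g], of "k - 1"] g F.P_uminus[of "nm g - 1" "k - 1"]
        by (simp add: norm_filtration_def inverse_eq_divide)
      have "0 \<le> k - 1" using k by simp
      then show "bij_betw ((*) g) ?H ?H"
        using HH(3)[OF g] filtration_mult[OF g] filtration_mult[OF gi]
        by (intro bij_betw_byWitness[where f' = "(*) (inverse g)"]) auto
      have R_iff: "nm (g * h) - nm (g * h') \<in> F.P k \<longleftrightarrow> nm h - nm h' \<in> F.P k" for h h'
        using F.P_unit_mult[OF HH(4)[OF g], of "nm h - nm h'" k] by (simp add: nm_mult right_diff_distrib)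
      show "nm h - nm h' \<in> F.P k" if "nm (g * h) - nm (g * h') \<in> F.P k" for h h'
        using that R_iff by blast
      show "nm (g * h) - nm (g * h') \<in> F.P k" if "nm h - nm h' \<in> F.P k" for h h'
        using that R_iff by blast
    qed (rule fcong)
    finally show "tt g (y x) = scl (\<eta> g) (y x)" .
  qed
  have "\<exists>x\<in>F.reps (n - k). y x \<noteq> 0"
  proof (rule ccontr)
    assume "\<not> ?thesis"
    then have yz: "y x = 0" if "x \<in> F.reps (n - k)" for x using that by blast
    \<comment> \<open>After \<open>nu (- x)\<close> the summand \<open>nu (x / nm h) (zh h)\<close>
      is displaced by \<open>e h * x\<close>. Outside the class of 1 the factor \<open>e h\<close>
      has exact valuation \<open>k - 1\<close>, so \<open>e h * x\<close> runs over the top layer of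
      \<open>P (n - 1)\<close>.\<close>
    define e where "e h = 1 / nm h - 1" for h
    have row: "(\<Sum>h\<in>S. nu (e h * x) (zh h)) = 0" if "x \<in> F.reps (n - k)" for x
    proof -
      have "nu (- x) (f x h) = nu (e h * x) (zh h)" if "h \<in> S" for h
      proof -
        have h: "h \<in> ?H" using that SH by blast
        have "zh h \<in> V" using zhK[OF h] by (rule step_kernel_V)
        then have "nu (- x) (nu (x / nm h) (zh h)) = nu (- x + x / nm h) (zh h)"
          by (rule A.nu_add[symmetric])
        moreover have "- x + x / nm h = e h * x" by (simp add: e_def left_diff_distrib)
        ultimately show ?thesis using f_eq[OF h] by simp
      qed
      then have "(\<Sum>h\<in>S. nu (e h * x) (zh h)) = (\<Sum>h\<in>S. nu (- x) (f x h))" by simp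
      also have "\<dots> = nu (- x) (y x)"
        unfolding y_def using SH fK step_kernel_V by (intro endo_sum[OF A.nu_endo, symmetric]) blast
      finally show ?thesis using yz[OF that] endo_zero[OF A.nu_endo] by simp
    qed
    have oneH: "1 \<in> ?H" using one_H by (simp add: norm_filtration_def)
    have ex1: "\<forall>x\<in>?H. \<exists>!h. h \<in> S \<and> ?R x h"
      using S unfolding transversal_def by (elim conjE)
    from bspec[OF ex1 oneH] obtain h0 where h0: "h0 \<in> S" "?R 1 h0"
      "\<And>h. h \<in> S \<Longrightarrow> ?R 1 h \<Longrightarrow> h = h0" by (elim ex1E) blast
    have e_eq: "e h = (1 - nm h) / nm h" if "h \<in> ?H" for h
      using HH(5)[OF that] by (simp add: e_def diff_divide_distrib)
    have col: "(\<Sum>x\<in>F.reps (n - k). nu (e h * x) (zh h)) = 0" if h: "h \<in> S - {h0}" for h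
    proof -
      have hH: "h \<in> ?H" using h SH by blast
      have "1 - nm h \<notin> F.P k" using h h0(3)[of h] by auto
      moreover have "1 - nm h \<in> F.P (k - 1)"
        using hH F.P_uminus[of "nm h - 1" "k - 1"] by (simp add: norm_filtration_def)
      ultimately have "e h \<notin> F.P k" "e h \<in> F.P (k - 1)"
        using F.P_unit_divide[OF HH(4)[OF hH]] e_eq[OF hH] by simp_all
      then have "e h \<noteq> 0" "vF (e h) = n - 1 - (n - k)" by (auto simp: F.in_P)
      from A.step_scaled[OF _ this, of "zh h"] show ?thesis
        using zhK[OF hH] by (simp add: step_kernel_def)
    qed
    have h0H: "h0 \<in> ?H" using h0(1) SH by blast
    have "zh 1 = z" using char_one zV by (simp add: zh_def tt_one)
    then have z0: "zh h0 = z" using zh_cong[OF oneH h0H] h0(2) by simp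
    have "1 - nm h0 \<in> F.P k" using h0(2) by simp
    then have e0: "e h0 \<in> F.P k"
      using e_eq[OF h0H] F.P_unit_divide[OF HH(4)[OF h0H]] by simp
    have "nu (e h0 * x) z = z" if "x \<in> F.reps (n - k)" for x
    proof -
      have "e h0 * x \<in> F.P n" by (rule F.P_mult_mono[OF e0 F.reps_P[OF that]]) simp
      then show ?thesis using z(1) by (simp add: step_kernel_def A.fixed_nu_def)
    qed
    then have "(\<Sum>x\<in>F.reps (n - k). nu (e h0 * x) (zh h0)) = (\<Sum>x\<in>F.reps (n - k). z)"
      using z0 by simp
    also have "\<dots> = scl (of_nat (card (F.reps (n - k)))) z" by (rule sum_const_scl)
    finally have c0: "(\<Sum>x\<in>F.reps (n - k). nu (e h0 * x) (zh h0)) = scl (of_nat (card (F.reps (n - k)))) z" .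
    have "finite S" using S by (simp add: transversal_def)
    then have "(\<Sum>h\<in>S. \<Sum>x\<in>F.reps (n - k). nu (e h * x) (zh h)) =
        (\<Sum>x\<in>F.reps (n - k). nu (e h0 * x) (zh h0)) +
        (\<Sum>h\<in>S - {h0}. \<Sum>x\<in>F.reps (n - k). nu (e h * x) (zh h))"
      using h0(1) by (rule sum.remove)
    also have "\<dots> = scl (of_nat (card (F.reps (n - k)))) z" using c0 col by simp
    finally have "scl (of_nat (card (F.reps (n - k)))) z =
        (\<Sum>x\<in>F.reps (n - k). \<Sum>h\<in>S. nu (e h * x) (zh h))"
      by (subst sum.swap) simp
    also have "\<dots> = 0" using row by simp
    finally show False using z(2) F.card_reps by simp
  qed
  then obtain x where "x \<in> F.reps (n - k)" "y x \<noteq> 0" by blast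
  then show ?thesis using yK eigy F.reps_P by blast
qed

lemma character_occurs: obtains n x where "A.fixed_nu n x" "x \<noteq> 0" "eigen H \<eta> x"
proof -
  obtain n z where z: "z \<in> step_kernel n" "z \<noteq> 0" by (rule step_kernel_nonzero)
  obtain k where k: "eigen (norm_filtration (int k)) \<eta> z"
    using eigen_deep[OF step_kernel_V[OF z(1)]] by blast
  have "\<exists>y. y \<in> step_kernel n \<and> y \<noteq> 0 \<and> eigen (norm_filtration 0) \<eta> y"
    if "z \<in> step_kernel n" "z \<noteq> 0" "eigen (norm_filtration (int k)) \<eta> z" for k z
    using that
  proof (induction k arbitrary: z)
    case 0
    then show ?case by auto
  next
    case (Suc k)
    then show ?case using eigen_step[of z n "int (Suc k)"] by auto
  qed
  from this[OF z k] obtain y where y: "y \<in> step_kernel n" "y \<noteq> 0" "eigen (norm_filtration 0) \<eta> y" by blast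
  have "norm_filtration 0 = H"
    using nm_H F.unit_P F.P_diff by (auto simp: norm_filtration_def F.one_in_P)
  then have "A.fixed_nu n y" "eigen H \<eta> y" using y by (simp_all add: step_kernel_def)
  then show ?thesis using that y(2) by blast
qed

end

section \<open>The conductors\<close>

text \<open>Since \<open>LEAST\<close> of an empty predicate is unspecified, an
  \<open>\<eta>\<close> that never occurs could spoil the minimum; the first assumption excludes
  this. The minimum of minima is then the minimum of the union \<open>S\<close>.\<close>

lemma Least_family:
  fixes L :: "'h \<Rightarrow> nat \<Rightarrow> bool"
  assumes "\<And>\<eta>. ok \<eta> \<Longrightarrow> \<exists>m. L \<eta> m" "\<And>\<eta> m. ok \<eta> \<Longrightarrow> L \<eta> m \<Longrightarrow> S m"
    "\<And>m. S m \<Longrightarrow> \<exists>\<eta>. ok \<eta> \<and> L \<eta> m" "S k"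
  shows "(LEAST c. \<exists>\<eta>. ok \<eta> \<and> c = (LEAST m. L \<eta> m)) = (LEAST m. S m)"
proof (rule Least_equality)
  have S: "S (LEAST m. S m)" using assms(4) by (rule LeastI)
  then obtain \<eta> where \<eta>: "ok \<eta>" "L \<eta> (LEAST m. S m)" using assms(3) by blast
  have "(LEAST m. L \<eta> m) = (LEAST m. S m)"
    using \<eta> assms(2) by (intro Least_equality) (auto intro: Least_le)
  then show "\<exists>\<eta>. ok \<eta> \<and> (LEAST m. S m) = (LEAST m. L \<eta> m)" using \<eta>(1) by auto
next
  fix c assume "\<exists>\<eta>. ok \<eta> \<and> c = (LEAST m. L \<eta> m)"
  then obtain \<eta> where \<eta>: "ok \<eta>" "c = (LEAST m. L \<eta> m)" by blast
  have "L \<eta> c" unfolding \<eta>(2) using assms(1)[OF \<eta>(1)] by (rule LeastI_ex)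
  then show "(LEAST m. S m) \<le> c" using assms(2) \<eta>(1) by (intro Least_le)
qed

context cuspidal_U11
begin

lemma nl_smooth:
  assumes x: "x \<in> V"
  shows "\<exists>n. \<forall>c\<in>F.P n. nl c x = x"
  by (rule smooth[OF x]) (force simp: nl_def emb_P)

definition level :: "int \<Rightarrow> int \<Rightarrow> ('e \<Rightarrow> complex) \<Rightarrow> 'v \<Rightarrow> bool" where
  "level i j \<eta> x \<longleftrightarrow> A.fixed_nu i x \<and> (\<forall>c\<in>F.P j. nl c x = x) \<and> eigen (int_units vE) \<eta> x"

lemma unit_character_emb:
  assumes "unit_character vE \<eta>"
  shows "unit_character vF (\<lambda>u. \<eta> (\<iota> u))"
proof -
  obtain n where n: "\<forall>x\<in>unit_filtration vE n. \<eta> x = 1"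
    using assms by (auto simp: unit_character_def)
  have "\<forall>x\<in>unit_filtration vF n. \<eta> (\<iota> x) = 1"
    using n emb_unit emb_one_P by (simp add: F.unit_filtration_iff E.unit_filtration_iff)
  then show ?thesis
    using assms emb_unit unfolding unit_character_def by (auto simp: emb_mult)
qed

lemma level_type:
  "level i j \<eta> x \<Longrightarrow> A.torus_type i j 0 (\<lambda>u. \<eta> (\<iota> u)) x"
  using emb_unit by (simp add: level_def A.torus_type_def eigen_def unit_filtration_def)

lemma level_bound:
  assumes "unit_character vE \<eta>" "level i j \<eta> x" "x \<noteq> 0"
  shows "2 \<le> i + j" and "u \<in> unit_filtration vF (nat (i + j) div 2) \<Longrightarrow> \<eta> (\<iota> u) = 1"
  using A.type_level[OF level_type[OF assms(2)] assms(3)] unit_character_emb[OF assms(1)]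
  unfolding unit_character_def by blast+

text \<open>Conjugation by \<open>diag(q, 1)\<close>, where \<open>q = 1\<close> for \<open>K\<^sub>m\<close> and \<open>q = 1/p\<close> for \<open>K\<^sub>m'\<close>.\<close>

definition shift :: "('f \<Rightarrow> 'a::field) \<Rightarrow> 'f \<Rightarrow> ('a^2^2 \<Rightarrow> 'a^2^2) \<Rightarrow> bool" where
  "shift j q \<phi> \<longleftrightarrow> q \<noteq> 0 \<and> (\<forall>a b c d. \<phi> (mat2 a b c d) = mat2 a (b * j q) (c / j q) d)"

lemma shift_id: "shift \<iota> 1 id" "shift id 1 id"
  by (simp_all add: shift_def emb_one)

lemma shift_alpha: "shift \<iota> (inverse p) (alpha_conj (\<iota> p))" "shift id (inverse p) (alpha_conj p)"
  using p(1) by (simp_all add: shift_def alpha_conj_mat2 emb_inverse divide_inverse mult.commute)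

lemma shift_upper:
  assumes "shift \<iota> q \<phi>" shows "\<phi> (mat2 1 (\<iota> (b / q)) 0 1) = mat2 1 (\<iota> b) 0 1"
  using assms by (simp add: shift_def emb_divide)

lemma shift_lower:
  assumes "shift \<iota> q \<phi>" shows "\<phi> (mat2 1 0 (\<iota> (c * q)) 1) = mat2 1 0 (\<iota> c) 1"
  using assms by (simp add: shift_def emb_mult)

lemma shift_diag:
  assumes "shift \<iota> q \<phi>" shows "\<phi> (mat2 a 0 0 d) = mat2 a 0 0 d"
  using assms by (simp add: shift_def)

lemma P_shift:
  assumes "q \<noteq> 0" "vF q = i"
  shows "b / q \<in> F.P n \<longleftrightarrow> b \<in> F.P (n + i)" "c * q \<in> F.P n \<longleftrightarrow> c \<in> F.P (n - i)"
proof -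
  show "b / q \<in> F.P n \<longleftrightarrow> b \<in> F.P (n + i)"
    using F.P_scale[OF assms(1), of "b / q" "n + i"] assms by simp
  show "c * q \<in> F.P n \<longleftrightarrow> c \<in> F.P (n - i)"
    using F.P_scale[OF assms(1), of c n] assms by (simp add: mult.commute)
qed

lemma Kbar_mat2: "mat2 a b c d \<in> Kbar vE s m \<longleftrightarrow> mat2 a b c d \<in> carrier (U11 s) \<and>
    a * d - b * c \<in> int_units vE \<and> a \<in> E.P 0 \<and> b \<in> E.P 0 \<and> c \<in> E.P 0 \<and> d \<in> E.P 0 \<and>
    (m = 0 \<or> c \<in> E.P (int m))"
  by (simp add: Kbar_def GL2_integers_def det_mat2 int_matrix_iff)

text \<open>Iwahori factorization: for positive \<open>m\<close> the product \<open>b * c\<close> is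
  in the maximal ideal, so \<open>d\<close> is a unit and the matrix lies in the big cell, with
  unipotent factors of the required depths. Conversely, these factors themselves belong to the
  group.\<close>

lemma Kbar_space_pos:
  assumes \<phi>: "shift \<iota> q \<phi>" "vF q = i" and \<eta>: "unit_character vE \<eta>" and m: "m \<noteq> 0"
  shows "Kbar_space vF vE \<iota> s scl V \<pi> \<phi> \<eta> m = {x. level i (int m - i) \<eta> x}"
proof -
  have q: "q \<noteq> 0" using \<phi>(1) by (simp add: shift_def)
  have \<eta>1: "\<eta> 1 = 1"
    using \<eta> unfolding unit_character_def by (metis E.unit_one mult_cancel_right1 mult_1)
  have "level i (int m - i) \<eta> x" if x: "x \<in> V" "\<And>g. g \<in> Kbar vE s m \<Longrightarrow> \<pi> (\<phi> g) x = scl (\<eta> (g $ 2 $ 2)) x" for x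
    unfolding level_def A.fixed_nu_def eigen_def
  proof (intro conjI ballI)
    fix b assume "b \<in> F.P i"
    then have "\<iota> (b / q) \<in> E.P 0" using P_shift[OF q \<phi>(2)] emb_P by simp
    then have "mat2 1 (\<iota> (b / q)) 0 1 \<in> Kbar vE s m" by (simp add: Kbar_mat2 E.one_in_P)
    from x(2)[OF this] show "nu b x = x" using shift_upper[OF \<phi>(1)] \<eta>1 by (simp add: nu_def)
  next
    fix c assume "c \<in> F.P (int m - i)"
    then have c: "\<iota> (c * q) \<in> E.P (int m)" using P_shift[OF q \<phi>(2)] emb_P by simp
    then have "\<iota> (c * q) \<in> E.P 0" by (rule E.P_mono) simp
    then have "mat2 1 0 (\<iota> (c * q)) 1 \<in> Kbar vE s m" using c by (simp add: Kbar_mat2 E.one_in_P)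
    from x(2)[OF this] show "nl c x = x" using shift_lower[OF \<phi>(1)] \<eta>1 by (simp add: nl_def)
  next
    fix d assume d: "d \<in> int_units vE"
    then have "d \<noteq> 0" "inverse (s d) \<in> int_units vE" using E.unit_nonzero E.unit_inverse by auto
    then have "mat2 (inverse (s d)) 0 0 d \<in> Kbar vE s m"
      using d E.unit_P E.unit_mult by (simp add: Kbar_mat2)
    from x(2)[OF this] show "tt d x = scl (\<eta> d) x" using shift_diag[OF \<phi>(1)] by (simp add: tt_def)
  qed (use x in simp_all)
  moreover have "\<pi> (\<phi> g) x = scl (\<eta> (g $ 2 $ 2)) x"
    if x: "level i (int m - i) \<eta> x" and g: "g \<in> Kbar vE s m" for g x
  proof -
    have xV: "x \<in> V" using x by (simp add: level_def A.fixed_nu_def)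
    obtain a b c d where ge: "g = mat2 a b c d" by (rule mat2_cases)
    have k: "mat2 a b c d \<in> carrier (U11 s)" "a * d - b * c \<in> int_units vE" "a \<in> E.P 0" "b \<in> E.P 0"
      "d \<in> E.P 0" "c \<in> E.P (int m)" using g m unfolding ge Kbar_mat2 by auto
    have "b * c \<in> E.P 1" using m by (intro E.P_mult_mono[OF k(4,6)]) simp
    then have "a * d \<notin> E.P 1"
      using k(2) E.P_diff[of "a * d" 1 "b * c"] by (auto simp: E.int_units_iff)
    then have "d \<notin> E.P 1" using E.P_mult_mono[OF k(3), of d 1 1] by auto
    then have d: "d \<in> int_units vE" using k(5) by (simp add: E.int_units_iff)
    then have d0: "d \<noteq> 0" by (rule E.unit_nonzero)
    obtain b' c' where bc: "b = \<iota> b' * d" "c = \<iota> c' * d"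
      "mat2 a b c d = mat2 1 (\<iota> b') 0 1 ** mat2 (inverse (s d)) 0 0 d ** mat2 1 0 (\<iota> c') 1"
      using U11_big_cell[OF k(1) d0] by blast
    have "\<iota> b' = b / d" "\<iota> c' = c / d" using bc(1,2) d0 by simp_all
    then have b': "b' \<in> F.P 0" and c': "c' \<in> F.P (int m)"
      using k(4,6) E.P_unit_divide[OF d] emb_P by metis+
    have b2: "b' * q \<in> F.P i" using b' P_shift(2)[OF q \<phi>(2)] by simp
    have c2: "c' / q \<in> F.P (int m - i)" using c' P_shift(1)[OF q \<phi>(2)] by simp
    have a: "a = inverse (s d) + \<iota> b' * d * \<iota> c'" using bc(3) by (simp add: mat2_mult mat2_eq_iff)
    have "\<iota> q \<noteq> 0" using q by simp
    then have "\<phi> g = mat2 1 (\<iota> (b' * q)) 0 1 ** (mat2 (inverse (s d)) 0 0 d ** mat2 1 0 (\<iota> (c' / q)) 1)"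
      using \<phi>(1) unfolding ge shift_def
      by (simp add: mat2_mult mat2_eq_iff a bc(1,2) emb_mult emb_divide del: FE.scale_scale)
    then have "\<pi> (\<phi> g) x = nu (b' * q) (tt d (nl (c' / q) x))"
      using d0 xV by (simp add: nu_def tt_def nl_def act_act U11_mult_in)
    also have "\<dots> = scl (\<eta> d) x"
      using x c2 b2 d xV by (simp add: level_def A.fixed_nu_def eigen_def A.nu_scl)
    finally show ?thesis by (simp add: ge)
  qed
  moreover have "x \<in> V" if "level i (int m - i) \<eta> x" for x
    using that by (simp add: level_def A.fixed_nu_def)
  moreover have "x \<in> Kbar_space vF vE \<iota> s scl V \<pi> \<phi> \<eta> m \<longleftrightarrow>
      x \<in> V \<and> (\<forall>g\<in>Kbar vE s m. \<pi> (\<phi> g) x = scl (\<eta> (g $ 2 $ 2)) x)" for x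
    using m by (simp add: Kbar_space_def)
  ultimately show ?thesis by blast
qed

text \<open>For \<open>m = 0\<close> both sides are false, because supercuspidality excludes level
  0. To see this on the left one also has to check that 0 lies in the space, as the empty set would
  differ from \<open>{0}\<close> too.\<close>

lemma Kbar_space_ne:
  assumes \<phi>: "shift \<iota> q \<phi>" "vF q = i" and \<eta>: "unit_character vE \<eta>"
  shows "Kbar_space vF vE \<iota> s scl V \<pi> \<phi> \<eta> m \<noteq> {0} \<longleftrightarrow> (\<exists>x. x \<noteq> 0 \<and> level i (int m - i) \<eta> x)"
proof (cases "m = 0")
  case False
  have "0 \<in> Kbar_space vF vE \<iota> s scl V \<pi> \<phi> \<eta> m"
    unfolding Kbar_space_pos[OF assms False] level_def A.fixed_nu_def eigen_def
    using endo_zero[OF A.nu_endo] endo_zero[OF A.nl_endo] endo_zero[OF tt_endo] E.unit_nonzero by auto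
  then show ?thesis using Kbar_space_pos[OF assms False] by auto
next
  case True
  have q: "q \<noteq> 0" using \<phi>(1) by (simp add: shift_def)
  have no: "\<not> level i (- i) \<eta> x" if "x \<noteq> 0" for x using level_bound(1)[OF \<eta> _ that] by fastforce
  show ?thesis
  proof (cases "\<forall>u\<in>int_units vF. \<eta> (\<iota> u) = 1")
    case False
    then show ?thesis using True no by (auto simp: Kbar_space_def)
  next
    case triv: True
    have \<eta>1: "\<eta> 1 = 1" using triv F.unit_one emb_one by metis
    let ?S = "Kbar_space vF vE \<iota> s scl V \<pi> \<phi> \<eta> 0"
    have S: "x \<in> ?S \<longleftrightarrow> x \<in> V \<and> (\<forall>k\<in>SL2_integers vF. \<forall>t\<in>int_units vE.
              \<pi> (\<phi> (map_matrix \<iota> k ** mat2 t 0 0 (inverse (s t)))) x = scl (\<eta> (inverse (s t))) x)" for x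
      using triv by (simp add: Kbar_space_def)
    have "level i (- i) \<eta> x" if x: "x \<in> ?S" for x
      unfolding level_def A.fixed_nu_def eigen_def
    proof (intro conjI ballI)
      have fixed: "\<pi> (\<phi> (mat2 1 (\<iota> b) (\<iota> c) 1)) x = x" if "mat2 1 b c 1 \<in> SL2_integers vF" for b c
      proof -
        have "\<pi> (\<phi> (map_matrix \<iota> (mat2 1 b c 1) ** mat2 1 0 0 (inverse (s 1)))) x = scl (\<eta> (inverse (s 1))) x"
          using x that E.unit_one unfolding S by blast
        then show ?thesis using \<eta>1 by (simp add: map_matrix_mat2 mat2_mult emb_one)
      qed
      show "nu b x = x" if "b \<in> F.P i" for b
      proof -
        have "b / q \<in> F.P 0" using that P_shift[OF q \<phi>(2)] by simp
        then have "mat2 1 (b / q) 0 1 \<in> SL2_integers vF"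
          by (simp add: SL2_integers_def det_mat2 int_matrix_iff F.one_in_P)
        from fixed[OF this] show ?thesis using shift_upper[OF \<phi>(1)] by (simp add: nu_def)
      qed
      show "nl c x = x" if "c \<in> F.P (- i)" for c
      proof -
        have "c * q \<in> F.P 0" using that P_shift[OF q \<phi>(2)] by simp
        then have "mat2 1 0 (c * q) 1 \<in> SL2_integers vF"
          by (simp add: SL2_integers_def det_mat2 int_matrix_iff F.one_in_P)
        from fixed[OF this] show ?thesis using shift_lower[OF \<phi>(1)] by (simp add: nl_def)
      qed
      fix d assume d: "d \<in> int_units vE"
      then have "inverse (s d) \<in> int_units vE" using E.unit_inverse by simp
      moreover have "mat 1 \<in> SL2_integers vF"
        by (simp add: SL2_integers_def mat_eq_mat2 det_mat2 int_matrix_iff F.one_in_P)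
      ultimately have "\<pi> (\<phi> (map_matrix \<iota> (mat 1) ** mat2 (inverse (s d)) 0 0 (inverse (s (inverse (s d)))))) x
          = scl (\<eta> (inverse (s (inverse (s d))))) x"
        using x unfolding S by blast
      then show "tt d x = scl (\<eta> d) x"
        using shift_diag[OF \<phi>(1)]
        by (simp add: tt_def mat_eq_mat2 map_matrix_mat2 mat2_mult emb_one aut_inverse)
    qed (use x S in blast)+
    moreover have "0 \<in> ?S"
    proof -
      have "\<pi> (\<phi> (map_matrix \<iota> k ** mat2 t 0 0 (inverse (s t)))) 0 = 0"
        if k: "k \<in> SL2_integers vF" and t: "t \<in> int_units vE" for k t
      proof -
        obtain a b c d where ke: "k = mat2 a b c d" by (rule mat2_cases)
        have "a * d - b * c = 1" using k by (simp add: ke SL2_integers_def det_mat2)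
        then have "a * d - b * q * (c / q) = 1" using q by simp
        from U11_emb[OF this] have "\<phi> (mat2 (\<iota> a) (\<iota> b) (\<iota> c) (\<iota> d)) \<in> carrier (U11 s)"
          using \<phi>(1) by (simp add: shift_def emb_mult emb_divide del: FE.scale_scale)
        moreover have t0: "t \<noteq> 0" using t by (rule E.unit_nonzero)
        ultimately have "\<phi> (mat2 (\<iota> a) (\<iota> b) (\<iota> c) (\<iota> d)) ** mat2 t 0 0 (inverse (s t)) \<in> carrier (U11 s)"
          using U11_mult_in by simp
        moreover have "\<phi> (map_matrix \<iota> k ** mat2 t 0 0 (inverse (s t))) =
            \<phi> (mat2 (\<iota> a) (\<iota> b) (\<iota> c) (\<iota> d)) ** mat2 t 0 0 (inverse (s t))"
          using \<phi>(1) by (simp add: shift_def ke map_matrix_mat2 mat2_mult mat2_eq_iff ac_simps del: FE.scale_scale)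
        ultimately show ?thesis using endo_zero[OF act_endo] by simp
      qed
      then show ?thesis unfolding S by simp
    qed
    ultimately have "?S = {0}" using no by blast
    then show ?thesis using True no by auto
  qed
qed

text \<open>The values 0 and -1 of \<open>i\<close> are the valuations of the conjugating elements 1
  and \<open>inverse p\<close>. No torus character occurs any more, which makes the condition common
  to \<open>U(1,1)\<close> and \<open>SL\<^sub>2(F)\<close>.\<close>

definition fixed_level :: "nat \<Rightarrow> bool" where
  "fixed_level m \<longleftrightarrow> (\<exists>i\<in>{0, -1}. \<exists>x. x \<noteq> 0 \<and> A.fixed_nu i x \<and> (\<forall>c\<in>F.P (int m - i). nl c x = x))"

lemma level_eigenvector:
  assumes x: "x \<noteq> 0" "A.fixed_nu i x" "\<forall>c\<in>F.P j. nl c x = x"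
  obtains \<eta> y where "unit_character vE \<eta>" "y \<noteq> 0" "level i j \<eta> y"
proof -
  define X where "X = {x. A.fixed_nu i x \<and> (\<forall>c\<in>F.P j. nl c x = x)}"
  have XV: "X \<subseteq> V" by (auto simp: X_def A.fixed_nu_def)
  have "subspace X"
    by (rule subspaceI)
      (auto simp: X_def A.fixed_nu_def endo_zero[OF A.nu_endo] endo_zero[OF A.nl_endo] A.nu_scl A.nl_scl
        linear_endoD(2)[OF A.nu_endo] linear_endoD(2)[OF A.nl_endo])
  moreover have "tt d x \<in> X" if d: "d \<in> int_units vE" and x: "x \<in> X" for d x
  proof -
    have d0: "d \<noteq> 0" using d by (rule E.unit_nonzero)
    have "nl c (tt d x) = tt d x" if c: "c \<in> F.P j" for c
    proof -
      have "c / nm d \<in> F.P j" using c F.P_unit_divide[OF nm_unit[OF d]] by blast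
      then have "nl (c / nm d) x = x" using x by (simp add: X_def)
      then show ?thesis using tt_nl[OF d0, of x "c / nm d"] x XV d0 by auto
    qed
    then show ?thesis using x d fixed_nu_tt by (simp add: X_def)
  qed
  moreover have "x \<in> X" using x by (simp add: X_def)
  ultimately obtain \<eta> y where "unit_character vE \<eta>" "y \<in> X" "y \<noteq> 0" "eigen (int_units vE) \<eta> y"
    using torus_eigenvector[of X x] XV x(1) by blast
  then show ?thesis using that by (auto simp: X_def level_def)
qed

lemma conductor_U11_at_eq:
  assumes "unit_character vE \<eta>"
  shows "conductor_U11_at vF vE \<iota> s p scl V \<pi> \<eta> =
    (LEAST m. \<exists>i\<in>{0, -1}. \<exists>x. x \<noteq> 0 \<and> level i (int m - i) \<eta> x)"
proof -
  have v: "vF 1 = 0" "vF (inverse p) = -1" using p by (simp_all add: F.val_inverse)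
  show ?thesis
    unfolding conductor_U11_at_def
    using Kbar_space_ne[OF shift_id(1) v(1) assms] Kbar_space_ne[OF shift_alpha(1) v(2) assms] by simp
qed

end

context torus_character
begin

text \<open>A torus element \<open>\<iota> q\<close> with \<open>q\<close> a high power of
  \<open>p\<close> moves the upper invariance to depth 0. It commutes with \<open>H\<close>, so the
  eigenvalues are unchanged.\<close>

lemma character_level:
  obtains m :: nat and x where "x \<noteq> 0" "A.fixed_nu 0 x" "\<forall>c\<in>F.P (int m). nl c x = x" "eigen H \<eta> x"
proof -
  obtain n x where x: "A.fixed_nu n x" "x \<noteq> 0" "eigen H \<eta> x" using character_occurs by blast
  have xV: "x \<in> V" using x(1) by (simp add: A.fixed_nu_def)
  define q where "q = p ^ nat n"
  have q: "q \<noteq> 0" "vF q = int (nat n)" using p by (simp_all add: q_def F.val_power)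
  have q0: "\<iota> q \<noteq> 0" using q by simp
  define y where "y = tt (\<iota> q) x"
  have yV: "y \<in> V" using xV q0 by (simp add: y_def)
  have "nu b y = y" if b: "b \<in> F.P 0" for b
  proof -
    have "b * (q * q) \<in> F.P n"
      using q by (intro F.P_mult_mono[OF b, of _ "int (nat n)"]) (auto simp: F.in_P F.val_mult)
    then have "nu (b * (q * q)) x = x" using x(1) by (simp add: A.fixed_nu_def)
    then show ?thesis using tt_nu[OF q0 xV, of "b * (q * q)"] q by (simp add: y_def)
  qed
  then have "A.fixed_nu 0 y" using yV by (simp add: A.fixed_nu_def)
  moreover have "y \<noteq> 0" using A.td_eq_0[OF q(1) xV] x(2) unfolding y_def by blast
  moreover have "eigen H \<eta> y"
    unfolding eigen_def
  proof (intro conjI ballI)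
    fix h assume h: "h \<in> H"
    then have "h \<noteq> 0" using H_units E.unit_nonzero by blast
    then show "tt h y = scl (\<eta> h) y"
      using tt_commute[OF _ q0 xV] x(3) h tt_scl[OF q0 xV] by (simp add: y_def eigen_def)
  qed (rule yV)
  moreover obtain n where n: "\<forall>c\<in>F.P n. nl c y = y" using nl_smooth[OF yV] by blast
  then have "\<forall>c\<in>F.P (int (nat n)). nl c y = y" using F.P_mono[of _ "int (nat n)" n] by simp
  ultimately show ?thesis using that by blast
qed

end

context cuspidal_U11
begin

lemma level_exists:
  assumes \<eta>: "unit_character vE \<eta>" "extends_central_character s scl V \<pi> \<eta>"
  shows "\<exists>m x. x \<noteq> 0 \<and> level 0 (int m) \<eta> x"
proof -
  interpret torus_character vF vE \<iota> s p scl V \<pi> "int_units vE" \<eta>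
  proof unfold_locales
    show "\<iota> ` int_units vF \<subseteq> int_units vE" using emb_unit by blast
    obtain n where "\<forall>x\<in>unit_filtration vE n. \<eta> x = 1" using \<eta>(1) by (auto simp: unit_character_def)
    then show "\<exists>n. \<forall>h\<in>int_units vE. h - 1 \<in> E.P n \<longrightarrow> \<eta> h = 1"
      by (intro exI[of _ "int n"]) (simp add: E.unit_filtration_iff)
    show "tt h x = scl (\<eta> h) x" if "h * s h = 1" "x \<in> V" for h x
      using central_tt[OF \<eta>(2)] that by blast
  qed (use \<eta>(1) in \<open>simp_all add: unit_character_def E.unit_mult E.unit_inverse\<close>)
  obtain m x where "x \<noteq> 0" "A.fixed_nu 0 x" "\<forall>c\<in>F.P (int m). nl c x = x" "eigen (int_units vE) \<eta> x"
    using character_level .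
  then have "x \<noteq> 0 \<and> level 0 (int m) \<eta> x" by (simp add: level_def)
  then show ?thesis by blast
qed

lemma fixed_level_exists: "\<exists>m. fixed_level m"
proof -
  obtain \<eta> where "unit_character vE \<eta>" "extends_central_character s scl V \<pi> \<eta>" using central_character .
  then obtain m x where "x \<noteq> 0" "level 0 (int m) \<eta> x" using level_exists by blast
  then show ?thesis unfolding fixed_level_def level_def by (intro exI[of _ m]) auto
qed

text \<open>Minimizing over \<open>\<eta>\<close> removes it from the condition: an invariant vector
  yields an eigenvector of the unit torus with the same invariance, and its character is compatible
  with the center.\<close>

theorem conductor_U11_eq: "conductor_U11 vF vE \<iota> s p scl V \<pi> = (LEAST m. fixed_level m)"
proof -
  define ok where "ok \<eta> \<longleftrightarrow> unit_character vE \<eta> \<and> extends_central_character s scl V \<pi> \<eta>" for \<eta>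
  define L where "L \<eta> m \<longleftrightarrow> (\<exists>i\<in>{0, -1}. \<exists>x. x \<noteq> 0 \<and> level i (int m - i) \<eta> x)" for \<eta> m
  obtain m0 where m0: "fixed_level m0" using fixed_level_exists by blast
  have "conductor_U11 vF vE \<iota> s p scl V \<pi> = (LEAST c. \<exists>\<eta>. ok \<eta> \<and> c = (LEAST m. L \<eta> m))"
    unfolding conductor_U11_def ok_def L_def
    by (intro arg_cong[where f = Least] ext ex_cong1) (auto simp: conductor_U11_at_eq)
  also have "\<dots> = (LEAST m. fixed_level m)"
  proof (rule Least_family[where k = m0])
    show "\<exists>m. L \<eta> m" if ok: "ok \<eta>" for \<eta>
    proof -
      obtain m x where "x \<noteq> 0" "level 0 (int m - 0) \<eta> x"
        using level_exists[of \<eta>] ok unfolding ok_def by auto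
      then show ?thesis unfolding L_def by blast
    qed
    show "fixed_level m" if "L \<eta> m" for \<eta> m
      using that unfolding L_def fixed_level_def level_def by blast
    show "\<exists>\<eta>. ok \<eta> \<and> L \<eta> m" if m: "fixed_level m" for m
    proof -
      obtain i x where i: "i \<in> {0, -1}" and x: "x \<noteq> 0" "A.fixed_nu i x" "\<forall>c\<in>F.P (int m - i). nl c x = x"
        using m unfolding fixed_level_def by blast
      obtain \<eta> y where y: "unit_character vE \<eta>" "y \<noteq> 0" "level i (int m - i) \<eta> y"
        using level_eigenvector[OF x] .
      then have "ok \<eta>" using eigen_central unfolding ok_def level_def by blast
      then show ?thesis using y i unfolding L_def by blast
    qed
  qed (rule m0)
  finally show ?thesis .
qed

lemma conductor_level: "fixed_level (conductor_U11 vF vE \<iota> s p scl V \<pi>)"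
  unfolding conductor_U11_eq using fixed_level_exists by (rule LeastI_ex)

lemma conductor_le: "fixed_level m \<Longrightarrow> conductor_U11 vF vE \<iota> s p scl V \<pi> \<le> m"
  unfolding conductor_U11_eq by (rule Least_le)

end

section \<open>Restriction to \<open>SL\<^sub>2\<close>\<close>

locale cuspidal_constituent = cuspidal_U11 vF vE \<iota> s p scl V \<pi>
  for vF :: "'f::field \<Rightarrow> int" and vE :: "'e::field \<Rightarrow> int" and \<iota> s p
    and scl :: "complex \<Rightarrow> 'v \<Rightarrow> 'v::ab_group_add" and V \<pi> +
  fixes W :: "'v set"
  assumes W_V: "W \<subseteq> V"
    and W_irreducible: "irreducible_representation scl W SL2 (\<lambda>g. \<pi> (map_matrix \<iota> g))"
begin

definition sg :: "'f^2^2 \<Rightarrow> 'v \<Rightarrow> 'v" where "sg g = \<pi> (map_matrix \<iota> g)"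

lemma SL2_iff: "mat2 a b c d \<in> carrier SL2 \<longleftrightarrow> a * d - b * c = 1"
  by (simp add: SL2_def matrix_group_def det_mat2)

lemma sg_mat2: "sg (mat2 a b c d) = \<pi> (mat2 (\<iota> a) (\<iota> b) (\<iota> c) (\<iota> d))"
  by (simp add: sg_def map_matrix_mat2)

lemma sg_U11:
  assumes "g \<in> carrier SL2" shows "map_matrix \<iota> g \<in> carrier (U11 s)"
proof -
  obtain a b c d where g: "g = mat2 a b c d" by (rule mat2_cases)
  show ?thesis using assms U11_emb unfolding g map_matrix_mat2 SL2_iff by blast
qed

lemma sg_endo: "g \<in> carrier SL2 \<Longrightarrow> linear_endo scl V (sg g)"
  unfolding sg_def using sg_U11 by (rule act_endo)

lemma nu_sg: "nu b = sg (mat2 1 b 0 1)" and nl_sg: "nl c = sg (mat2 1 0 c 1)"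
  by (simp_all add: nu_def nl_def sg_mat2 emb_one)

lemma tt_sg: "tt (\<iota> d) = sg (mat2 (inverse d) 0 0 d)"
  by (simp add: tt_def sg_mat2 aut_emb emb_inverse)

lemma subspace_W: "subspace W"
  using W_irreducible by (simp add: irreducible_representation_def Defs.representation_def)

lemma W_sg: "g \<in> carrier SL2 \<Longrightarrow> x \<in> W \<Longrightarrow> sg g x \<in> W"
  using W_irreducible unfolding irreducible_representation_def Defs.representation_def sg_def by blast

lemma W_minimal:
  assumes "subspace U" "U \<subseteq> W" "\<And>g x. g \<in> carrier SL2 \<Longrightarrow> x \<in> U \<Longrightarrow> sg g x \<in> U" "x \<in> U" "x \<noteq> 0"
  shows "U = W"
  using W_irreducible assms unfolding irreducible_representation_def sg_def by blast

lemma W_nonzero: obtains x where "x \<in> W" "x \<noteq> 0"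
  using W_irreducible subspace_0[OF subspace_W] unfolding irreducible_representation_def by blast

text \<open>The diagonal torus of \<open>U(1,1)\<close> normalizes \<open>SL\<^sub>2(F)\<close>:
  conjugation scales the off-diagonal entries by the norm of \<open>t\<close> and by its
  inverse.\<close>

lemma sg_tt:
  assumes g: "g \<in> carrier SL2" and t: "t \<noteq> 0"
  obtains g' where "g' \<in> carrier SL2" "\<And>x. x \<in> V \<Longrightarrow> sg g (tt t x) = tt t (sg g' x)"
proof -
  obtain a b c d where ge: "g = mat2 a b c d" by (rule mat2_cases)
  have det: "a * d - b * c = 1" using g by (simp add: ge SL2_iff)
  define g' where "g' = mat2 a (b * nm t) (c / nm t) d"
  have g': "g' \<in> carrier SL2" using det t by (simp add: g'_def SL2_iff)
  have "mat2 (\<iota> a) (\<iota> b) (\<iota> c) (\<iota> d) ** mat2 (inverse (s t)) 0 0 t =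
      mat2 (inverse (s t)) 0 0 t ** mat2 (\<iota> a) (\<iota> (b * nm t)) (\<iota> (c / nm t)) (\<iota> d)"
    unfolding emb_mult emb_divide emb_nm using t by (simp add: mat2_mult mat2_eq_iff field_simps)
  then have "sg g (tt t x) = tt t (sg g' x)" if "x \<in> V" for x
    using that t sg_U11[OF g] sg_U11[OF g']
    by (simp add: sg_mat2 ge g'_def tt_def map_matrix_mat2 act_act)
  then show ?thesis using that g' by blast
qed

section \<open>Finite sums of torus translates of the constituent\<close>

definition torus_sum :: "'e set \<Rightarrow> 'v set" where
  "torus_sum S = {x. \<exists>w. (\<forall>t. w t \<in> W) \<and> x = (\<Sum>t\<in>S. tt t (w t))}"

lemma torus_sumI: "(\<And>t. w t \<in> W) \<Longrightarrow> (\<Sum>t\<in>S. tt t (w t)) \<in> torus_sum S"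
  by (auto simp: torus_sum_def)

lemma torus_sum_V:
  assumes "S \<subseteq> int_units vE" shows "torus_sum S \<subseteq> V"
  using assms W_V E.unit_nonzero by (auto simp: torus_sum_def intro!: V_sum tt_V)

lemma subspace_torus_sum:
  assumes S: "S \<subseteq> int_units vE"
  shows "subspace (torus_sum S)"
proof (rule subspaceI)
  have S0: "t \<noteq> 0" if "t \<in> S" for t using that S E.unit_nonzero by blast
  have "(\<Sum>t\<in>S. tt t 0) = 0" using endo_zero[OF tt_endo[OF S0]] by simp
  then show "0 \<in> torus_sum S"
    using torus_sumI[of "\<lambda>_. 0" S] subspace_0[OF subspace_W] by simp
  fix x assume "x \<in> torus_sum S"
  then obtain u where u: "\<And>t. u t \<in> W" "x = (\<Sum>t\<in>S. tt t (u t))" by (auto simp: torus_sum_def)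
  have uV: "u t \<in> V" for t using u(1) W_V by blast
  {
    fix y assume "y \<in> torus_sum S"
    then obtain w where w: "\<And>t. w t \<in> W" "y = (\<Sum>t\<in>S. tt t (w t))" by (auto simp: torus_sum_def)
    have wV: "w t \<in> V" for t using w(1) W_V by blast
    have "x + y = (\<Sum>t\<in>S. tt t (u t + w t))"
      unfolding u(2) w(2) using linear_endoD(2)[OF tt_endo[OF S0] uV wV] by (simp flip: sum.distrib)
    then show "x + y \<in> torus_sum S"
      using torus_sumI[of "\<lambda>t. u t + w t" S] u(1) w(1) subspace_add[OF subspace_W] by simp
  }
  fix a
  have "scl a x = (\<Sum>t\<in>S. tt t (scl a (u t)))"
    unfolding u(2) using tt_scl[OF S0 uV] by (simp add: scale_sum_right)
  then show "scl a x \<in> torus_sum S"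
    using torus_sumI[of "\<lambda>t. scl a (u t)" S] u(1) subspace_scale[OF subspace_W] by simp
qed

lemma torus_sum_mono:
  assumes "finite S'" "S \<subseteq> S'" "S' \<subseteq> int_units vE"
  shows "torus_sum S \<subseteq> torus_sum S'"
proof
  fix x assume "x \<in> torus_sum S"
  then obtain u where u: "\<And>t. u t \<in> W" "x = (\<Sum>t\<in>S. tt t (u t))" by (auto simp: torus_sum_def)
  let ?u = "\<lambda>t. if t \<in> S then u t else 0"
  have "(\<Sum>t\<in>S'. tt t (?u t)) = (\<Sum>t\<in>S. tt t (?u t))"
    using assms endo_zero[OF tt_endo] E.unit_nonzero
    by (intro sum.mono_neutral_right) auto
  also have "\<dots> = x" unfolding u(2) by (intro sum.cong) auto
  finally show "x \<in> torus_sum S'"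
    using torus_sumI[of ?u S'] u(1) subspace_0[OF subspace_W] by force
qed

lemma torus_sum_sg:
  assumes S: "S \<subseteq> int_units vE" and g: "g \<in> carrier SL2" and x: "x \<in> torus_sum S"
  shows "sg g x \<in> torus_sum S"
proof -
  obtain u where u: "\<And>t. u t \<in> W" "x = (\<Sum>t\<in>S. tt t (u t))" using x by (auto simp: torus_sum_def)
  have uV: "u t \<in> V" for t using u(1) W_V by blast
  have S0: "t \<noteq> 0" if "t \<in> S" for t using that S E.unit_nonzero by blast
  have "\<exists>w. w \<in> W \<and> (t \<in> S \<longrightarrow> sg g (tt t (u t)) = tt t w)" for t
  proof (cases "t \<in> S")
    case True
    obtain g' where "g' \<in> carrier SL2" "\<And>x. x \<in> V \<Longrightarrow> sg g (tt t x) = tt t (sg g' x)"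
      using sg_tt[OF g S0[OF True]] by blast
    then show ?thesis using uV W_sg u(1) by blast
  qed (use u(1) in auto)
  then obtain w where w: "\<And>t. w t \<in> W" "\<And>t. t \<in> S \<Longrightarrow> sg g (tt t (u t)) = tt t (w t)" by metis
  have "sg g x = (\<Sum>t\<in>S. sg g (tt t (u t)))"
    unfolding u(2) by (rule endo_sum[OF sg_endo[OF g]]) (use uV S0 in simp)
  also have "\<dots> = (\<Sum>t\<in>S. tt t (w t))" using w(2) by simp
  finally show ?thesis using torus_sumI w(1) by simp
qed

text \<open>The union \<open>M\<close> of these sums is stable under \<open>SL\<^sub>2(F)\<close>
  and under units of the torus. The extension being unramified, every torus element is a unit times
  an element of \<open>F\<close>, and the latter belongs to \<open>SL\<^sub>2(F)\<close>. With the
  big cell this makes \<open>M\<close> stable under the whole group, and irreducibility gives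
  \<open>V\<close>.\<close>

lemma torus_sum_total:
  assumes x: "x \<in> V"
  shows "\<exists>S. finite S \<and> S \<subseteq> int_units vE \<and> x \<in> torus_sum S"
proof -
  define M where "M = {x. \<exists>S. finite S \<and> S \<subseteq> int_units vE \<and> x \<in> torus_sum S}"
  have MV: "M \<subseteq> V" using torus_sum_V by (auto simp: M_def)
  have "subspace M"
  proof (rule subspaceI)
    show "0 \<in> M" using subspace_0[OF subspace_torus_sum[of "{}"]] by (auto simp: M_def)
    fix x assume "x \<in> M"
    then obtain S where S: "finite S" "S \<subseteq> int_units vE" "x \<in> torus_sum S" by (auto simp: M_def)
    show "scl a x \<in> M" for a
      using S subspace_scale[OF subspace_torus_sum] by (auto simp: M_def)
    fix y assume "y \<in> M"
    then obtain T where T: "finite T" "T \<subseteq> int_units vE" "y \<in> torus_sum T" by (auto simp: M_def)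
    have U: "finite (S \<union> T)" "S \<union> T \<subseteq> int_units vE" using S T by auto
    have "x \<in> torus_sum (S \<union> T)" "y \<in> torus_sum (S \<union> T)"
      using torus_sum_mono[OF U(1) _ U(2)] S(3) T(3) by blast+
    then have "x + y \<in> torus_sum (S \<union> T)" using subspace_add[OF subspace_torus_sum[OF U(2)]] by blast
    then show "x + y \<in> M" using U by (auto simp: M_def)
  qed
  moreover have sgM: "sg g x \<in> M" if "g \<in> carrier SL2" "x \<in> M" for g x
    using that torus_sum_sg unfolding M_def by blast
  have ttM: "tt d x \<in> M" if d: "d \<noteq> 0" and x: "x \<in> M" for d x
  proof -
    obtain S where S: "finite S" "S \<subseteq> int_units vE" "x \<in> torus_sum S" using x by (auto simp: M_def)
    define q where "q = p powi vE d"
    have q: "q \<noteq> 0" "vF q = vE d" using p by (simp_all add: q_def F.val_power_int)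
    define u where "u = d / \<iota> q"
    have uu: "u \<in> int_units vE" using d q by (simp add: u_def int_units_def E.val_divide val_emb)
    then have u0: "u \<noteq> 0" by (rule E.unit_nonzero)
    have due: "d = \<iota> q * u" using q by (simp add: u_def)
    obtain w where w: "\<And>t. w t \<in> W" "x = (\<Sum>t\<in>S. tt t (w t))" using S(3) by (auto simp: torus_sum_def)
    have wV: "w t \<in> V" for t using w(1) W_V by blast
    have S0: "t \<noteq> 0" if "t \<in> S" for t using that S E.unit_nonzero by blast
    have "tt u x = (\<Sum>t\<in>S. tt u (tt t (w t)))"
      unfolding w(2) by (rule endo_sum[OF tt_endo[OF u0]]) (use wV S0 in simp)
    also have "\<dots> = (\<Sum>t\<in>S. tt (u * t) (w t))" using tt_mult[OF u0 S0 wV] by simp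
    also have "\<dots> = (\<Sum>t\<in>(*) u ` S. tt t (w (t / u)))"
      using u0 by (subst sum.reindex) (auto simp: inj_on_def)
    also have "\<dots> \<in> torus_sum ((*) u ` S)" by (rule torus_sumI) (rule w(1))
    finally have "tt u x \<in> torus_sum ((*) u ` S)" .
    moreover have "(*) u ` S \<subseteq> int_units vE" using S(2) uu E.unit_mult by blast
    ultimately have "tt u x \<in> M" using S(1) by (auto simp: M_def)
    moreover have "mat2 (inverse q) 0 0 q \<in> carrier SL2" using q by (simp add: SL2_iff)
    ultimately have "tt (\<iota> q) (tt u x) \<in> M" using sgM by (simp add: tt_sg)
    moreover have "x \<in> V" using x MV by blast
    ultimately show ?thesis using tt_mult[of "\<iota> q" u x] q u0 by (simp add: due)
  qed
  have nuM: "nu b x \<in> M" and nlM: "nl c x \<in> M" if "x \<in> M" for b c x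
    using that sgM by (simp_all add: nu_sg nl_sg SL2_iff)
  have big: "\<pi> (mat2 a b c d) x \<in> M" if g: "mat2 a b c d \<in> carrier (U11 s)" and d: "d \<noteq> 0" and x: "x \<in> M" for a b c d x
  proof -
    obtain b' c' where e: "mat2 a b c d = mat2 1 (\<iota> b') 0 1 ** mat2 (inverse (s d)) 0 0 d ** mat2 1 0 (\<iota> c') 1"
      using U11_big_cell[OF g d] by blast
    have "x \<in> V" using x MV by blast
    then have "\<pi> (mat2 a b c d) x = nu b' (tt d (nl c' x))"
      using d by (simp add: e nu_def tt_def nl_def act_act U11_mult_in matrix_mul_assoc)
    then show ?thesis using nuM nlM ttM x d by simp
  qed
  have "\<pi> g x \<in> M" if g: "g \<in> carrier (U11 s)" and x: "x \<in> M" for g x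
  proof -
    obtain a b c d where ge: "g = mat2 a b c d" by (rule mat2_cases)
    show ?thesis
    proof (cases "d = 0")
      case False
      then show ?thesis using big g x ge by blast
    next
      case True
      have xV: "x \<in> V" using x MV by blast
      \<comment> \<open>Off the big cell \<open>d\<close> is zero and \<open>c\<close> is not, so an
        upper unipotent on the right makes the lower right entry nonzero.\<close>
      have "c \<noteq> 0" using g True by (auto simp: ge U11_mat2)
      moreover have gu: "mat2 a b c d ** mat2 1 (\<iota> 1) 0 1 \<in> carrier (U11 s)"
        using g ge by (intro U11_mult_in) simp_all
      ultimately have "\<pi> (mat2 a b c d ** mat2 1 (\<iota> 1) 0 1) (nu (-1) x) \<in> M"
        using nuM[OF x] big[of a "a + b" c "c + d"] True by (simp add: mat2_mult emb_one)
      moreover have "mat2 a b c d ** mat2 1 (\<iota> 1) 0 1 ** mat2 1 (\<iota> (-1)) 0 1 = mat2 a b c d"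
        by (simp add: mat2_mult emb_one)
      ultimately show ?thesis
        using act_act[OF gu U11_upper[of "-1"] xV] by (simp add: nu_def ge)
    qed
  qed
  moreover obtain w where w: "w \<in> W" "w \<noteq> 0" by (rule W_nonzero)
  have "tt 1 w \<in> torus_sum {1}" using torus_sumI[of "\<lambda>_. w" "{1}"] w by simp
  then have "w \<in> M" using tt_one[of w] w W_V by (auto simp: M_def intro!: exI[of _ "{1}"])
  ultimately have "M = V"
    using irreducible w(2) MV unfolding irreducible_representation_def by blast
  then show ?thesis using x by (auto simp: M_def)
qed

text \<open>A finite sum of translates of \<open>W\<close> of minimal length containing \<open>x\<close> admits an equivariant
  projection to any of its members.\<close>

lemma constituent_type:
  assumes x: "A.torus_type i j 0 \<eta> x" "x \<noteq> 0"
  shows "\<exists>y\<in>W. y \<noteq> 0 \<and> A.torus_type i j 0 \<eta> y"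
proof -
  have main: "\<exists>y\<in>W. y \<noteq> 0 \<and> A.torus_type i j 0 \<eta> y"
    if "finite S" "S \<subseteq> int_units vE" "x \<in> torus_sum S" for S
    using that
  proof (induction S rule: finite_induct)
    case empty
    then show ?case using x(2) by (auto simp: torus_sum_def)
  next
    case (insert t S)
    have S: "S \<subseteq> int_units vE" and t: "t \<in> int_units vE" using insert.prems by auto
    then have t0: "t \<noteq> 0" using E.unit_nonzero by blast
    obtain w where w: "\<And>r. w r \<in> W" "x = (\<Sum>r\<in>insert t S. tt r (w r))"
      using insert.prems(2) by (auto simp: torus_sum_def)
    define r where "r = (\<Sum>r\<in>S. tt r (w r))"
    have r: "r \<in> torus_sum S" unfolding r_def using w(1) by (rule torus_sumI)
    have xe: "x = tt t (w t) + r" using insert.hyps w(2) by (simp add: r_def)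
    have wV: "w t \<in> V" using w(1) W_V by blast
    have rV: "r \<in> V" using r torus_sum_V[OF S] by blast
    have sub: "subspace (torus_sum S)" by (rule subspace_torus_sum[OF S])
    \<comment> \<open>\<open>U\<close> measures the overlap of the translate by \<open>t\<close>
      with the remaining ones. It is stable under \<open>SL\<^sub>2(F)\<close>, so it is
      \<open>W\<close> or zero. In the first case \<open>t\<close> is redundant; in the second the
      component \<open>w t\<close> is unique and inherits the eigenvalue relations of
      \<open>x\<close>.\<close>
    define U where "U = {u \<in> W. tt t u \<in> torus_sum S}"
    show ?case
    proof (cases "\<exists>u\<in>U. u \<noteq> 0")
      case True
      have "subspace U"
        using subspace_W sub W_V linear_endoD(2,3)[OF tt_endo[OF t0]] endo_zero[OF tt_endo[OF t0]]
        unfolding U_def subspace_def by (auto simp: subset_iff)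
      moreover have "sg g u \<in> U" if g: "g \<in> carrier SL2" and u: "u \<in> U" for g u
      proof -
        have uV: "u \<in> V" using u W_V by (auto simp: U_def)
        obtain a b c d where ge: "g = mat2 a b c d" by (rule mat2_cases)
        have ti: "inverse t \<noteq> 0" using t0 by simp
        obtain g' where g': "g' \<in> carrier SL2" "\<And>x. x \<in> V \<Longrightarrow> sg g (tt (inverse t) x) = tt (inverse t) (sg g' x)"
          using sg_tt[OF g ti] by blast
        have ttu: "tt t u \<in> V" using uV t0 by simp
        have u_eq: "tt (inverse t) (tt t u) = u" using tt_mult[OF ti t0 uV] uV t0 by (simp add: tt_one)
        have sgV: "sg g' (tt t u) \<in> V" using linear_endoD(1)[OF sg_endo[OF g'(1)] ttu] .
        have "tt t (sg g u) = tt t (tt (inverse t) (sg g' (tt t u)))" using g'(2)[OF ttu] u_eq by simp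
        also have "\<dots> = sg g' (tt t u)" using tt_mult[OF t0 ti sgV] sgV t0 by (simp add: tt_one)
        finally show ?thesis
          using u g W_sg torus_sum_sg[OF S g'(1)] by (simp add: U_def)
      qed
      moreover have "U \<subseteq> W" by (auto simp: U_def)
      ultimately have "U = W" using True W_minimal[of U] by blast
      then have "tt t (w t) \<in> torus_sum S" using w(1) by (auto simp: U_def)
      then have "x \<in> torus_sum S" using r subspace_add[OF sub] xe by blast
      then show ?thesis using insert.IH S by blast
    next
      case False
      have proj: "sg g (w t) = scl a (w t)"
        if g: "g \<in> carrier SL2" "g' \<in> carrier SL2" and gg: "sg g' (tt t (w t)) = tt t (sg g (w t))"
          and a: "sg g' x = scl a x" for g g' a
      proof -
        have ttw: "tt t (w t) \<in> V" using t0 wV by simp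
        have "sg g (w t) - scl a (w t) \<in> W"
          using W_sg[OF g(1) w(1)] subspace_diff[OF subspace_W] subspace_scale[OF subspace_W] w(1) by blast
        moreover have "tt t (sg g (w t) - scl a (w t)) = scl a r - sg g' r"
        proof -
          have "sg g (w t) \<in> V" using W_sg[OF g(1) w(1)] W_V by blast
          then have "tt t (sg g (w t) - scl a (w t)) = sg g' (tt t (w t)) - scl a (tt t (w t))"
            using endo_diff[OF tt_endo[OF t0]] wV tt_scl[OF t0 wV] gg by simp
          moreover have "sg g' (tt t (w t)) + sg g' r = scl a (tt t (w t)) + scl a r"
            using linear_endoD(2)[OF sg_endo[OF g(2)] ttw rV] a unfolding xe by (simp add: scale_right_distrib)
          moreover have "X = D - C" if "X = A - B" "A + C = B + D" for X A B C D :: 'v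
          proof -
            have "X + C = A + C - B" using that(1) by simp
            then show ?thesis using that(2) by (simp add: eq_diff_eq)
          qed
          ultimately show ?thesis by blast
        qed
        moreover have "scl a r - sg g' r \<in> torus_sum S"
          using torus_sum_sg[OF S g(2) r] subspace_scale[OF sub r] subspace_diff[OF sub] by blast
        ultimately have "sg g (w t) - scl a (w t) \<in> U" by (simp add: U_def)
        then show ?thesis using False by auto
      qed
      show ?thesis
      proof (cases "w t = 0")
        case True
        then have "x \<in> torus_sum S" using xe r endo_zero[OF tt_endo[OF t0]] by simp
        then show ?thesis using insert.IH S by blast
      next
        case wne: False
        have nt: "nm t \<in> int_units vF" "nm t \<noteq> 0" using nm_unit[OF t] F.unit_nonzero by blast+
        have "A.torus_type i j 0 \<eta> (w t)"
          unfolding A.torus_type_def A.fixed_nu_def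
        proof (intro conjI ballI)
          fix b assume b: "b \<in> F.P i"
          have "nu (b / nm t) x = x" using A.typeD(3)[OF x(1)] b F.P_unit_divide[OF nt(1)] by blast
          then have "sg (mat2 1 b 0 1) (w t) = scl 1 (w t)"
            using tt_nu[OF t0 wV, of b]
            by (intro proj[of _ "mat2 1 (b / nm t) 0 1"]) (simp_all add: SL2_iff flip: nu_sg)
          then show "nu b (w t) = w t" by (simp add: nu_sg)
        next
          fix c assume c: "c \<in> F.P j"
          have "nl (c * nm t) x = x"
            using A.typeD(4)[OF x(1)] c F.P_unit_mult[OF nt(1)] by (simp add: mult.commute)
          then have "sg (mat2 1 0 c 1) (w t) = scl 1 (w t)"
            using tt_nl[OF t0 wV, of c]
            by (intro proj[of _ "mat2 1 0 (c * nm t) 1"]) (simp_all add: SL2_iff flip: nl_sg)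
          then show "nl c (w t) = w t" by (simp add: nl_sg)
        next
          fix d assume d: "d \<in> unit_filtration vF 0"
          then have d0: "d \<noteq> 0" by (simp add: unit_filtration_def int_units_def)
          then have d1: "\<iota> d \<noteq> 0" by simp
          have "sg (mat2 (inverse d) 0 0 d) (w t) = scl (\<eta> d) (w t)"
          proof (rule proj[of _ "mat2 (inverse d) 0 0 d"])
            show "sg (mat2 (inverse d) 0 0 d) x = scl (\<eta> d) x"
              using A.typeD(5)[OF x(1) d] by (simp add: tt_sg)
            show "sg (mat2 (inverse d) 0 0 d) (tt t (w t)) = tt t (sg (mat2 (inverse d) 0 0 d) (w t))"
              using tt_commute[OF d1 t0 wV] by (simp add: tt_sg)
          qed (use d0 in \<open>simp_all add: SL2_iff\<close>)
          then show "tt (\<iota> d) (w t) = scl (\<eta> d) (w t)" by (simp add: tt_sg)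
        qed (rule wV)
        then show ?thesis using wne w(1) by blast
      qed
    qed
  qed
  obtain S where "finite S" "S \<subseteq> int_units vE" "x \<in> torus_sum S"
    using torus_sum_total[OF A.typeD(1)[OF x(1)]] by blast
  then show ?thesis by (rule main)
qed

section \<open>Congruence subgroups acting on the constituent\<close>

lemma K_SL2_mat2: "mat2 a b c d \<in> K_SL2 vF m \<longleftrightarrow> a * d - b * c = 1 \<and>
    a \<in> F.P 0 \<and> b \<in> F.P 0 \<and> c \<in> F.P 0 \<and> d \<in> F.P 0 \<and> (m = 0 \<or> c \<in> F.P (int m))"
  by (simp add: K_SL2_def SL2_integers_def det_mat2 int_matrix_iff)

lemma conductor_trivial:
  assumes "unit_character vF \<eta>" "u \<in> unit_filtration vF (character_conductor vF \<eta>)"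
  shows "\<eta> u = 1"
proof -
  have "\<exists>n. \<forall>u\<in>unit_filtration vF n. \<eta> u = 1" using assms(1) by (simp add: unit_character_def)
  then have "\<forall>u\<in>unit_filtration vF (character_conductor vF \<eta>). \<eta> u = 1"
    unfolding character_conductor_def by (rule LeastI_ex)
  then show ?thesis using assms(2) by blast
qed

text \<open>A nonzero vector of torus type has level \<open>m\<close> at least 2, and its character
  is trivial at depth \<open>m\<close>. So the special clauses for \<open>m = 0\<close> and for
  \<open>m\<close> below the conductor of \<open>\<eta>\<close> cannot exclude it.\<close>

lemma K_SL2_space_ne:
  assumes \<phi>: "shift id q \<phi>" "vF q = i" and \<eta>: "unit_character vF \<eta>"
  shows "K_SL2_space vF scl W (\<lambda>g. \<pi> (map_matrix \<iota> g)) \<phi> \<eta> m \<noteq> {0} \<longleftrightarrow>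
    (\<exists>x\<in>W. x \<noteq> 0 \<and> A.torus_type i (int m - i) 0 \<eta> x)"
proof -
  let ?S = "K_SL2_space vF scl W (\<lambda>g. \<pi> (map_matrix \<iota> g)) \<phi> \<eta> m"
  define e where "e g = (if m = 0 then 1 else \<eta> (g $ 2 $ 2))" for g :: "'f^2^2"
  have q: "q \<noteq> 0" using \<phi>(1) by (simp add: shift_def)
  have \<phi>_eq: "\<phi> (mat2 a b c d) = mat2 a (b * q) (c / q) d" for a b c d
    using \<phi>(1) by (simp add: shift_def)
  have \<eta>1: "\<eta> 1 = 1"
    using \<eta> unfolding unit_character_def by (metis F.unit_one mult_cancel_right1 mult_1)
  have \<eta>_mult: "\<And>x y. x \<in> int_units vF \<Longrightarrow> y \<in> int_units vF \<Longrightarrow> \<eta> (x * y) = \<eta> x * \<eta> y"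
    using \<eta> by (simp add: unit_character_def)
  show ?thesis
  proof
    assume ne: "?S \<noteq> {0}"
    then have m: "\<not> m < character_conductor vF \<eta>" by (auto simp: K_SL2_space_def)
    have S: "x \<in> ?S \<longleftrightarrow> x \<in> W \<and> (\<forall>g\<in>K_SL2 vF m. sg (\<phi> g) x = scl (e g) x)" for x
      using m by (simp add: K_SL2_space_def sg_def e_def)
    have "0 \<in> ?S"
    proof -
      have "sg (\<phi> g) 0 = 0" if g: "g \<in> K_SL2 vF m" for g
      proof -
        obtain a b c d where ge: "g = mat2 a b c d" by (rule mat2_cases)
        have "\<phi> g \<in> carrier SL2" using g q by (simp add: ge K_SL2_mat2 SL2_iff \<phi>_eq)
        then show ?thesis using endo_zero[OF sg_endo] by blast
      qed
      then show ?thesis unfolding S using subspace_0[OF subspace_W] by simp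
    qed
    then obtain x where x: "x \<in> ?S" "x \<noteq> 0" using ne by blast
    have act: "sg (\<phi> g) x = scl (e g) x" if "g \<in> K_SL2 vF m" for g using x(1) that S by blast
    have xW: "x \<in> W" using x(1) S by blast
    have "A.torus_type i (int m - i) 0 \<eta> x"
      unfolding A.torus_type_def A.fixed_nu_def
    proof (intro conjI ballI)
      show "x \<in> V" using xW W_V by blast
    next
      fix b assume "b \<in> F.P i"
      then have "b / q \<in> F.P 0" using P_shift[OF q \<phi>(2)] by simp
      then have "mat2 1 (b / q) 0 1 \<in> K_SL2 vF m" by (simp add: K_SL2_mat2 F.one_in_P)
      from act[OF this] show "nu b x = x" using q \<eta>1 by (simp add: \<phi>_eq nu_sg e_def)
    next
      fix c assume "c \<in> F.P (int m - i)"
      then have c: "c * q \<in> F.P (int m)" using P_shift[OF q \<phi>(2)] by simp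
      then have "c * q \<in> F.P 0" by (rule F.P_mono) simp
      then have "mat2 1 0 (c * q) 1 \<in> K_SL2 vF m" using c by (simp add: K_SL2_mat2 F.one_in_P)
      from act[OF this] show "nl c x = x" using q \<eta>1 by (simp add: \<phi>_eq nl_sg e_def)
    next
      fix d assume "d \<in> unit_filtration vF 0"
      then have d: "d \<in> int_units vF" by (simp add: unit_filtration_def)
      have "mat2 (inverse d) 0 0 d \<in> K_SL2 vF m"
        using F.unit_P[OF d] F.unit_P[OF F.unit_inverse[OF d]] F.unit_nonzero[OF d]
        by (simp add: K_SL2_mat2)
      from act[OF this] have "tt (\<iota> d) x = scl (e (mat2 (inverse d) 0 0 d)) x"
        by (simp add: \<phi>_eq tt_sg)
      moreover have "\<eta> d = 1" if "m = 0"
        using conductor_trivial[OF \<eta>, of d] m that d by (simp add: unit_filtration_def)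
      ultimately show "tt (\<iota> d) x = scl (\<eta> d) x" by (simp add: e_def split: if_splits)
    qed
    then show "\<exists>x\<in>W. x \<noteq> 0 \<and> A.torus_type i (int m - i) 0 \<eta> x" using xW x(2) by blast
  next
    assume "\<exists>x\<in>W. x \<noteq> 0 \<and> A.torus_type i (int m - i) 0 \<eta> x"
    then obtain x where x: "x \<in> W" "x \<noteq> 0" "A.torus_type i (int m - i) 0 \<eta> x" by blast
    have xV: "x \<in> V" using x(1) W_V by blast
    have m2: "2 \<le> m" using A.type_level(1)[OF x(3,2) \<eta>_mult] by simp
    have "character_conductor vF \<eta> \<le> m"
      unfolding character_conductor_def
      using A.type_character_trivial[OF x(3,2), of m] m2 by (intro Least_le) simp
    then have S: "x \<in> ?S \<longleftrightarrow> x \<in> W \<and> (\<forall>g\<in>K_SL2 vF m. sg (\<phi> g) x = scl (\<eta> (g $ 2 $ 2)) x)"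
      using m2 by (simp add: K_SL2_space_def sg_def)
    have "sg (\<phi> g) x = scl (\<eta> (g $ 2 $ 2)) x" if g: "g \<in> K_SL2 vF m" for g
    proof -
      obtain a b c d where ge: "g = mat2 a b c d" by (rule mat2_cases)
      have k: "a * d - b * c = 1" "a \<in> F.P 0" "b \<in> F.P 0" "d \<in> F.P 0" "c \<in> F.P (int m)"
        using g m2 unfolding ge K_SL2_mat2 by auto
      have bc: "b * c \<in> F.P 1" using m2 by (intro F.P_mult_mono[OF k(3,5)]) simp
      have "a * d \<notin> F.P 1"
      proof
        assume "a * d \<in> F.P 1"
        from F.P_diff[OF this bc] show False by (simp add: k(1))
      qed
      then have "d \<notin> F.P 1" using F.P_mult_mono[OF k(2), of d 1 1] by auto
      then have d: "d \<in> int_units vF" using k(4) by (simp add: F.int_units_iff)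
      then have d0: "d \<noteq> 0" by (rule F.unit_nonzero)
      have b2: "b / d * q \<in> F.P i" using k(3) P_shift(2)[OF q \<phi>(2)] F.P_unit_divide[OF d] by simp
      have c2: "c / d / q \<in> F.P (int m - i)"
        using k(5) P_shift(1)[OF q \<phi>(2), of "c / d"] F.P_unit_divide[OF d] by simp
      have "a * d = 1 + b * c" using k(1) by (simp add: algebra_simps)
      then have a: "a = inverse d + b / d * q * d * (c / d / q)" using d0 q by (simp add: field_simps)
      have "\<phi> g = mat2 1 (b / d * q) 0 1 ** (mat2 (inverse d) 0 0 d ** mat2 1 0 (c / d / q) 1)"
        unfolding ge \<phi>_eq using d0 a by (simp add: mat2_mult mat2_eq_iff)
      moreover have "sg (g ** h) x = sg g (sg h x)" if "g \<in> carrier SL2" "h \<in> carrier SL2" "x \<in> V" for g h x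
      proof -
        have "map_matrix \<iota> (g ** h) = map_matrix \<iota> g ** map_matrix \<iota> h"
          by (simp add: vec_eq_iff map_matrix_def matrix_matrix_mult_def sum_2 emb_add emb_mult del: FE.scale_scale)
        then show ?thesis using act_act[OF sg_U11[OF that(1)] sg_U11[OF that(2)] that(3)] by (simp add: sg_def)
      qed
      moreover have "mat2 (inverse d) 0 0 d ** mat2 1 0 (c / d / q) 1 \<in> carrier SL2"
        using d0 by (simp add: mat2_mult SL2_iff)
      moreover have "mat2 1 (b / d * q) 0 1 \<in> carrier SL2" "mat2 (inverse d) 0 0 d \<in> carrier SL2"
        "mat2 1 0 (c / d / q) 1 \<in> carrier SL2"
        using d0 by (simp_all add: SL2_iff)
      ultimately have "sg (\<phi> g) x = nu (b / d * q) (tt (\<iota> d) (nl (c / d / q) x))"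
        using xV by (simp add: nu_sg tt_sg nl_sg)
      also have "\<dots> = scl (\<eta> d) x"
        using A.typeD(3,4)[OF x(3)] A.typeD(5)[OF x(3), of d] b2 c2 d xV
        by (simp add: A.nu_scl unit_filtration_def)
      finally show ?thesis by (simp add: ge)
    qed
    then show "?S \<noteq> {0}" using S x(1,2) by blast
  qed
qed

lemma conductor_SL2_at_eq:
  assumes "unit_character vF \<eta>"
  shows "conductor_SL2_at vF p scl W (\<lambda>g. \<pi> (map_matrix \<iota> g)) \<eta> =
    (LEAST m. \<exists>i\<in>{0, -1}. \<exists>x\<in>W. x \<noteq> 0 \<and> A.torus_type i (int m - i) 0 \<eta> x)"
proof -
  have v: "vF 1 = 0" "vF (inverse p) = -1" using p by (simp_all add: F.val_inverse)
  show ?thesis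
    unfolding conductor_SL2_at_def
    using K_SL2_space_ne[OF shift_id(2) v(1) assms] K_SL2_space_ne[OF shift_alpha(2) v(2) assms] by simp
qed

lemma sg_minus_one: "\<pi> (map_matrix \<iota> (mat (-1))) = tt (-1)"
  using mat_tt[of "-1"] by (simp add: mat_eq_mat2 map_matrix_mat2 emb_one)

text \<open>The character \<open>\<eta>\<close> is not extended to \<open>E\<close>: the torus
  argument is run with \<open>H\<close> the units of \<open>F\<close>, where the elements of norm
  one are 1 and -1. Compatibility with the center is thus the given condition at -1.\<close>

lemma type_exists:
  assumes \<eta>: "unit_character vF \<eta>" and c: "\<And>x. x \<in> W \<Longrightarrow> tt (-1) x = scl (\<eta> (-1)) x"
  shows "\<exists>m. \<exists>x\<in>W. x \<noteq> 0 \<and> A.torus_type 0 (int m) 0 \<eta> x"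
proof -
  obtain \<eta>0 where \<eta>0: "unit_character vE \<eta>0" "extends_central_character s scl V \<pi> \<eta>0"
    using central_character .
  obtain w where w: "w \<in> W" "w \<noteq> 0" by (rule W_nonzero)
  have wV: "w \<in> V" using w(1) W_V by blast
  have m1: "(-1) * s (-1) = 1" by simp
  have "scl (\<eta> (-1)) w = scl (\<eta>0 (-1)) w"
    using trans[OF c[OF w(1), symmetric] central_tt[OF \<eta>0(2) m1 wV]] .
  then have e: "\<eta>0 (-1) = \<eta> (-1)" using w(2) by simp
  define \<eta>' where "\<eta>' h = \<eta> (inv_into UNIV \<iota> h)" for h
  have "inj \<iota>" by (rule injI) simp
  then have \<eta>': "\<eta>' (\<iota> u) = \<eta> u" for u by (simp add: \<eta>'_def)
  interpret torus_character vF vE \<iota> s p scl V \<pi> "\<iota> ` int_units vF" \<eta>'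
  proof unfold_locales
    show "\<iota> ` int_units vF \<subseteq> int_units vE" using emb_unit by blast
    show "g * h \<in> \<iota> ` int_units vF" if "g \<in> \<iota> ` int_units vF" "h \<in> \<iota> ` int_units vF" for g h
      using that F.unit_mult by (auto simp flip: emb_mult)
    show "inverse h \<in> \<iota> ` int_units vF" if "h \<in> \<iota> ` int_units vF" for h
      using that F.unit_inverse by (auto simp flip: emb_inverse)
    show "\<eta>' (g * h) = \<eta>' g * \<eta>' h" if "g \<in> \<iota> ` int_units vF" "h \<in> \<iota> ` int_units vF" for g h
      using that \<eta> by (auto simp: \<eta>' unit_character_def simp flip: emb_mult)
    show "\<eta>' h \<noteq> 0" if "h \<in> \<iota> ` int_units vF" for h
      using that \<eta> by (auto simp: \<eta>' unit_character_def)
    obtain n where "\<forall>x\<in>unit_filtration vF n. \<eta> x = 1" using \<eta> by (auto simp: unit_character_def)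
    then show "\<exists>n. \<forall>h\<in>\<iota> ` int_units vF. h - 1 \<in> E.P n \<longrightarrow> \<eta>' h = 1"
      by (intro exI[of _ "int n"]) (simp add: F.unit_filtration_iff \<eta>' emb_one_P)
    show "tt h x = scl (\<eta>' h) x" if h: "h \<in> \<iota> ` int_units vF" "h * s h = 1" and x: "x \<in> V" for h x
    proof -
      obtain u where u: "h = \<iota> u" using h(1) by blast
      have "\<iota> (u * u) = \<iota> 1" using h(2) by (simp only: u aut_emb emb_mult emb_one)
      then have "u * u = 1" by (simp only: emb_eq_iff)
      then have "(u - 1) * (u + 1) = 0" by (simp add: algebra_simps)
      then have "u = 1 \<or> u = -1" by (simp add: eq_neg_iff_add_eq_0)
      then show ?thesis
      proof
        assume "u = 1"
        moreover have "\<eta> 1 = 1" using \<eta> unfolding unit_character_def by (metis F.unit_one mult_cancel_right1 mult_1)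
        ultimately show ?thesis using x \<eta>'[of 1] by (simp add: u emb_one tt_one)
      next
        assume "u = -1"
        then show ?thesis using central_tt[OF \<eta>0(2) m1 x] e \<eta>'[of "-1"] by (simp add: u emb_one)
      qed
    qed
  qed simp
  obtain m x where "x \<noteq> 0" "A.fixed_nu 0 x" "\<forall>c\<in>F.P (int m). nl c x = x" "eigen (\<iota> ` int_units vF) \<eta>' x"
    using character_level .
  then have "A.torus_type 0 (int m) 0 \<eta> x"
    by (simp add: A.torus_type_def eigen_def \<eta>' unit_filtration_def)
  then show ?thesis using constituent_type \<open>x \<noteq> 0\<close> by blast
qed

text \<open>Vectors of \<open>W\<close> are vectors of \<open>V\<close>; conversely
  \<open>constituent_type\<close> carries a vector of \<open>V\<close> into \<open>W\<close> with
  the same \<open>i\<close>, \<open>j\<close> and character of the units of \<open>F\<close>. So the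
  least level is the one found for \<open>U(1,1)\<close>.\<close>

theorem conductor_SL2_eq:
  "conductor_SL2 vF p scl W (\<lambda>g. \<pi> (map_matrix \<iota> g)) = (LEAST m. fixed_level m)"
proof -
  define ok where "ok \<eta> \<longleftrightarrow> unit_character vF \<eta> \<and> (\<forall>x\<in>W. tt (-1) x = scl (\<eta> (-1)) x)" for \<eta>
  define L where "L \<eta> m \<longleftrightarrow> (\<exists>i\<in>{0, -1}. \<exists>x\<in>W. x \<noteq> 0 \<and> A.torus_type i (int m - i) 0 \<eta> x)" for \<eta> m
  obtain m0 where m0: "fixed_level m0" using fixed_level_exists by blast
  have "conductor_SL2 vF p scl W (\<lambda>g. \<pi> (map_matrix \<iota> g)) = (LEAST c. \<exists>\<eta>. ok \<eta> \<and> c = (LEAST m. L \<eta> m))"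
    unfolding conductor_SL2_def ok_def L_def sg_minus_one
    by (intro arg_cong[where f = Least] ext ex_cong1) (auto simp: conductor_SL2_at_eq)
  also have "\<dots> = (LEAST m. fixed_level m)"
  proof (rule Least_family[where k = m0])
    show "\<exists>m. L \<eta> m" if ok: "ok \<eta>" for \<eta>
    proof -
      obtain m x where "x \<in> W" "x \<noteq> 0" "A.torus_type 0 (int m - 0) 0 \<eta> x"
        using type_exists[of \<eta>] ok unfolding ok_def by auto
      then show ?thesis unfolding L_def by blast
    qed
    show "fixed_level m" if "L \<eta> m" for \<eta> m
      using that unfolding L_def fixed_level_def A.torus_type_def by blast
    show "\<exists>\<eta>. ok \<eta> \<and> L \<eta> m" if m: "fixed_level m" for m
    proof -
      obtain i x where i: "i \<in> {0, -1}" and x: "x \<noteq> 0" "A.fixed_nu i x" "\<forall>c\<in>F.P (int m - i). nl c x = x"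
        using m unfolding fixed_level_def by blast
      obtain \<eta> y where y: "unit_character vE \<eta>" "y \<noteq> 0" "level i (int m - i) \<eta> y"
        using level_eigenvector[OF x] .
      have "extends_central_character s scl V \<pi> \<eta>" using eigen_central y unfolding level_def by blast
      then have "tt (-1) x = scl (\<eta> (\<iota> (-1))) x" if "x \<in> W" for x
        using central_tt[of \<eta> "-1" x] that W_V by (auto simp: emb_one)
      then have "ok (\<lambda>u. \<eta> (\<iota> u))" unfolding ok_def using unit_character_emb[OF y(1)] by blast
      moreover have "L (\<lambda>u. \<eta> (\<iota> u)) m"
        unfolding L_def using constituent_type[OF level_type[OF y(3)] y(2)] i by blast
      ultimately show ?thesis by blast
    qed
  qed (rule m0)
  finally show ?thesis .
qed

end

section \<open>The minimal depth\<close>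

lemma (in nonarch_local_field) ex_bound:
  "\<exists>M\<ge>0. a \<in> P (- M) \<and> b \<in> P (- M) \<and> c \<in> P (- M) \<and> d \<in> P (- M)"
  by (intro exI[of _ "\<bar>v a\<bar> + \<bar>v b\<bar> + \<bar>v c\<bar> + \<bar>v d\<bar>"]) (auto simp: in_P)

lemma (in unramified_quadratic_extension) U11_det:
  assumes "g \<in> carrier (U11 s)" shows "det g * s (det g) = 1"
proof -
  obtain a b c d where g: "g = mat2 a b c d" by (rule mat2_cases)
  have "det (map_matrix s g ** mat2 0 1 (-1) 0 ** transpose g) = det (mat2 0 1 (-1) 0 :: 'e^2^2)"
    using assms by (simp add: U11_carrier)
  then have "det (map_matrix s g) * det g = 1"
    by (simp add: det_mul det_mat2)
  then show ?thesis by (simp add: g map_matrix_mat2 det_mat2 aut_diff aut_mult mult.commute)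
qed

context cuspidal_U11
begin

section \<open>Characters of the unitary group and twisted invariants\<close>

abbreviation is_char :: "('e^2^2 \<Rightarrow> complex) \<Rightarrow> bool" where
  "is_char \<theta> \<equiv> group_character vE (U11 s) \<theta>"

lemma is_char_mult: "is_char \<theta> \<Longrightarrow> g \<in> carrier (U11 s) \<Longrightarrow> h \<in> carrier (U11 s) \<Longrightarrow> \<theta> (g ** h) = \<theta> g * \<theta> h"
  by (simp add: group_character_def)

lemma is_char_nonzero: "is_char \<theta> \<Longrightarrow> g \<in> carrier (U11 s) \<Longrightarrow> \<theta> g \<noteq> 0"
  by (simp add: group_character_def)

lemma is_char_one: "is_char \<theta> \<Longrightarrow> \<theta> (mat 1) = 1"
  using is_char_mult[of \<theta> "mat 1" "mat 1"] is_char_nonzero[of \<theta> "mat 1"] U11_mat[of 1] by simp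

text \<open>Unipotents are commutators with a torus element.\<close>

lemma char_unipotent:
  assumes \<theta>: "is_char \<theta>"
  shows "\<theta> (mat2 1 (\<iota> b) 0 1) = 1" "\<theta> (mat2 1 0 (\<iota> c) 1) = 1"
proof -
  define T where "T = mat2 (inverse (s (\<iota> p))) 0 0 (\<iota> p)"
  have T: "T \<in> carrier (U11 s)" unfolding T_def using p(1) by (intro U11_diag) simp
  have pp: "vF (p * p) = 2" using p by (simp add: F.val_mult)
  have one: "1 - p * p \<noteq> 0"
  proof
    assume "1 - p * p = 0"
    then have "p * p = 1" by simp
    then show False using pp by simp
  qed
  have cancel: "\<theta> (g ** h) = 1"
    if "g \<in> carrier (U11 s)" "h \<in> carrier (U11 s)" "h' \<in> carrier (U11 s)" "g ** h' = mat 1"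
      "T ** h = h' ** T" for g h h'
  proof -
    have "\<theta> T * \<theta> h = \<theta> (T ** h)" by (rule is_char_mult[OF \<theta> T that(2), symmetric])
    also have "\<dots> = \<theta> (h' ** T)" by (rule arg_cong[OF that(5)])
    also have "\<dots> = \<theta> h' * \<theta> T" by (rule is_char_mult[OF \<theta> that(3) T])
    finally have "\<theta> T * \<theta> h = \<theta> T * \<theta> h'" by (simp only: mult.commute)
    then have "\<theta> h = \<theta> h'" using is_char_nonzero[OF \<theta> T] by simp
    then have "\<theta> (g ** h) = \<theta> (g ** h')"
      using is_char_mult[OF \<theta> that(1,2)] is_char_mult[OF \<theta> that(1,3)] by simp
    then show ?thesis using is_char_one[OF \<theta>] that(4) by simp
  qed
  have p0: "\<iota> p \<noteq> 0" using p by simp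
  have sum: "mat2 1 (\<iota> x) 0 1 ** mat2 1 (\<iota> y) 0 1 = mat2 1 (\<iota> (x + y)) 0 1"
    "mat2 1 0 (\<iota> x) 1 ** mat2 1 0 (\<iota> y) 1 = mat2 1 0 (\<iota> (x + y)) 1" for x y
    by (simp_all add: mat2_mult emb_add add.commute)
  have zero: "mat2 1 (\<iota> 0) 0 1 = mat 1" "mat2 1 0 (\<iota> 0) 1 = mat 1" by (simp_all add: mat_eq_mat2)
  \<comment> \<open>\<open>T\<close> divides the upper coordinate by the norm \<open>p * p\<close>,
    so \<open>\<theta>\<close> agrees at the coordinates \<open>z\<close> and
    \<open>z * (p * p)\<close>. The value of \<open>z\<close> makes their difference equal to
    \<open>b\<close>.\<close>
  define z where "z = b / (p * p - 1)"
  have "z * (p * p - 1) = b" using one by (simp add: z_def)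
  then have z: "- z + z * (p * p) = b" by (simp add: right_diff_distrib)
  have "T ** mat2 1 (\<iota> (z * (p * p))) 0 1 = mat2 1 (\<iota> z) 0 1 ** T"
    unfolding T_def diag_upper[OF p0] using p(1) by simp
  from cancel[OF U11_upper[of "- z"] U11_upper U11_upper _ this]
  show "\<theta> (mat2 1 (\<iota> b) 0 1) = 1" unfolding sum z by (simp add: mat_eq_mat2)
  define y where "y = c / (1 - p * p)"
  have "y * (1 - p * p) = c" using one by (simp add: y_def)
  then have y: "- (y * (p * p)) + y = c" by (simp add: right_diff_distrib)
  have "T ** mat2 1 0 (\<iota> y) 1 = mat2 1 0 (\<iota> (y * (p * p))) 1 ** T"
    unfolding T_def diag_lower[OF p0] by simp
  from cancel[OF U11_lower[of "- (y * (p * p))"] U11_lower U11_lower _ this]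
  show "\<theta> (mat2 1 0 (\<iota> c) 1) = 1" unfolding sum y by (simp add: mat_eq_mat2)
qed

text \<open>Invariance just above depth \<open>r\<close> at the point \<open>y\<close>, tested on
  generators. Only the torus condition involves \<open>\<theta>\<close>, since characters are
  trivial on unipotents.\<close>

definition deep_fixed :: "('e^2^2 \<Rightarrow> complex) \<Rightarrow> real \<Rightarrow> real \<Rightarrow> 'v \<Rightarrow> bool" where
  "deep_fixed \<theta> y r x \<longleftrightarrow> x \<in> V \<and>
    (\<forall>b. b \<noteq> 0 \<longrightarrow> r < real_of_int (vF b) + y \<longrightarrow> nu b x = x) \<and>
    (\<forall>c. c \<noteq> 0 \<longrightarrow> r < real_of_int (vF c) - y \<longrightarrow> nl c x = x) \<and>
    (\<forall>t. t \<noteq> 0 \<longrightarrow> t \<noteq> 1 \<longrightarrow> r < real_of_int (vE (t - 1)) \<longrightarrow>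
       twist scl \<pi> \<theta> (mat2 t 0 0 (inverse (s t))) x = x)"

lemma deep_fixedD:
  assumes "deep_fixed \<theta> y r x"
  shows "x \<in> V" "\<And>b. b \<noteq> 0 \<Longrightarrow> r < real_of_int (vF b) + y \<Longrightarrow> nu b x = x"
    "\<And>c. c \<noteq> 0 \<Longrightarrow> r < real_of_int (vF c) - y \<Longrightarrow> nl c x = x"
    "\<And>t. t \<noteq> 0 \<Longrightarrow> t \<noteq> 1 \<Longrightarrow> r < real_of_int (vE (t - 1)) \<Longrightarrow>
       twist scl \<pi> \<theta> (mat2 t 0 0 (inverse (s t))) x = x"
  using assms by (simp_all add: deep_fixed_def)

lemma twist_mult:
  assumes "is_char \<theta>" "g \<in> carrier (U11 s)" "h \<in> carrier (U11 s)" "x \<in> V"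
  shows "twist scl \<pi> \<theta> (g ** h) x = twist scl \<pi> \<theta> g (twist scl \<pi> \<theta> h x)"
  using assms linear_endoD(3)[OF act_endo[OF assms(2)], of "\<pi> h x"]
  by (simp add: twist_def is_char_mult act_act)

lemma fixer_subgroup:
  assumes \<theta>: "is_char \<theta>" and x: "x \<in> V"
  shows "subgroup {h \<in> carrier (U11 s). twist scl \<pi> \<theta> h x = x} (U11 s)"
proof (rule group.subgroupI[OF U11_group])
  have one: "mat 1 \<in> {h \<in> carrier (U11 s). twist scl \<pi> \<theta> h x = x}"
    using is_char_one[OF \<theta>] act_one[OF x] U11_mat[of 1] by (simp add: twist_def)
  then show "{h \<in> carrier (U11 s). twist scl \<pi> \<theta> h x = x} \<noteq> {}" by blast
  fix g assume g: "g \<in> {h \<in> carrier (U11 s). twist scl \<pi> \<theta> h x = x}"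
  then have gc: "g \<in> carrier (U11 s)" by simp
  have "twist scl \<pi> \<theta> (matrix_inv g) x = twist scl \<pi> \<theta> (matrix_inv g) (twist scl \<pi> \<theta> g x)"
    using g by simp
  also have "\<dots> = twist scl \<pi> \<theta> (matrix_inv g ** g) x"
    using twist_mult[OF \<theta> U11_matrix_inv[OF gc] gc x] by simp
  also have "\<dots> = x" using U11_matrix_inv_mult[OF gc] one by simp
  finally show "inv\<^bsub>U11 s\<^esub> g \<in> {h \<in> carrier (U11 s). twist scl \<pi> \<theta> h x = x}"
    using U11_inv[OF gc] U11_matrix_inv[OF gc] by simp
next
  fix g h assume "g \<in> {h \<in> carrier (U11 s). twist scl \<pi> \<theta> h x = x}" "h \<in> {h \<in> carrier (U11 s). twist scl \<pi> \<theta> h x = x}"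
  then show "g \<otimes>\<^bsub>U11 s\<^esub> h \<in> {h \<in> carrier (U11 s). twist scl \<pi> \<theta> h x = x}"
    using twist_mult[OF \<theta> _ _ x] U11_mult_in by simp
qed auto

lemma twist_unipotent:
  assumes "is_char \<theta>"
  shows "twist scl \<pi> \<theta> (mat2 1 (\<iota> b) 0 1) x = nu b x" "twist scl \<pi> \<theta> (mat2 1 0 (\<iota> c) 1) x = nl c x"
  using char_unipotent[OF assms] by (simp_all add: twist_def nu_def nl_def)

text \<open>The fixer of a vector is a subgroup, so generators suffice. Conversely a generator
  strictly above \<open>r\<close> lies in the group whose index is its own depth.\<close>

lemma deep_fixed_iff:
  assumes \<theta>: "is_char \<theta>" and x: "x \<in> V"
  shows "(\<forall>h\<in>moy_prasad_plus vF vE \<iota> s y r. twist scl \<pi> \<theta> h x = x) \<longleftrightarrow> deep_fixed \<theta> y r x"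
proof
  assume h: "\<forall>h\<in>moy_prasad_plus vF vE \<iota> s y r. twist scl \<pi> \<theta> h x = x"
  show "deep_fixed \<theta> y r x"
    unfolding deep_fixed_def
  proof (intro conjI allI impI)
    show "x \<in> V" by (rule x)
  next
    fix b assume b: "b \<noteq> 0" "r < real_of_int (vF b) + y"
    have "mat2 1 (\<iota> b) 0 1 \<in> moy_prasad vF vE \<iota> s y (real_of_int (vF b) + y)"
      unfolding moy_prasad_def by (rule generate.incl) auto
    then have "mat2 1 (\<iota> b) 0 1 \<in> moy_prasad_plus vF vE \<iota> s y r"
      unfolding moy_prasad_plus_def using b(2) by blast
    then show "nu b x = x" using h twist_unipotent[OF \<theta>] by metis
  next
    fix c assume c: "c \<noteq> 0" "r < real_of_int (vF c) - y"
    have "mat2 1 0 (\<iota> c) 1 \<in> moy_prasad vF vE \<iota> s y (real_of_int (vF c) - y)"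
      unfolding moy_prasad_def by (rule generate.incl) auto
    then have "mat2 1 0 (\<iota> c) 1 \<in> moy_prasad_plus vF vE \<iota> s y r"
      unfolding moy_prasad_plus_def using c(2) by blast
    then show "nl c x = x" using h twist_unipotent[OF \<theta>] by metis
  next
    fix t assume t: "t \<noteq> 0" "t \<noteq> 1" "r < real_of_int (vE (t - 1))"
    have "mat2 t 0 0 (inverse (s t)) \<in> moy_prasad vF vE \<iota> s y (real_of_int (vE (t - 1)))"
      unfolding moy_prasad_def using t(1) by (intro generate.incl) auto
    then have "mat2 t 0 0 (inverse (s t)) \<in> moy_prasad_plus vF vE \<iota> s y r"
      unfolding moy_prasad_plus_def using t(3) by blast
    then show "twist scl \<pi> \<theta> (mat2 t 0 0 (inverse (s t))) x = x" using h by blast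
  qed
next
  assume d: "deep_fixed \<theta> y r x"
  let ?S = "{h \<in> carrier (U11 s). twist scl \<pi> \<theta> h x = x}"
  have one: "twist scl \<pi> \<theta> (mat2 1 0 0 1) x = x"
    using twist_unipotent(1)[OF \<theta>, of 0] A.nu_zero[OF x] by simp
  have "moy_prasad vF vE \<iota> s y r' \<subseteq> ?S" if r: "r < r'" for r'
    unfolding moy_prasad_def
  proof (rule group.generate_subgroup_incl[OF U11_group _ fixer_subgroup[OF \<theta> x]], intro Un_least subsetI)
    fix g assume "g \<in> {mat2 t 0 0 (inverse (s t)) |t. t = 1 \<or> t \<noteq> 0 \<and> r' \<le> real_of_int (vE (t - 1))}"
    then obtain t where t: "g = mat2 t 0 0 (inverse (s t))" "t = 1 \<or> t \<noteq> 0 \<and> r' \<le> real_of_int (vE (t - 1))" by blast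
    then have t0: "t \<noteq> 0" by auto
    have "twist scl \<pi> \<theta> g x = x"
    proof (cases "t = 1")
      case False
      then have "r < real_of_int (vE (t - 1))" using t(2) r by simp
      then show ?thesis using deep_fixedD(4)[OF d t0 False] t(1) by simp
    qed (use one t(1) in simp)
    then show "g \<in> ?S" using t0 t(1) by simp
  next
    fix g assume "g \<in> {mat2 1 (\<iota> b) 0 1 |b. b = 0 \<or> r' \<le> real_of_int (vF b) + y}"
    then obtain b where b: "g = mat2 1 (\<iota> b) 0 1" "b = 0 \<or> r' \<le> real_of_int (vF b) + y" by blast
    have "nu b x = x"
    proof (cases "b = 0")
      case False
      then have "r < real_of_int (vF b) + y" using b(2) r by simp
      then show ?thesis using deep_fixedD(2)[OF d False] by simp
    qed (simp add: A.nu_zero x)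
    then show "g \<in> ?S" using twist_unipotent[OF \<theta>] b(1) by simp
  next
    fix g assume "g \<in> {mat2 1 0 (\<iota> c) 1 |c. c = 0 \<or> r' \<le> real_of_int (vF c) - y}"
    then obtain c where c: "g = mat2 1 0 (\<iota> c) 1" "c = 0 \<or> r' \<le> real_of_int (vF c) - y" by blast
    have "nl c x = x"
    proof (cases "c = 0")
      case False
      then have "r < real_of_int (vF c) - y" using c(2) r by simp
      then show ?thesis using deep_fixedD(3)[OF d False] by simp
    qed (simp add: A.nl_zero x)
    then show "g \<in> ?S" using twist_unipotent[OF \<theta>] c(1) by simp
  qed
  then show "\<forall>h\<in>moy_prasad_plus vF vE \<iota> s y r. twist scl \<pi> \<theta> h x = x"
    unfolding moy_prasad_plus_def by blast
qed

lemma moy_prasad_carrier: "moy_prasad_plus vF vE \<iota> s y r \<subseteq> carrier (U11 s)"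
  unfolding moy_prasad_plus_def moy_prasad_def
  using U11_upper[of 0] by (intro UN_least group.generate_incl[OF U11_group]) auto

definition depth_set :: "('e^2^2 \<Rightarrow> complex) \<Rightarrow> real \<Rightarrow> bool" where
  "depth_set \<theta> r \<longleftrightarrow> 0 \<le> r \<and> (\<exists>y x. x \<noteq> 0 \<and> deep_fixed \<theta> y r x)"

text \<open>The translation \<open>g\<close> of the point is absorbed into the vector, which leaves
  the points of one apartment.\<close>

lemma depth_eq:
  assumes \<theta>: "is_char \<theta>"
  shows "depth vF vE \<iota> s V (twist scl \<pi> \<theta>) = (LEAST r. depth_set \<theta> r)"
  unfolding depth_def
proof (intro arg_cong[where f = Least] ext iffI)
  fix r assume "depth_set \<theta> r"
  then obtain y x where r: "0 \<le> r" and x: "x \<noteq> 0" "deep_fixed \<theta> y r x" by (auto simp: depth_set_def)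
  have xV: "x \<in> V" using x(2) by (simp add: deep_fixed_def)
  have inv1: "matrix_inv (mat 1 :: 'e^2^2) = mat 1" by (rule matrix_inv_unique) simp
  have "\<forall>h\<in>moy_prasad_plus vF vE \<iota> s y r. twist scl \<pi> \<theta> (mat 1 ** h ** matrix_inv (mat 1)) x = x"
    using deep_fixed_iff[OF \<theta> xV] x(2) by (simp add: inv1)
  moreover have "mat 1 \<in> carrier (U11 s)" using U11_mat[of 1] by simp
  ultimately show "0 \<le> r \<and> (\<exists>g\<in>carrier (U11 s). \<exists>y. \<exists>x\<in>V. x \<noteq> 0 \<and>
        (\<forall>h\<in>moy_prasad_plus vF vE \<iota> s y r. twist scl \<pi> \<theta> (g ** h ** matrix_inv g) x = x))"
    using r x(1) xV by blast
next
  fix r assume "0 \<le> r \<and> (\<exists>g\<in>carrier (U11 s). \<exists>y. \<exists>x\<in>V. x \<noteq> 0 \<and>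
        (\<forall>h\<in>moy_prasad_plus vF vE \<iota> s y r. twist scl \<pi> \<theta> (g ** h ** matrix_inv g) x = x))"
  then obtain g y x where r: "0 \<le> r" and g: "g \<in> carrier (U11 s)" and x: "x \<in> V" "x \<noteq> 0"
    and h: "\<And>h. h \<in> moy_prasad_plus vF vE \<iota> s y r \<Longrightarrow> twist scl \<pi> \<theta> (g ** h ** matrix_inv g) x = x" by blast
  let ?g = "matrix_inv g"
  let ?z = "twist scl \<pi> \<theta> ?g x"
  have gi: "?g \<in> carrier (U11 s)" using g by (rule U11_matrix_inv)
  have zV: "?z \<in> V" using gi x(1) by (simp add: twist_def)
  have z0: "?z \<noteq> 0" using act_eq_0[OF gi x(1)] x(2) is_char_nonzero[OF \<theta> gi] by (auto simp: twist_def)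
  have "twist scl \<pi> \<theta> k ?z = ?z" if k: "k \<in> moy_prasad_plus vF vE \<iota> s y r" for k
  proof -
    have kc: "k \<in> carrier (U11 s)" using k moy_prasad_carrier by blast
    have gk: "g ** k ** ?g \<in> carrier (U11 s)" using g kc gi by (intro U11_mult_in)
    have "?g ** (g ** k ** ?g) = k ** ?g"
      using U11_matrix_inv_mult[OF g] by (simp add: matrix_mul_assoc)
    then have "twist scl \<pi> \<theta> k ?z = twist scl \<pi> \<theta> ?g (twist scl \<pi> \<theta> (g ** k ** ?g) x)"
      using twist_mult[OF \<theta> kc gi x(1)] twist_mult[OF \<theta> gi gk x(1)] by simp
    then show ?thesis using h[OF k] by simp
  qed
  then have "deep_fixed \<theta> y r ?z" using deep_fixed_iff[OF \<theta> zV] by blast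
  then show "depth_set \<theta> r" using r z0 unfolding depth_set_def by blast
qed

text \<open>Only the integers exceeding \<open>r\<close>, \<open>r - y\<close> and \<open>r + y\<close> matter, so jumps occur at half integers.\<close>

lemma depth_set_half:
  assumes "depth_set \<theta> r"
  shows "depth_set \<theta> (real_of_int \<lfloor>2 * r\<rfloor> / 2)"
proof -
  obtain y x where r: "0 \<le> r" and x: "x \<noteq> 0" "deep_fixed \<theta> y r x"
    using assms by (auto simp: depth_set_def)
  define k where "k = \<lfloor>2 * r\<rfloor>"
  define I where "I = \<lfloor>r - y\<rfloor>"
  \<comment> \<open>The point is moved so that \<open>k / 2 - y'\<close> is the integer
    \<open>I\<close> and \<open>k / 2 + y'\<close> is \<open>k - I\<close>. From
    \<open>I \<le> r - y\<close> one gets \<open>r + y < k - I + 1\<close>, so integers beyond the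
    new thresholds exceed the old ones.\<close>
  define y' where "y' = real_of_int k / 2 - real_of_int I"
  have k: "2 * r < real_of_int k + 1" unfolding k_def by linarith
  have I: "r - y < real_of_int I + 1" "real_of_int I \<le> r - y" unfolding I_def by linarith+
  have 1: "r < real_of_int n" if "real_of_int k / 2 < real_of_int n" for n :: int
  proof -
    have "k + 1 \<le> 2 * n" using that by linarith
    then have "real_of_int k + 1 \<le> 2 * real_of_int n" by linarith
    then show ?thesis using k by linarith
  qed
  have 2: "r < real_of_int n + y" if "real_of_int k / 2 < real_of_int n + y'" for n :: int
  proof -
    have "I + 1 \<le> n" using that unfolding y'_def by linarith
    then have "real_of_int I + 1 \<le> real_of_int n" by linarith
    then show ?thesis using I by linarith
  qed
  have 3: "r < real_of_int n - y" if "real_of_int k / 2 < real_of_int n - y'" for n :: int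
  proof -
    have "k - I + 1 \<le> n" using that unfolding y'_def by linarith
    then have "real_of_int k - real_of_int I + 1 \<le> real_of_int n" by linarith
    then show ?thesis using I k by linarith
  qed
  have "deep_fixed \<theta> y' (real_of_int k / 2) x"
    unfolding deep_fixed_def by (intro conjI allI impI deep_fixedD[OF x(2)] 1 2 3)
  moreover have "0 \<le> k" unfolding k_def using r by simp
  ultimately show ?thesis using x(1) unfolding depth_set_def k_def[symmetric] by auto
qed

lemma depth_set_nonempty:
  assumes \<theta>: "is_char \<theta>"
  shows "\<exists>r. depth_set \<theta> r"
proof -
  obtain x where x: "x \<in> V" "x \<noteq> 0" by (rule V_nonzero)
  obtain n where n: "0 < n" "\<And>a b c d. mat2 a b c d \<in> carrier (U11 s) \<Longrightarrow> a - 1 \<in> E.P n \<Longrightarrow> b \<in> E.P n \<Longrightarrow>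
      c \<in> E.P n \<Longrightarrow> d - 1 \<in> E.P n \<Longrightarrow> \<pi> (mat2 a b c d) x = x"
    using smooth[OF x(1)] by blast
  have "open_in_group vE (U11 s) {g \<in> carrier (U11 s). \<theta> g = 1}"
    using \<theta> by (simp add: group_character_def)
  moreover have "mat 1 \<in> {g \<in> carrier (U11 s). \<theta> g = 1}"
    using is_char_one[OF \<theta>] U11_mat[of 1] by simp
  ultimately obtain m where m: "\<And>h. h \<in> carrier (U11 s) \<Longrightarrow>
      \<forall>i j. h $ i $ j - mat 1 $ i $ j \<in> E.P m \<Longrightarrow> h \<in> {g \<in> carrier (U11 s). \<theta> g = 1}"
    unfolding open_in_group_def by blast
  define k where "k = max n m"
  have "deep_fixed \<theta> 0 (real_of_int k) x"
    unfolding deep_fixed_def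
  proof (intro conjI allI impI)
    fix b assume "b \<noteq> 0" "real_of_int k < real_of_int (vF b) + 0"
    then have "\<iota> b \<in> E.P n" by (simp add: emb_P F.in_P k_def)
    then show "nu b x = x" unfolding nu_def by (intro n(2)) simp_all
  next
    fix c assume "c \<noteq> 0" "real_of_int k < real_of_int (vF c) - 0"
    then have "\<iota> c \<in> E.P n" by (simp add: emb_P F.in_P k_def)
    then show "nl c x = x" unfolding nl_def by (intro n(2)) simp_all
  next
    fix t assume t: "t \<noteq> 0" "t \<noteq> 1" "real_of_int k < real_of_int (vE (t - 1))"
    then have tP: "t - 1 \<in> E.P k" by (simp add: E.in_P)
    have k0: "0 < k" using n(1) by (simp add: k_def)
    have iP: "inverse (s t) - 1 \<in> E.P k" using E.one_inverse[of "s t" k] tP k0 by simp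
    have T: "mat2 t 0 0 (inverse (s t)) \<in> carrier (U11 s)" using t(1) by simp
    have "\<pi> (mat2 t 0 0 (inverse (s t))) x = x"
      using E.P_mono[OF tP, of n] E.P_mono[OF iP, of n] by (intro n(2) T) (simp_all add: k_def)
    moreover have "\<theta> (mat2 t 0 0 (inverse (s t))) = 1"
      using m[OF T] E.P_mono[OF tP, of m] E.P_mono[OF iP, of m] by (simp add: forall_2 mat_eq_mat2 k_def)
    ultimately show "twist scl \<pi> \<theta> (mat2 t 0 0 (inverse (s t))) x = x" by (simp add: twist_def)
  qed (rule x(1))
  moreover have "0 \<le> real_of_int k" using n(1) by (simp add: k_def)
  ultimately show ?thesis using x(2) unfolding depth_set_def by blast
qed

text \<open>A set of reals need not have a least element. Here rounding \<open>2 * r\<close> down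
  stays in the set, so the minimum is half of a least natural number.\<close>

lemma depth_least:
  assumes \<theta>: "is_char \<theta>"
  shows "depth_set \<theta> (depth vF vE \<iota> s V (twist scl \<pi> \<theta>))"
    and "depth_set \<theta> r \<Longrightarrow> depth vF vE \<iota> s V (twist scl \<pi> \<theta>) \<le> r"
proof -
  define Q where "Q k \<longleftrightarrow> depth_set \<theta> (real k / 2)" for k :: nat
  have half: "Q (nat \<lfloor>2 * r\<rfloor>) \<and> real (nat \<lfloor>2 * r\<rfloor>) / 2 \<le> r" if "depth_set \<theta> r" for r
  proof -
    have "0 \<le> r" using that by (simp add: depth_set_def)
    then have "real (nat \<lfloor>2 * r\<rfloor>) = real_of_int \<lfloor>2 * r\<rfloor>" by simp
    moreover from this have "real (nat \<lfloor>2 * r\<rfloor>) / 2 \<le> r" by linarith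
    ultimately show ?thesis using depth_set_half[OF that] unfolding Q_def by simp
  qed
  obtain r0 where "depth_set \<theta> r0" using depth_set_nonempty[OF \<theta>] by blast
  then have "Q (nat \<lfloor>2 * r0\<rfloor>)" using half by blast
  then have Q: "Q (LEAST k. Q k)" by (rule LeastI)
  have le: "real (LEAST k. Q k) / 2 \<le> r" if "depth_set \<theta> r" for r
  proof -
    have "(LEAST k. Q k) \<le> nat \<lfloor>2 * r\<rfloor>" using half[OF that] by (intro Least_le) blast
    then have "real (LEAST k. Q k) \<le> real (nat \<lfloor>2 * r\<rfloor>)" by (rule of_nat_mono)
    then show ?thesis using half[OF that] by linarith
  qed
  have e: "depth vF vE \<iota> s V (twist scl \<pi> \<theta>) = real (LEAST k. Q k) / 2"
    unfolding depth_eq[OF \<theta>] by (rule Least_equality) (use Q le in \<open>auto simp: Q_def\<close>)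
  show "depth_set \<theta> (depth vF vE \<iota> s V (twist scl \<pi> \<theta>))" using Q unfolding e Q_def .
  show "depth vF vE \<iota> s V (twist scl \<pi> \<theta>) \<le> r" if "depth_set \<theta> r" using le[OF that] unfolding e .
qed

text \<open>The integers above \<open>r - y\<close> and \<open>r + y\<close> start at
  \<open>i0\<close> and \<open>j\<close>, and \<open>i0 + j\<close> is at most
  \<open>\<lfloor>2 * r\<rfloor> + 2\<close>. The two strict inequalities are the origin of the 2 in
  the formula.\<close>

lemma conductor_le_depth:
  assumes "depth_set \<theta> r"
  shows "(real (conductor_U11 vF vE \<iota> s p scl V \<pi>) - 2) / 2 \<le> r"
proof -
  obtain y x where r: "0 \<le> r" and x: "x \<noteq> 0" "deep_fixed \<theta> y r x"
    using assms by (auto simp: depth_set_def)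
  have xV: "x \<in> V" using x(2) by (simp add: deep_fixed_def)
  define i0 where "i0 = \<lfloor>r - y\<rfloor> + 1"
  define j where "j = \<lfloor>r + y\<rfloor> + 1"
  define m where "m = nat (\<lfloor>2 * r\<rfloor> + 2)"
  have m: "int m = \<lfloor>2 * r\<rfloor> + 2" using r by (simp add: m_def)
  have ij: "i0 + j \<le> int m" unfolding m i0_def j_def by linarith
  have fnu: "nu b x = x" if "b \<in> F.P i0" for b
  proof (cases "b = 0")
    case False
    then have "i0 \<le> vF b" using that by (simp add: F.in_P)
    then have "r < real_of_int (vF b) + y" unfolding i0_def by linarith
    then show ?thesis using x(2) False by (simp add: deep_fixed_def)
  qed (simp add: A.nu_zero xV)
  have fnl: "nl c x = x" if "c \<in> F.P j" for c
  proof (cases "c = 0")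
    case False
    then have "j \<le> vF c" using that by (simp add: F.in_P)
    then have "r < real_of_int (vF c) - y" unfolding j_def by linarith
    then show ?thesis using x(2) False by (simp add: deep_fixed_def)
  qed (simp add: A.nl_zero xV)
  \<comment> \<open>A torus element of \<open>F\<close> shifts the upper depth by an even integer,
    so the parity of \<open>i0\<close> decides between \<open>K\<^sub>m\<close> and
    \<open>K\<^sub>m'\<close>.\<close>
  define i where "i = (if even i0 then 0 else -1 :: int)"
  define l where "l = (i0 - i) div 2"
  have l: "2 * l = i0 - i" by (auto simp: l_def i_def)
  define q where "q = p powi l"
  have q: "q \<noteq> 0" "vF q = l" using p by (simp_all add: q_def F.val_power_int)
  have q0: "\<iota> q \<noteq> 0" using q by simp
  have qq: "q * q \<noteq> 0" "vF (q * q) = i0 - i" using q l by (simp_all add: F.val_mult)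
  define z where "z = tt (\<iota> q) x"
  have zV: "z \<in> V" using q0 xV by (simp add: z_def)
  have z0: "z \<noteq> 0" using A.td_eq_0[OF q(1) xV] x(1) unfolding z_def by blast
  have "nu b z = z" if "b \<in> F.P i" for b
  proof -
    have "b * (q * q) \<in> F.P i0" using P_shift(2)[OF qq, of b i0] that by simp
    then show ?thesis using tt_nu[OF q0 xV, of "b * (q * q)"] fnu q(1) by (simp add: z_def)
  qed
  then have "A.fixed_nu i z" using zV by (simp add: A.fixed_nu_def)
  moreover have "nl c z = z" if "c \<in> F.P (int m - i)" for c
  proof -
    have "c \<in> F.P (j + (i0 - i))" using that by (rule F.P_mono) (use ij in simp)
    then have "c / (q * q) \<in> F.P j" using P_shift(1)[OF qq] by simp
    then show ?thesis using tt_nl[OF q0 xV, of "c / (q * q)"] fnl q(1) by (simp add: z_def)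
  qed
  moreover have "i \<in> {0, -1}" by (simp add: i_def)
  ultimately have "fixed_level m" unfolding fixed_level_def using z0 by blast
  then have "conductor_U11 vF vE \<iota> s p scl V \<pi> \<le> m" by (rule conductor_le)
  then have "real (conductor_U11 vF vE \<iota> s p scl V \<pi>) \<le> real_of_int (int m)" by simp
  also have "\<dots> = real_of_int \<lfloor>2 * r\<rfloor> + 2" unfolding m by simp
  also have "\<dots> \<le> 2 * r + 2" by simp
  finally show ?thesis by simp
qed

text \<open>Determinants of unitary matrices have norm one, hence are units, where
  \<open>\<eta>\<close> is multiplicative. For openness, entries in \<open>P (- M)\<close> perturbed
  by \<open>P (N + M)\<close> change the determinant by an element of \<open>P N\<close>.\<close>

lemma det_character:
  assumes \<eta>: "unit_character vE \<eta>"
  shows "is_char (\<lambda>g. \<eta> (det g) ^ k)"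
  unfolding group_character_def
proof (intro conjI ballI)
  have du: "det g \<in> int_units vE" if "g \<in> carrier (U11 s)" for g
    using norm_one_unit[OF U11_det[OF that]] .
  show "\<eta> (det g) ^ k \<noteq> 0" if "g \<in> carrier (U11 s)" for g
    using \<eta> du[OF that] by (simp add: unit_character_def)
  show "\<eta> (det (g \<otimes>\<^bsub>U11 s\<^esub> h)) ^ k = \<eta> (det g) ^ k * \<eta> (det h) ^ k"
    if "g \<in> carrier (U11 s)" "h \<in> carrier (U11 s)" for g h
    using \<eta> du that by (simp add: unit_character_def det_mul power_mult_distrib)
  obtain N where N: "\<forall>x\<in>unit_filtration vE N. \<eta> x = 1" using \<eta> by (auto simp: unit_character_def)
  show "open_in_group vE (U11 s) {g \<in> carrier (U11 s). \<eta> (det g) ^ k = 1}"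
    unfolding open_in_group_def
  proof (intro conjI ballI)
    fix g assume "g \<in> {g \<in> carrier (U11 s). \<eta> (det g) ^ k = 1}"
    then have g: "g \<in> carrier (U11 s)" "\<eta> (det g) ^ k = 1" by simp_all
    obtain a b c d where ge: "g = mat2 a b c d" by (rule mat2_cases)
    obtain M where M: "0 \<le> M" "a \<in> E.P (- M)" "b \<in> E.P (- M)" "c \<in> E.P (- M)" "d \<in> E.P (- M)"
      using E.ex_bound by blast
    have "h \<in> {g \<in> carrier (U11 s). \<eta> (det g) ^ k = 1}"
      if h: "h \<in> carrier (U11 s)" "\<forall>i j. h $ i $ j - g $ i $ j \<in> E.P (int N + M)" for h
    proof -
      obtain a' b' c' d' where he: "h = mat2 a' b' c' d'" by (rule mat2_cases)
      have D: "a' - a \<in> E.P (int N + M)" "b' - b \<in> E.P (int N + M)" "c' - c \<in> E.P (int N + M)" "d' - d \<in> E.P (int N + M)"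
        using h(2) by (simp_all add: forall_2 ge he)
      have "a' - a \<in> E.P (- M)" "b' - b \<in> E.P (- M)"
        using E.P_mono[OF D(1), of "- M"] E.P_mono[OF D(2), of "- M"] M(1) by simp_all
      then have "a' - a + a \<in> E.P (- M)" "b' - b + b \<in> E.P (- M)"
        using E.P_add M(2,3) by blast+
      then have M': "a' \<in> E.P (- M)" "b' \<in> E.P (- M)" by simp_all
      have "det h - det g = (a' * (d' - d) + (a' - a) * d) - (b' * (c' - c) + (b' - b) * c)"
        by (simp add: ge he det_mat2 algebra_simps)
      also have "\<dots> \<in> E.P (int N)"
        using D M M' by (intro E.P_diff E.P_add) (rule E.P_mult_mono, assumption, assumption, simp)+
      finally have dd: "det h - det g \<in> E.P (int N)" .
      have dg: "det g \<noteq> 0" using E.unit_nonzero[OF du[OF g(1)]] .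
      have "det h / det g - 1 = (det h - det g) / det g" using dg by (simp add: diff_divide_distrib)
      then have "det h / det g \<in> unit_filtration vE N"
        using dd E.P_unit_divide[OF du[OF g(1)]] E.unit_divide[OF du[OF h(1)] du[OF g(1)]]
        by (simp add: E.unit_filtration_iff)
      then have "\<eta> (det h / det g) = 1" using N by blast
      moreover have "\<eta> (det g * (det h / det g)) = \<eta> (det g) * \<eta> (det h / det g)"
        using \<eta> du[OF g(1)] E.unit_divide[OF du[OF h(1)] du[OF g(1)]] unfolding unit_character_def by blast
      ultimately show ?thesis using g h(1) dg by simp
    qed
    then show "\<exists>n. \<forall>h\<in>carrier (U11 s). (\<forall>i j. h $ i $ j - g $ i $ j \<in> E.P n) \<longrightarrow>
        h \<in> {g \<in> carrier (U11 s). \<eta> (det g) ^ k = 1}" by blast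
  qed auto
qed

text \<open>A twist by a character of the determinant makes the central character trivial on one-units:
  \<open>E\<^sup>1 \<inter> (1 + P)\<close> modulo a deep subgroup has odd exponent \<open>2k + 1\<close>, a power of the residue
  characteristic, so \<open>\<eta>(e) \<eta>(e\<^sup>2)\<^sup>k = 1\<close>.\<close>

lemma depth_le_conductor:
  "\<exists>\<theta>. is_char \<theta> \<and> depth_set \<theta> ((real (conductor_U11 vF vE \<iota> s p scl V \<pi>) - 2) / 2)"
proof -
  define c where "c = conductor_U11 vF vE \<iota> s p scl V \<pi>"
  obtain i x where x: "x \<noteq> 0" "A.fixed_nu i x" "\<forall>b\<in>F.P (int c - i). nl b x = x"
    using conductor_level unfolding fixed_level_def c_def by blast
  obtain \<eta> z where z: "unit_character vE \<eta>" "z \<noteq> 0" "level i (int c - i) \<eta> z"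
    using level_eigenvector[OF x] .
  have zV: "z \<in> V" using z(3) by (simp add: level_def A.fixed_nu_def)
  have c2: "2 \<le> c" using level_bound(1)[OF z(1,3,2)] by simp
  have triv: "\<eta> (\<iota> u) = 1" if "u \<in> unit_filtration vF (c div 2)" for u
    using level_bound(2)[OF z(1,3,2)] that by simp
  have \<eta>_mult: "\<eta> (a * b) = \<eta> a * \<eta> b" if "a \<in> int_units vE" "b \<in> int_units vE" for a b
    using z(1) that by (simp add: unit_character_def)
  have \<eta>_power: "\<eta> (a ^ l) = \<eta> a ^ l" if "a \<in> int_units vE" for a l
  proof (induction l)
    case 0
    have "\<eta> 1 \<noteq> 0" using z(1) by (simp add: unit_character_def)
    then show ?case using \<eta>_mult[of 1 1] by simp
  next
    case (Suc l)
    then show ?case using \<eta>_mult[OF that E.unit_power[OF that]] by simp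
  qed
  obtain N where N: "\<forall>x\<in>unit_filtration vE N. \<eta> x = 1" using z(1) by (auto simp: unit_character_def)
  define Q where "Q = residue_char vF ^ N"
  have "odd Q" using odd_residue_char by (simp add: Q_def)
  then obtain k where k: "Q = 2 * k + 1" by (elim oddE)
  have "\<iota> (of_nat n) = of_nat n" for n by (induction n) (simp_all add: emb_add emb_one)
  then have q: "of_nat (residue_char vF) \<in> E.P 1"
    using F.residue_char_in emb_P[of "of_nat (residue_char vF)" 1] by simp
  define \<theta> where "\<theta> g = \<eta> (det g) ^ k" for g :: "'e^2^2"
  have \<theta>: "is_char \<theta>" unfolding \<theta>_def by (rule det_character[OF z(1)])
  have central: "\<eta> e * \<eta> (e * e) ^ k = 1" if e: "e - 1 \<in> E.P 1" for e
  proof -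
    have eu: "e \<in> int_units vE" using E.one_unit[OF e] by simp
    have "e ^ Q - 1 \<in> E.P (int N)"
      using E.one_unit_power[OF q e, of N] unfolding Q_def by (rule E.P_mono) simp
    then have "\<eta> (e ^ Q) = 1" using N E.unit_power[OF eu] by (simp add: E.unit_filtration_iff)
    then have "\<eta> e ^ (2 * k + 1) = 1" unfolding \<eta>_power[OF eu] k .
    then show ?thesis using \<eta>_mult[OF eu eu] by (simp add: power_mult power2_eq_square)
  qed
  \<comment> \<open>The point is chosen so that \<open>?r - ?y = i - 1\<close> and
    \<open>?r + ?y = c - i - 1\<close>; the unipotents strictly beyond these thresholds are exactly
    those known to fix \<open>z\<close>.\<close>
  let ?r = "(real c - 2) / 2" and ?y = "real c / 2 - real_of_int i"
  have "deep_fixed \<theta> ?y ?r z"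
    unfolding deep_fixed_def
  proof (intro conjI allI impI)
    fix b assume "b \<noteq> 0" "?r < real_of_int (vF b) + ?y"
    then have "real_of_int (i - 1) < real_of_int (vF b)" by (simp add: diff_divide_distrib)
    then have "i - 1 < vF b" by (simp only: of_int_less_iff)
    then show "nu b z = z" using z(3) by (simp add: level_def A.fixed_nu_def F.in_P)
  next
    fix b assume "b \<noteq> 0" "?r < real_of_int (vF b) - ?y"
    then have "real_of_int (int c - i - 1) < real_of_int (vF b)" by (simp add: diff_divide_distrib)
    then have "int c - i - 1 < vF b" by (simp only: of_int_less_iff)
    then show "nl b z = z" using z(3) by (simp add: level_def F.in_P)
  next
    fix t assume t: "t \<noteq> 0" "t \<noteq> 1" "?r < real_of_int (vE (t - 1))"
    let ?n = "int (c div 2)"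
    have n0: "0 < ?n" using c2 by simp
    have "real_of_int (int c - 2) < real_of_int (2 * vE (t - 1))" using t(3) by simp
    then have "int c - 2 < 2 * vE (t - 1)" by (simp only: of_int_less_iff)
    \<comment> \<open>For either parity of \<open>c\<close>, an integer above
      \<open>(c - 2) / 2\<close> is at least \<open>c div 2\<close>, the depth at which
      \<open>\<eta>\<close> is known to be trivial on \<open>F\<close>.\<close>
    then have "?n \<le> vE (t - 1)" by linarith
    then have tP: "t - 1 \<in> E.P ?n" by (simp add: E.in_P)
    define d where "d = inverse (s t)"
    have dP: "d - 1 \<in> E.P ?n" using E.one_inverse[of "s t" ?n] tP n0 by (simp add: d_def)
    have du: "d \<in> int_units vE" using E.one_unit[OF dP n0] .
    then have d0: "d \<noteq> 0" by (rule E.unit_nonzero)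
    have td: "t = inverse (s d)" by (simp add: d_def aut_inverse)
    have "nm d - 1 \<in> F.P ?n" using dP n0 by (intro nm_one_P) simp_all
    then obtain u e where ue: "d = \<iota> u * e" "u - 1 \<in> F.P ?n" "e * s e = 1"
      using norm_one_factor n0 by blast
    have uu: "u \<in> int_units vF" using F.one_unit[OF ue(2) n0] .
    have uE: "\<iota> u \<in> int_units vE" using uu emb_unit by blast
    have u0: "\<iota> u \<noteq> 0" using E.unit_nonzero[OF uE] .
    have eu: "e \<in> int_units vE" using norm_one_unit[OF ue(3)] .
    have e0: "e \<noteq> 0" using E.unit_nonzero[OF eu] .
    have "e = d * inverse (\<iota> u)" using u0 by (simp add: ue(1))
    moreover have "inverse (\<iota> u) - 1 \<in> E.P ?n"
      using E.one_inverse[of "\<iota> u" ?n] ue(2) n0 by (simp add: emb_one_P)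
    ultimately have "e - 1 \<in> E.P ?n" using E.one_mult[OF dP] n0 by simp
    then have e1: "e - 1 \<in> E.P 1" by (rule E.P_mono) (use n0 in simp)
    have "\<eta> (\<iota> u) = 1" using uu ue(2) by (intro triv) (simp add: F.unit_filtration_iff)
    then have "\<eta> d = \<eta> e" using \<eta>_mult[OF uE eu] by (simp add: ue(1))
    then have pi: "\<pi> (mat2 t 0 0 (inverse (s t))) z = scl (\<eta> e) z"
      using z(3) du unfolding td d_def[symmetric] level_def eigen_def by (simp add: tt_def aut_inverse)
    have se: "s e = inverse e" using ue(3) by (metis inverse_unique)
    \<comment> \<open>The factor \<open>\<iota> u\<close> cancels in the determinant, which sees
      only the central part \<open>e\<close>, and that through its square.\<close>
    have "det (mat2 t 0 0 (inverse (s t))) = inverse (s d) * d" by (simp add: det_mat2 td aut_inverse)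
    also have "\<dots> = e * e" using u0 e0 by (simp add: ue(1) aut_mult aut_emb se)
    finally have "\<theta> (mat2 t 0 0 (inverse (s t))) = \<eta> (e * e) ^ k" by (simp add: \<theta>_def)
    then show "twist scl \<pi> \<theta> (mat2 t 0 0 (inverse (s t))) z = z"
      using central[OF e1] pi by (simp add: twist_def mult.commute)
  qed (rule zV)
  then have "depth_set \<theta> ?r" unfolding depth_set_def using z(2) c2 by auto
  then show ?thesis using \<theta> unfolding c_def by blast
qed

text \<open>The lower bound holds for every twist, since unipotent invariance does not see a
  character; a single twist attains it.\<close>

theorem minimal_depth_eq:
  "minimal_depth vF vE \<iota> s scl V \<pi> = (real (conductor_U11 vF vE \<iota> s p scl V \<pi>) - 2) / 2"
  unfolding minimal_depth_def
proof (rule Least_equality)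
  obtain \<theta> where \<theta>: "is_char \<theta>" "depth_set \<theta> ((real (conductor_U11 vF vE \<iota> s p scl V \<pi>) - 2) / 2)"
    using depth_le_conductor by blast
  have "(real (conductor_U11 vF vE \<iota> s p scl V \<pi>) - 2) / 2 = depth vF vE \<iota> s V (twist scl \<pi> \<theta>)"
    using depth_least(2)[OF \<theta>] conductor_le_depth[OF depth_least(1)[OF \<theta>(1)]] by simp
  then show "\<exists>\<theta>. is_char \<theta> \<and> (real (conductor_U11 vF vE \<iota> s p scl V \<pi>) - 2) / 2 = depth vF vE \<iota> s V (twist scl \<pi> \<theta>)"
    using \<theta>(1) by blast
next
  fix r assume "\<exists>\<theta>. is_char \<theta> \<and> r = depth vF vE \<iota> s V (twist scl \<pi> \<theta>)"
  then show "(real (conductor_U11 vF vE \<iota> s p scl V \<pi>) - 2) / 2 \<le> r"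
    using conductor_le_depth depth_least(1) by blast
qed

end

theorem theorem4p4p1:
  fixes vF :: "'f::field \<Rightarrow> int" and vE :: "'e::field \<Rightarrow> int"
    and \<iota> :: "'f \<Rightarrow> 'e" and s :: "'e \<Rightarrow> 'e" and p :: 'f
    and scl :: "complex \<Rightarrow> 'v \<Rightarrow> 'v::ab_group_add" and V :: "'v set"
    and \<pi>' :: "'e^2^2 \<Rightarrow> 'v \<Rightarrow> 'v"
  assumes "unramified_quadratic_extension vF vE \<iota> s"
    and "odd (residue_char vF)"
    and "p \<noteq> 0" and "vF p = 1"
    and "irreducible_representation scl V (U11 s) \<pi>'"
    and "admissible vE scl V (U11 s) \<pi>'"
    and "supercuspidal \<iota> scl V \<pi>'"
  shows "minimal_depth vF vE \<iota> s scl V \<pi>' = (real (conductor_U11 vF vE \<iota> s p scl V \<pi>') - 2) / 2 \<and>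
    (\<forall>W. W \<subseteq> V \<and> irreducible_representation scl W SL2 (\<lambda>g. \<pi>' (map_matrix \<iota> g)) \<longrightarrow>
       conductor_U11 vF vE \<iota> s p scl V \<pi>' =
       conductor_SL2 vF p scl W (\<lambda>g. \<pi>' (map_matrix \<iota> g)))"
proof -
  have U: "cuspidal_U11 vF vE \<iota> s p scl V \<pi>'"
    unfolding cuspidal_U11_def odd_unramified_quadratic_extension_def
      odd_unramified_quadratic_extension_axioms_def cuspidal_U11_axioms_def
    using assms by blast
  have "conductor_U11 vF vE \<iota> s p scl V \<pi>' = conductor_SL2 vF p scl W (\<lambda>g. \<pi>' (map_matrix \<iota> g))"
    if "W \<subseteq> V" "irreducible_representation scl W SL2 (\<lambda>g. \<pi>' (map_matrix \<iota> g))" for W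
  proof -
    have "cuspidal_constituent vF vE \<iota> s p scl V \<pi>' W"
      using U that by (simp add: cuspidal_constituent_def cuspidal_constituent_axioms_def)
    then show ?thesis
      using cuspidal_constituent.conductor_SL2_eq cuspidal_U11.conductor_U11_eq[OF U] by metis
  qed
  then show ?thesis using cuspidal_U11.minimal_depth_eq[OF U] by blast
qed

end
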